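(* Assume that, for some $\alpha\in(0,1)$: $c_T\in C^{(1+\alpha/2)}([0,T_{max}])$ and $c_T\ge0$ for every $T\in[0,T_{max}]$; the map $T\in[0,T_{max}]\mapsto c_T\in C^{(1+\alpha/2)}([0,T_{max}])$ is continuous; $m_0\in C^{(2+\alpha)}(\Gamma)$ with $m_0(v_0)=0$; and either $\partial_xm_0(v_0)>0$, or $\partial_xm_0(v_0)=\partial_x^2m_0(v_0)=0$. Then there exists a value $T\in[t_0,T_{max}]$ which is coherent with the expectations of the participants to the meeting, i.e. a fixed point $T=T^*$ of the scheme $T\to u\to m\to T^*$ defined in the context.
   Context: Network. $\Gamma\subset\mathbb R^n$ is a network: a finite set of vertices $V=\{v_i\}_{i\in I}$ connected by finitely many continuous, non self-intersecting arcs (edges) $E=\{e_j\}_{j\in J}$, each parametrized by a smooth $\pi_j:[0,l_j]\to\mathbb R^n$, $l_j>0$. $Inc_i=\{j\in J: e_j \text{ is incident to } v_i\}$, $I_B=\{i:\#Inc_i=1\}$, $I_T=I\setminus I_B$, $\partial\Gamma=\{v_i: i\in I_B\}$, $\Gamma_T=\{v_i:i\in I_T\}$. It is assumed that $\partial\Gamma=\{v_0\}$ is a single boundary vertex. $a_{ij}=1$ if $v_i\in e_j$ and $\pi_j(0)=v_i$, $a_{ij}=-1$ if $v_i\in e_j$ and $\pi_j(l_j)=v_i$, $a_{ij}=0$ otherwise. A point $x\in e_j$ is identified with $y=\pi_j^{-1}(x)\in[0,l_j]$; for $u:\Gamma\to\mathbb R$, $u_j(y)=u(\pi_j(y))$;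 $\partial_x^\gamma u$ (inside $e_j$) and $\partial_j^\gamma u(v_i)$ (at a vertex, $j\in Inc_i$) denote $\frac{d^\gamma u_j}{dy^\gamma}$ at the corresponding $y$. The unique edge $e_0$ incident to $v_0$ is parametrized so that $\pi_0(0)=v_0$; derivatives $\partial_x$ at $v_0$ are taken along $e_0$. $C^{(q+\alpha)}([a,b])$ is the usual Hölder space and $C^{(q+\alpha)}(\Gamma)=\{u\in C(\Gamma): u_j\in C^{(q+\alpha)}([0,l_j])\ \forall j\in J\}$. Data. $0<t_0<T_{max}$; $\theta\in(0,1)$; $m_0:\Gamma\to\mathbb R$ is the initial distribution (a probability density on $\Gamma$: $m_0\ge0$, $\int_\Gamma m_0=1$). The cost is $c_T(s)=c_1(s-t_0)+c_2(s-T)+c_3(T-s)$, $s\in[0,T_{max}]$, where $c_i:\mathbb R\to\mathbb R$ are smooth with $c_i(s)=0$ for $s\le0$ and $c_i(s)>0$ for $s>0$. Diffusion coefficients are normalized to $1$. The scheme. Given $T\in[t_0,T_{max}]$, let $(u,m)$ be the classical solution (continuous on $\Gamma\times[0,T_{max}]$, $C^{2,1}$ on each edge up to its endpoints for times in $(0,T_{max})$; it exists and is unique under the stated hypotheses on $c_T,m_0$) of: $\partial_tu+\partial_x^2u+\frac12|\partial_xu|^2=0$ and $\partial_tm-\partial_x^2m+\partial_x(\partial_xu\,m)=0$ in $\Gamma\times(0,T_{max})$; $\sum_{j\in Inc_i}a_{ij}\partial_ju(v_i,s)=0$ and $\sum_{j\in Inc_i}a_{ij}[\partial_jm-m\partial_ju](v_i,s)=0$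 for $(v_i,s)\in\Gamma_T\times(0,T_{max})$; $m(x,0)=m_0(x)$ and $u(x,T_{max})=c_T(T_{max})$ for $x\in\Gamma$; $m(v_0,s)=0$ and $u(v_0,s)=c_T(s)$ for $s\in[0,T_{max}]$. Set $F(s)=\int_0^s\partial_xm(v_0,r)\,dr$ (cumulative distribution of arrival times at $v_0$) and define $T^*$ by the quorum rule: $T^*=t_0$ if $F^{-1}(\theta)\le t_0$; $T^*=F^{-1}(\theta)$ if $t_0<F^{-1}(\theta)<T_{max}$; $T^*=T_{max}$ if $F^{-1}(\theta)\ge T_{max}$. Here $F^{-1}(\theta)=\inf\{s\in[0,T_{max}]:F(s)\ge\theta\}$, with the convention $F^{-1}(\theta)=+\infty$ if $F$ does not reach $\theta$ on $[0,T_{max}]$. *)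

theory Defs
  imports "HOL-Analysis.Analysis"
begin

section \<open>Functions of one real variable\<close>

text \<open>
  Iterated derivatives relative to a set. On a nondegenerate closed interval the
  derivatives at the end points are one-sided; on \<open>UNIV\<close> they are the usual ones.
\<close>

primrec deriv_within :: "real set \<Rightarrow> nat \<Rightarrow> (real \<Rightarrow> 'b::real_normed_vector) \<Rightarrow> real \<Rightarrow> 'b" where
  "deriv_within S 0 f = f"
| "deriv_within S (Suc k) f = (\<lambda>x. vector_derivative (deriv_within S k f) (at x within S))"

definition smooth_on :: "real set \<Rightarrow> (real \<Rightarrow> 'b::real_normed_vector) \<Rightarrow> bool" where
  "smooth_on S f \<longleftrightarrow> (\<forall>k. \<forall>x\<in>S. deriv_within S k f differentiable (at x within S))"

definition Ck_on :: "real set \<Rightarrow> nat \<Rightarrow> (real \<Rightarrow> real) \<Rightarrow> bool" where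
  "Ck_on S q f \<longleftrightarrow>
     (\<forall>k<q. \<forall>x\<in>S. deriv_within S k f differentiable (at x within S)) \<and>
     continuous_on S (deriv_within S q f)"

text \<open>\<open>hoelder_on S q \<alpha>\<close> is the class \<open>C\<^sup>(\<^sup>q\<^sup>+\<^sup>\<alpha>\<^sup>)\<close> on \<open>S\<close>, meant for compact intervals \<open>S\<close>.\<close>

definition hoelder_on :: "real set \<Rightarrow> nat \<Rightarrow> real \<Rightarrow> (real \<Rightarrow> real) \<Rightarrow> bool" where
  "hoelder_on S q \<alpha> f \<longleftrightarrow> Ck_on S q f \<and>
     (\<exists>C. \<forall>x\<in>S. \<forall>y\<in>S. \<bar>deriv_within S q f x - deriv_within S q f y\<bar> \<le> C * \<bar>x - y\<bar> powr \<alpha>)"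

definition hoelder_norm :: "real set \<Rightarrow> nat \<Rightarrow> real \<Rightarrow> (real \<Rightarrow> real) \<Rightarrow> real" where
  "hoelder_norm S q \<alpha> f =
     (\<Sum>k\<le>q. SUP x\<in>S. \<bar>deriv_within S k f x\<bar>) +
     (SUP (x, y)\<in>{(x, y). x \<in> S \<and> y \<in> S \<and> x \<noteq> y}.
        \<bar>deriv_within S q f x - deriv_within S q f y\<bar> / \<bar>x - y\<bar> powr \<alpha>)"


section \<open>Networks\<close>

record ('i, 'j, 'n::finite) network =
  vertex_idx :: "'i set"
  edge_idx :: "'j set"
  vertex :: "'i \<Rightarrow> real ^ 'n"
  edge_length :: "'j \<Rightarrow> real"
  edge_param :: "'j \<Rightarrow> real \<Rightarrow> real ^ 'n"

definition vertices :: "('i, 'j, 'n::finite) network \<Rightarrow> (real ^ 'n) set" where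
  "vertices N = vertex N ` vertex_idx N"

definition edge :: "('i, 'j, 'n::finite) network \<Rightarrow> 'j \<Rightarrow> (real ^ 'n) set" where
  "edge N j = edge_param N j ` {0..edge_length N j}"

definition open_edge :: "('i, 'j, 'n::finite) network \<Rightarrow> 'j \<Rightarrow> (real ^ 'n) set" where
  "open_edge N j = edge_param N j ` {0<..<edge_length N j}"

definition net_points :: "('i, 'j, 'n::finite) network \<Rightarrow> (real ^ 'n) set" where
  "net_points N = vertices N \<union> (\<Union>j\<in>edge_idx N. edge N j)"

text \<open>
  Edges are injectively parametrized arcs (in particular no loops, which makes the incidence
  coefficients below unambiguous) that meet the vertex set exactly at their end points and each
  other only at vertices. Several edges may join the same pair of vertices, and connectedness
  is not required.
\<close>

definition is_network :: "('i, 'j, 'n::finite) network \<Rightarrow> bool" where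
  "is_network N \<longleftrightarrow>
     finite (vertex_idx N) \<and> finite (edge_idx N) \<and> inj_on (vertex N) (vertex_idx N) \<and>
     (\<forall>j\<in>edge_idx N.
        edge_length N j > 0 \<and>
        smooth_on {0..edge_length N j} (edge_param N j) \<and>
        inj_on (edge_param N j) {0..edge_length N j} \<and>
        edge_param N j 0 \<in> vertices N \<and> edge_param N j (edge_length N j) \<in> vertices N \<and>
        open_edge N j \<inter> vertices N = {}) \<and>
     (\<forall>j\<in>edge_idx N. \<forall>k\<in>edge_idx N. j \<noteq> k \<longrightarrow> edge N j \<inter> edge N k \<subseteq> vertices N)"

definition Inc :: "('i, 'j, 'n::finite) network \<Rightarrow> 'i \<Rightarrow> 'j set" where
  "Inc N i = {j \<in> edge_idx N. vertex N i \<in> edge N j}"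

definition boundary_idx :: "('i, 'j, 'n::finite) network \<Rightarrow> 'i set" where
  "boundary_idx N = {i \<in> vertex_idx N. card (Inc N i) = 1}"

definition transition_idx :: "('i, 'j, 'n::finite) network \<Rightarrow> 'i set" where
  "transition_idx N = vertex_idx N - boundary_idx N"

definition inc_coeff :: "('i, 'j, 'n::finite) network \<Rightarrow> 'i \<Rightarrow> 'j \<Rightarrow> real" where
  "inc_coeff N i j =
     (if edge_param N j 0 = vertex N i then 1
      else if edge_param N j (edge_length N j) = vertex N i then -1
      else 0)"

definition on_edge :: "('i, 'j, 'n::finite) network \<Rightarrow> 'j \<Rightarrow> (real ^ 'n \<Rightarrow> real) \<Rightarrow> real \<Rightarrow> real" where
  "on_edge N j f = (\<lambda>y. f (edge_param N j y))"

text \<open>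
  \<open>edge_deriv N j k f x\<close> is the \<open>k\<close>-th derivative along edge \<open>j\<close> at the point \<open>x\<close> of that edge,
  with respect to the parameter of the edge; it serves both inside the edge and, one-sidedly,
  at its two end vertices.
\<close>

definition edge_deriv ::
  "('i, 'j, 'n::finite) network \<Rightarrow> 'j \<Rightarrow> nat \<Rightarrow> (real ^ 'n \<Rightarrow> real) \<Rightarrow> real ^ 'n \<Rightarrow> real" where
  "edge_deriv N j k f x =
     deriv_within {0..edge_length N j} k (on_edge N j f)
       (the_inv_into {0..edge_length N j} (edge_param N j) x)"

definition hoelder_net ::
  "('i, 'j, 'n::finite) network \<Rightarrow> nat \<Rightarrow> real \<Rightarrow> (real ^ 'n \<Rightarrow> real) \<Rightarrow> bool" where
  "hoelder_net N q \<alpha> f \<longleftrightarrow> continuous_on (net_points N) f \<and>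
     (\<forall>j\<in>edge_idx N. hoelder_on {0..edge_length N j} q \<alpha> (on_edge N j f))"

text \<open>The integral over the network is taken with respect to the edge parameters.\<close>

definition prob_density :: "('i, 'j, 'n::finite) network \<Rightarrow> (real ^ 'n \<Rightarrow> real) \<Rightarrow> bool" where
  "prob_density N f \<longleftrightarrow> (\<forall>x\<in>net_points N. 0 \<le> f x) \<and>
     (\<forall>j\<in>edge_idx N. on_edge N j f integrable_on {0..edge_length N j}) \<and>
     (\<Sum>j\<in>edge_idx N. integral {0..edge_length N j} (on_edge N j f)) = 1"


section \<open>The mean field game system\<close>

definition penalty :: "(real \<Rightarrow> real) \<Rightarrow> bool" where
  "penalty c \<longleftrightarrow> smooth_on UNIV c \<and> (\<forall>s\<le>0. c s = 0) \<and> (\<forall>s>0. c s > 0)"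

definition meeting_cost ::
  "(real \<Rightarrow> real) \<Rightarrow> (real \<Rightarrow> real) \<Rightarrow> (real \<Rightarrow> real) \<Rightarrow> real \<Rightarrow> real \<Rightarrow> real \<Rightarrow> real" where
  "meeting_cost c1 c2 c3 t0 T s = c1 (s - t0) + c2 (s - T) + c3 (T - s)"

text \<open>
  Functions on the network times a time interval are curried. The first conjunct below is
  continuity up to the initial and final times; the others say that \<open>u\<close> is \<open>C\<^sup>2\<^sup>,\<^sup>1\<close> on each closed
  edge for times in the open interval.
\<close>

definition classical_regularity ::
  "('i, 'j, 'n::finite) network \<Rightarrow> real \<Rightarrow> (real ^ 'n \<Rightarrow> real \<Rightarrow> real) \<Rightarrow> bool" where
  "classical_regularity N Tmax u \<longleftrightarrow>
     continuous_on (net_points N \<times> {0..Tmax}) (\<lambda>(x, s). u x s) \<and>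
     (\<forall>j\<in>edge_idx N.
        (\<forall>s\<in>{0<..<Tmax}. Ck_on {0..edge_length N j} 2 (on_edge N j (\<lambda>x. u x s))) \<and>
        (\<forall>k\<le>2. continuous_on ({0..edge_length N j} \<times> {0<..<Tmax})
           (\<lambda>(y, s). deriv_within {0..edge_length N j} k (on_edge N j (\<lambda>x. u x s)) y)) \<and>
        (\<forall>x\<in>edge N j. \<forall>s\<in>{0<..<Tmax}. u x differentiable (at s)) \<and>
        continuous_on ({0..edge_length N j} \<times> {0<..<Tmax})
           (\<lambda>(y, s). deriv (u (edge_param N j y)) s))"

definition HJB_solution ::
  "('i, 'j, 'n::finite) network \<Rightarrow> 'i \<Rightarrow> real \<Rightarrow> (real \<Rightarrow> real) \<Rightarrow>
     (real ^ 'n \<Rightarrow> real \<Rightarrow> real) \<Rightarrow> bool" where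
  "HJB_solution N i0 Tmax c u \<longleftrightarrow>
     classical_regularity N Tmax u \<and>
     (\<forall>j\<in>edge_idx N. \<forall>x\<in>open_edge N j. \<forall>s\<in>{0<..<Tmax}.
        deriv (u x) s + edge_deriv N j 2 (\<lambda>x. u x s) x
          + 1/2 * \<bar>edge_deriv N j 1 (\<lambda>x. u x s) x\<bar>^2 = 0) \<and>
     (\<forall>i\<in>transition_idx N. \<forall>s\<in>{0<..<Tmax}.
        (\<Sum>j\<in>Inc N i. inc_coeff N i j * edge_deriv N j 1 (\<lambda>x. u x s) (vertex N i)) = 0) \<and>
     (\<forall>x\<in>net_points N. u x Tmax = c Tmax) \<and>
     (\<forall>s\<in>{0..Tmax}. u (vertex N i0) s = c s)"

definition FP_solution ::
  "('i, 'j, 'n::finite) network \<Rightarrow> 'i \<Rightarrow> real \<Rightarrow> (real ^ 'n \<Rightarrow> real) \<Rightarrow>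
     (real ^ 'n \<Rightarrow> real \<Rightarrow> real) \<Rightarrow> (real ^ 'n \<Rightarrow> real \<Rightarrow> real) \<Rightarrow> bool" where
  "FP_solution N i0 Tmax m0 u m \<longleftrightarrow>
     classical_regularity N Tmax m \<and>
     (\<forall>j\<in>edge_idx N. \<forall>x\<in>open_edge N j. \<forall>s\<in>{0<..<Tmax}.
        deriv (m x) s - edge_deriv N j 2 (\<lambda>x. m x s) x
          + edge_deriv N j 1 (\<lambda>x. edge_deriv N j 1 (\<lambda>x. u x s) x * m x s) x = 0) \<and>
     (\<forall>i\<in>transition_idx N. \<forall>s\<in>{0<..<Tmax}.
        (\<Sum>j\<in>Inc N i. inc_coeff N i j *
           (edge_deriv N j 1 (\<lambda>x. m x s) (vertex N i)
             - m (vertex N i) s * edge_deriv N j 1 (\<lambda>x. u x s) (vertex N i))) = 0) \<and>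
     (\<forall>x\<in>net_points N. m x 0 = m0 x) \<and>
     (\<forall>s\<in>{0..Tmax}. m (vertex N i0) s = 0)"

definition MFG_solution ::
  "('i, 'j, 'n::finite) network \<Rightarrow> 'i \<Rightarrow> real \<Rightarrow> (real \<Rightarrow> real) \<Rightarrow> (real ^ 'n \<Rightarrow> real) \<Rightarrow>
     (real ^ 'n \<Rightarrow> real \<Rightarrow> real) \<Rightarrow> (real ^ 'n \<Rightarrow> real \<Rightarrow> real) \<Rightarrow> bool" where
  "MFG_solution N i0 Tmax c m0 u m \<longleftrightarrow> HJB_solution N i0 Tmax c u \<and> FP_solution N i0 Tmax m0 u m"


section \<open>The quorum rule\<close>

definition arrival_cdf ::
  "('i, 'j, 'n::finite) network \<Rightarrow> 'i \<Rightarrow> 'j \<Rightarrow> (real ^ 'n \<Rightarrow> real \<Rightarrow> real) \<Rightarrow> real \<Rightarrow> real" where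
  "arrival_cdf N i0 j0 m s = integral {0..s} (\<lambda>r. edge_deriv N j0 1 (\<lambda>x. m x r) (vertex N i0))"

text \<open>The infimum is taken in the extended reals, so it is \<open>\<infinity>\<close> if \<open>F\<close> does not reach \<open>\<theta>\<close>.\<close>

definition quantile :: "real \<Rightarrow> (real \<Rightarrow> real) \<Rightarrow> real \<Rightarrow> ereal" where
  "quantile Tmax F \<theta> = Inf (ereal ` {s \<in> {0..Tmax}. F s \<ge> \<theta>})"

definition quorum_time :: "real \<Rightarrow> real \<Rightarrow> real \<Rightarrow> (real \<Rightarrow> real) \<Rightarrow> real" where
  "quorum_time t0 Tmax \<theta> F =
     (if quantile Tmax F \<theta> \<le> ereal t0 then t0
      else if quantile Tmax F \<theta> < ereal Tmax then real_of_ereal (quantile Tmax F \<theta>)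
      else Tmax)"

end

theory Submission
  imports Defs "HOL-Probability.Probability" "HOL-Complex_Analysis.Complex_Analysis"
begin

text \<open>
  The coupled system is linear in disguise. With \<open>w = exp (u / 2)\<close> and \<open>p = m / w\<close> the
  Hamilton--Jacobi equation becomes the backward heat equation for \<open>w\<close>, the Fokker--Planck equation
  becomes the forward heat equation for \<open>p\<close>, and both transition conditions become the Kirchhoff
  condition. The data are \<open>w = exp (c / 2)\<close> at the exit vertex with constant final value, and \<open>p = 0\<close>
  at the exit vertex with initial value \<open>m\<^sub>0 / w\<close>. So everything rests on the heat equation on a metric
  graph with one Dirichlet vertex.

  Uniqueness, \<open>w \<ge> 1\<close>, \<open>p \<ge> 0\<close> and continuous dependence on the cost all follow from the maximum
  principle (\<open>max_principle\<close>): since the equation holds up to the ends of each edge, a maximum at a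
  transition vertex is excluded by the same second derivative test as one inside an edge.

  Existence is explicit. The initial function on each edge is extended to the whole line by repeated
  reflection at the ends, \<open>f\<^sub>a(-z) = (2/d) \<Sum> f\<^sub>b(z) - f\<^sub>a(z)\<close> at a vertex with \<open>d\<close> incident edges. The
  extensions grow at most exponentially, so the Gaussian average of each of them is a solution on the
  line, and parity at the vertex turns the reflection rule into continuity and the Kirchhoff condition
  (\<open>heat_sol_exists\<close>). At the Dirichlet vertex the rule \<open>f(-z) = 2 B(z) - f(z)\<close> produces the boundary
  values of the heat flow of \<open>B\<close>; the choice \<open>B(z) = z\<^sup>2 / 2\<close> gives the boundary value \<open>t\<close>, and a general
  smooth boundary value is a superposition of this solution and its time integral by Taylor's formula
  (\<open>heat_sol_with_boundary_data\<close>).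

  Now let \<open>F\<^sub>\<tau>\<close> be the distribution of the arrival times when the announced time is \<open>\<tau>\<close>. Mass is lost
  only through the exit, so \<open>F\<^sub>\<tau>(s)\<close> is the mass lost up to time \<open>s\<close>; it is continuous in \<open>s\<close> and, by the
  maximum principle, in \<open>\<tau>\<close>. It is nondecreasing because \<open>p \<ge> 0\<close>, and its derivative is a positive
  factor times the flux of \<open>p\<close>, which is a real-analytic function of time
  (\<open>heat_flow_y_unique_continuation\<close>). Hence \<open>F\<^sub>\<tau>\<close> cannot be constant on an interval unless it
  vanishes, and if \<open>F\<^sub>\<tau>(\<tau>) = \<theta>\<close> then \<open>\<tau>\<close> is exactly the \<open>\<theta>\<close>-quantile. The intermediate value theorem
  for \<open>\<tau> \<mapsto> F\<^sub>\<tau>(\<tau>)\<close> yields such a \<open>\<tau>\<close>, unless one of the two end points of the time window is already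
  a fixed point (\<open>quorum_fixed_point\<close>).
\<close>

section \<open>Integrals over the line that depend on a parameter\<close>

text \<open>
  Difference quotients are bounded by the bound on the derivative, because the parameter set is convex,
  so dominated convergence applies. The lemma is stated over a normed field since it serves both the
  real heat kernel and a complex parameter.
\<close>

lemma has_field_derivative_lborel_integral:
  fixes K K' :: "'a::{real_normed_field, banach, second_countable_topology} \<Rightarrow> real \<Rightarrow> 'a"
  assumes S: "open S" "convex S" "p0 \<in> S"
    and der: "\<And>p z. p \<in> S \<Longrightarrow> ((\<lambda>p. K p z) has_field_derivative K' p z) (at p)"
    and bound: "\<And>p z. p \<in> S \<Longrightarrow> norm (K' p z) \<le> h z"
    and h: "integrable lborel h"
    and int: "\<And>p. p \<in> S \<Longrightarrow> integrable lborel (K p)"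
    and meas: "K' p0 \<in> borel_measurable lborel"
  shows "((\<lambda>p. \<integral>z. K p z \<partial>lborel) has_field_derivative (\<integral>z. K' p0 z \<partial>lborel)) (at p0)"
proof -
  let ?I = "\<lambda>p. \<integral>z. K p z \<partial>lborel"
  let ?Q = "\<lambda>p z. (K p z - K p0 z) / (p - p0)"
  have "((\<lambda>p. (?I p - ?I p0) / (p - p0)) \<longlongrightarrow> (\<integral>z. K' p0 z \<partial>lborel)) (at p0)"
    unfolding tendsto_at_iff_sequentially comp_def
  proof (intro allI impI)
    fix X :: "nat \<Rightarrow> 'a"
    assume X: "\<forall>i. X i \<in> UNIV - {p0}" "X \<longlonglongrightarrow> p0"
    \<comment> \<open>Drop finitely many terms, so that the whole sequence stays in the set where the bound holds.\<close>
    have "\<forall>\<^sub>F n in sequentially. X n \<in> S"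
      using X(2) S(1,3) by (rule topological_tendstoD)
    then obtain n0 where n0: "\<And>n. n \<ge> n0 \<Longrightarrow> X n \<in> S"
      unfolding eventually_sequentially by blast
    define Y where "Y n = X (n + n0)" for n
    have YS: "Y n \<in> S" "Y n \<noteq> p0" for n
      using n0 X(1) by (auto simp: Y_def)
    have Y: "Y \<longlonglongrightarrow> p0"
      unfolding Y_def by (rule LIMSEQ_ignore_initial_segment[OF X(2)])
    have "(\<lambda>n. \<integral>z. ?Q (Y n) z \<partial>lborel) \<longlonglongrightarrow> (\<integral>z. K' p0 z \<partial>lborel)"
    proof (rule integral_dominated_convergence[where w = h])
      show "K' p0 \<in> borel_measurable lborel" by (rule meas)
      show "?Q (Y n) \<in> borel_measurable lborel" for n
        using borel_measurable_integrable[OF int[OF YS(1)]] borel_measurable_integrable[OF int[OF S(3)]]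
        by measurable
      show "integrable lborel h" by (rule h)
      show "AE z in lborel. (\<lambda>n. ?Q (Y n) z) \<longlonglongrightarrow> K' p0 z"
      proof (rule AE_I2)
        fix z
        have "((\<lambda>p. ?Q p z) \<longlongrightarrow> K' p0 z) (at p0)"
          using der[OF S(3), of z] by (simp add: has_field_derivative_iff)
        then show "(\<lambda>n. ?Q (Y n) z) \<longlonglongrightarrow> K' p0 z"
          unfolding tendsto_at_iff_sequentially comp_def using YS Y by auto
      qed
      show "AE z in lborel. norm (?Q (Y n) z) \<le> h z" for n
      proof (rule AE_I2)
        fix z
        have "norm (K (Y n) z - K p0 z) \<le> h z * norm (Y n - p0)"
          using S YS by (intro field_differentiable_bound[of S "\<lambda>p. K p z" "\<lambda>p. K' p z"])
            (auto intro: bound has_field_derivative_at_within der)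
        then show "norm (?Q (Y n) z) \<le> h z"
          using YS(2)[of n] by (simp add: norm_divide divide_le_eq)
      qed
    qed
    moreover have Q: "(\<integral>z. ?Q (Y n) z \<partial>lborel) = (?I (Y n) - ?I p0) / (Y n - p0)" for n
      using int[OF YS(1)] int[OF S(3)] YS(2)[of n] by simp
    ultimately have "(\<lambda>n. (?I (Y n) - ?I p0) / (Y n - p0)) \<longlonglongrightarrow> (\<integral>z. K' p0 z \<partial>lborel)"
      by (simp only: Q)
    then have "(\<lambda>n. (?I (X (n + n0)) - ?I p0) / (X (n + n0) - p0)) \<longlonglongrightarrow> (\<integral>z. K' p0 z \<partial>lborel)"
      by (simp add: Y_def)
    then show "(\<lambda>n. (?I (X n) - ?I p0) / (X n - p0)) \<longlonglongrightarrow> (\<integral>z. K' p0 z \<partial>lborel)"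
      by (rule LIMSEQ_offset)
  qed
  then show ?thesis
    by (simp add: has_field_derivative_iff)
qed

lemma continuous_on_lborel_integral:
  fixes K :: "'p::first_countable_topology \<Rightarrow> real \<Rightarrow> real"
  assumes cont: "\<And>z. continuous_on S (\<lambda>p. K p z)"
    and bound: "\<And>p z. p \<in> S \<Longrightarrow> \<bar>K p z\<bar> \<le> h z"
    and h: "integrable lborel h"
    and meas: "\<And>p. p \<in> S \<Longrightarrow> K p \<in> borel_measurable lborel"
  shows "continuous_on S (\<lambda>p. \<integral>z. K p z \<partial>lborel)"
  unfolding continuous_on_def tendsto_at_iff_sequentially comp_def
proof (intro ballI allI impI)
  fix p and X :: "nat \<Rightarrow> 'p"
  assume p: "p \<in> S" and X: "\<forall>i. X i \<in> S - {p}" "X \<longlonglongrightarrow> p"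
  show "(\<lambda>n. \<integral>z. K (X n) z \<partial>lborel) \<longlonglongrightarrow> (\<integral>z. K p z \<partial>lborel)"
  proof (rule integral_dominated_convergence[where w = h])
    show "AE z in lborel. (\<lambda>n. K (X n) z) \<longlonglongrightarrow> K p z"
      using continuous_on_tendsto_compose[OF cont X(2) p] X(1) by auto
  qed (use p X h meas bound in auto)
qed

section \<open>The heat flow on the line\<close>

definition exp_growth :: "(real \<Rightarrow> real) \<Rightarrow> bool" where
  "exp_growth f \<longleftrightarrow> (\<exists>A k. \<forall>z. \<bar>f z\<bar> \<le> A * exp (k * \<bar>z\<bar>))"

lemma exp_growthE:
  assumes "exp_growth f"
  obtains A k where "A > 0" "k > 0" "\<And>z. \<bar>f z\<bar> \<le> A * exp (k * \<bar>z\<bar>)"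
proof -
  obtain A k where *: "\<And>z. \<bar>f z\<bar> \<le> A * exp (k * \<bar>z\<bar>)"
    using assms unfolding exp_growth_def by blast
  have "\<bar>f z\<bar> \<le> (\<bar>A\<bar> + 1) * exp ((\<bar>k\<bar> + 1) * \<bar>z\<bar>)" for z
    by (rule order.trans[OF *]) (intro mult_mono, auto intro!: mult_right_mono)
  then show ?thesis by (intro that[of "\<bar>A\<bar> + 1" "\<bar>k\<bar> + 1"]) auto
qed

lemma exp_growth_add:
  assumes "exp_growth f" "exp_growth g" shows "exp_growth (\<lambda>z. f z + g z)"
proof -
  obtain A k where f: "A > 0" "k > 0" "\<And>z. \<bar>f z\<bar> \<le> A * exp (k * \<bar>z\<bar>)" using exp_growthE[OF assms(1)] by blast
  obtain B l where g: "B > 0" "l > 0" "\<And>z. \<bar>g z\<bar> \<le> B * exp (l * \<bar>z\<bar>)" using exp_growthE[OF assms(2)] by blast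
  have "\<bar>f z + g z\<bar> \<le> (A + B) * exp ((k + l) * \<bar>z\<bar>)" for z
  proof -
    have "\<bar>f z + g z\<bar> \<le> A * exp (k * \<bar>z\<bar>) + B * exp (l * \<bar>z\<bar>)" using f(3)[of z] g(3)[of z] by linarith
    also have "\<dots> \<le> A * exp ((k + l) * \<bar>z\<bar>) + B * exp ((k + l) * \<bar>z\<bar>)"
      using f g by (intro add_mono mult_left_mono) (auto intro!: mult_right_mono)
    finally show ?thesis by (simp add: algebra_simps)
  qed
  then show ?thesis unfolding exp_growth_def by blast
qed

lemma exp_growth_cmult: assumes "exp_growth f" shows "exp_growth (\<lambda>z. c * f z)"
proof -
  obtain A k where f: "A > 0" "k > 0" "\<And>z. \<bar>f z\<bar> \<le> A * exp (k * \<bar>z\<bar>)" using exp_growthE[OF assms(1)] by blast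
  have "\<bar>c * f z\<bar> \<le> (\<bar>c\<bar> * A) * exp (k * \<bar>z\<bar>)" for z
    unfolding abs_mult using mult_left_mono[OF f(3)[of z], of "\<bar>c\<bar>"] by (simp add: mult.assoc)
  then show ?thesis unfolding exp_growth_def by blast
qed

lemma exp_growth_sum:
  assumes "\<And>i. i \<in> I \<Longrightarrow> exp_growth (f i)" shows "exp_growth (\<lambda>z. \<Sum>i\<in>I. f i z)"
proof (cases "finite I")
  case True
  then show ?thesis using assms
  proof (induction I rule: finite_induct)
    case empty then show ?case by (auto simp: exp_growth_def intro!: exI[of _ 0])
  next
    case (insert x I)
    then show ?case by (auto intro!: exp_growth_add)
  qed
next
  case False then show ?thesis by (auto simp: exp_growth_def intro!: exI[of _ 0])
qed

lemma exp_growth_affine: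
  assumes "exp_growth f" shows "exp_growth (\<lambda>z. f (a + c * z))"
proof -
  obtain A k where f: "A > 0" "k > 0" "\<And>z. \<bar>f z\<bar> \<le> A * exp (k * \<bar>z\<bar>)" using exp_growthE[OF assms(1)] by blast
  have "\<bar>f (a + c * z)\<bar> \<le> (A * exp (k * \<bar>a\<bar>)) * exp ((k * \<bar>c\<bar>) * \<bar>z\<bar>)" for z
  proof -
    have "\<bar>f (a + c * z)\<bar> \<le> A * exp (k * \<bar>a + c * z\<bar>)" by (rule f)
    also have "\<dots> \<le> A * exp (k * (\<bar>a\<bar> + \<bar>c\<bar> * \<bar>z\<bar>))"
      using f abs_triangle_ineq[of a "c * z"] by (intro mult_left_mono) (auto simp: abs_mult)
    finally show ?thesis by (simp add: algebra_simps exp_add)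
  qed
  then show ?thesis unfolding exp_growth_def by blast
qed

lemma integrable_exp_neg_abs: "integrable lborel (\<lambda>z::real. exp (- \<bar>z\<bar>))"
proof -
  have "set_integrable lborel {0<..} (\<lambda>x::real. exp (- x))"
    using integrable_I0i_exp_mscale[of 1] by simp
  then have 1: "integrable lborel (\<lambda>x::real. indicator {0<..} x * exp (- x))"
    by (simp add: set_integrable_def)
  then have 2: "integrable lborel (\<lambda>x::real. indicator {0<..} (-x) * exp (- (- x)))"
    using lborel_integrable_real_affine[OF 1, of "-1" 0] by simp
  have "integrable lborel (\<lambda>x::real. indicator {0<..} x * exp (- x) + indicator {0<..} (-x) * exp x)"
    using 1 2 by (intro Bochner_Integration.integrable_add) auto
  then show ?thesis
    by (rule Bochner_Integration.integrable_cong_AE_imp)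
       (auto intro!: AE_I[where N="{0}"] split: split_indicator)
qed

lemma std_normal_density_le_exp: "std_normal_density x \<le> exp (k\<^sup>2 / 2) * exp (- (k * \<bar>x\<bar>))"
proof -
  have "std_normal_density x \<le> 1 * exp (- x\<^sup>2 / 2)"
    unfolding std_normal_density_def
    by (intro mult_right_mono) (use pi_gt3 in \<open>auto simp: divide_le_eq\<close>)
  also have "\<dots> \<le> exp (k\<^sup>2 / 2 + - (k * \<bar>x\<bar>))"
    using zero_le_power2[of "k - \<bar>x\<bar>"] by (simp add: power2_diff)
  finally show ?thesis by (simp add: exp_add[symmetric])
qed

text \<open>
  The weight \<open>P\<close> is \<open>1\<close> for the heat flow itself and a Hermite polynomial for its space derivatives.
\<close>

definition gauss_avg :: "(real \<Rightarrow> real) \<Rightarrow> (real \<Rightarrow> real) \<Rightarrow> real \<Rightarrow> real \<Rightarrow> real" where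
  "gauss_avg P f y r = (\<integral>x. std_normal_density x * P x * f (y + r * x) \<partial>lborel)"

text \<open>
  The Gaussian beats any exponential, so one integrable majorant works for all bounded parameters. The
  factor \<open>exp (- N \<bar>x\<bar>)\<close> taken from the Gaussian pays for the growth of \<open>P\<close> and of \<open>f\<close> and leaves
  \<open>exp (- \<bar>x\<bar>)\<close>.
\<close>

lemma gauss_avg_bound:
  assumes P: "continuous_on UNIV P" "exp_growth P" and f: "continuous_on UNIV f" "exp_growth f"
  obtains C where "\<And>y r x. \<bar>y\<bar> \<le> M \<Longrightarrow> \<bar>r\<bar> \<le> M \<Longrightarrow>
      \<bar>std_normal_density x * P x * f (y + r * x)\<bar> \<le> C * exp (- \<bar>x\<bar>)"
proof -
  obtain A k where f: "A > 0" "k > 0" "\<And>z. \<bar>f z\<bar> \<le> A * exp (k * \<bar>z\<bar>)" using exp_growthE[OF f(2)] by blast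
  obtain B l where P: "B > 0" "l > 0" "\<And>z. \<bar>P z\<bar> \<le> B * exp (l * \<bar>z\<bar>)" using exp_growthE[OF P(2)] by blast
  define N where "N = l + k * M + 1"
  have "\<bar>std_normal_density x * P x * f (y + r * x)\<bar>
      \<le> (exp (N\<^sup>2 / 2) * B * A * exp (k * M)) * exp (- \<bar>x\<bar>)" if yr: "\<bar>y\<bar> \<le> M" "\<bar>r\<bar> \<le> M" for y r x
  proof -
    have "\<bar>f (y + r * x)\<bar> \<le> A * exp (k * (M + M * \<bar>x\<bar>))"
    proof (rule order.trans[OF f(3)])
      have "\<bar>y + r * x\<bar> \<le> M + M * \<bar>x\<bar>"
        using yr by (intro order.trans[OF abs_triangle_ineq] add_mono) (auto simp: abs_mult intro!: mult_right_mono)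
      then show "A * exp (k * \<bar>y + r * x\<bar>) \<le> A * exp (k * (M + M * \<bar>x\<bar>))"
        using f by auto
    qed
    then have "\<bar>std_normal_density x * P x * f (y + r * x)\<bar>
        \<le> (exp (N\<^sup>2 / 2) * exp (- (N * \<bar>x\<bar>))) * (B * exp (l * \<bar>x\<bar>)) * (A * exp (k * (M + M * \<bar>x\<bar>)))"
      unfolding abs_mult using P f std_normal_density_le_exp[of x N]
      by (intro mult_mono) (auto simp: normal_density_nonneg)
    also have "\<dots> = (exp (N\<^sup>2 / 2) * B * A * exp (k * M)) * (exp (- (N * \<bar>x\<bar>)) * exp (l * \<bar>x\<bar>) * exp (k * M * \<bar>x\<bar>))"
      by (simp add: algebra_simps exp_add)
    also have "exp (- (N * \<bar>x\<bar>)) * exp (l * \<bar>x\<bar>) * exp (k * M * \<bar>x\<bar>) = exp (- \<bar>x\<bar>)"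
      unfolding exp_add[symmetric] N_def by (simp add: algebra_simps)
    finally show ?thesis .
  qed
  then show ?thesis using that by blast
qed

lemma continuous_on_gauss_avg:
  assumes P: "continuous_on UNIV P" "exp_growth P" and f: "continuous_on UNIV f" "exp_growth f"
  shows "continuous_on UNIV (\<lambda>(y, r). gauss_avg P f y r)"
proof -
  have "continuous_on (ball 0 M) (\<lambda>p::real\<times>real. gauss_avg P f (fst p) (snd p))" for M :: real
  proof -
    obtain C where C: "\<And>y r x. \<bar>y\<bar> \<le> M \<Longrightarrow> \<bar>r\<bar> \<le> M \<Longrightarrow>
      \<bar>std_normal_density x * P x * f (y + r * x)\<bar> \<le> C * exp (- \<bar>x\<bar>)"
      using gauss_avg_bound[OF P f] by blast
    have Pm: "P \<in> borel_measurable lborel" using P by (simp add: borel_measurable_continuous_onI)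
    show ?thesis
      unfolding gauss_avg_def
    proof (rule continuous_on_lborel_integral[where h = "\<lambda>x. C * exp (- \<bar>x\<bar>)"])
      show "continuous_on (ball 0 M) (\<lambda>p. std_normal_density z * P z * f (fst p + snd p * z))" for z
        by (intro continuous_intros continuous_on_compose2[OF f(1)]) auto
      show "\<bar>std_normal_density z * P z * f (fst p + snd p * z)\<bar> \<le> C * exp (- \<bar>z\<bar>)"
        if "p \<in> ball 0 M" for p :: "real\<times>real" and z
        using that norm_fst_le[of "fst p" "snd p"] norm_snd_le[of "snd p" "fst p"] by (intro C) auto
      show "integrable lborel (\<lambda>x. C * exp (- \<bar>x\<bar>))"
        using integrable_exp_neg_abs by simp
      show "(\<lambda>z. std_normal_density z * P z * f (fst p + snd p * z)) \<in> borel_measurable lborel" for p :: "real\<times>real"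
        using Pm borel_measurable_continuous_onI[OF f(1)] by measurable
    qed
  qed
  then have "continuous_on (\<Union>M\<in>(UNIV::real set). ball 0 M) (\<lambda>p::real\<times>real. gauss_avg P f (fst p) (snd p))"
    by (intro continuous_on_open_UN) auto
  moreover have "(\<Union>M\<in>(UNIV::real set). ball (0::real\<times>real) M) = UNIV"
    by (auto intro!: gt_ex)
  ultimately show ?thesis by (simp add: case_prod_beta)
qed

lemma integrable_gauss_avg:
  assumes P: "continuous_on UNIV P" "exp_growth P" and f: "continuous_on UNIV f" "exp_growth f"
  shows "integrable lborel (\<lambda>x. std_normal_density x * P x * f (y + r * x))"
proof -
  obtain C where C: "\<And>x. \<bar>std_normal_density x * P x * f (y + r * x)\<bar> \<le> C * exp (- \<bar>x\<bar>)"
    using gauss_avg_bound[OF P f, of "max \<bar>y\<bar> \<bar>r\<bar>"] by (metis max.cobounded1 max.cobounded2)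
  have Pm: "P \<in> borel_measurable lborel" using P by (simp add: borel_measurable_continuous_onI)
  show ?thesis
  proof (rule Bochner_Integration.integrable_bound[where f = "\<lambda>x. C * exp (- \<bar>x\<bar>)"])
    show "integrable lborel (\<lambda>x. C * exp (- \<bar>x\<bar>))"
      using integrable_exp_neg_abs by simp
    show "(\<lambda>x. std_normal_density x * P x * f (y + r * x)) \<in> borel_measurable lborel"
      using Pm borel_measurable_continuous_onI[OF f(1)] by measurable
    show "AE x in lborel. norm (std_normal_density x * P x * f (y + r * x)) \<le> norm (C * exp (- \<bar>x\<bar>))"
      using C by (auto intro!: AE_I2 intro: order.trans[OF _ abs_ge_self])
  qed
qed

definition heat_kernel :: "real \<Rightarrow> real \<Rightarrow> real" where
  "heat_kernel t x = exp (- x\<^sup>2 / (4 * t)) / sqrt (4 * pi * t)"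

text \<open>
  Writing the heat flow as an average over a standard normal variable, scaled by \<open>sqrt (2 * t)\<close>, keeps
  the formula meaningful at \<open>t = 0\<close>; this makes continuity up to the initial time a case of the general
  continuity of Gaussian averages.
\<close>

definition heat_flow :: "(real \<Rightarrow> real) \<Rightarrow> real \<Rightarrow> real \<Rightarrow> real" where
  "heat_flow f y t = gauss_avg (\<lambda>x. 1) f y (sqrt (2 * t))"

definition heat_flow_y :: "(real \<Rightarrow> real) \<Rightarrow> real \<Rightarrow> real \<Rightarrow> real" where
  "heat_flow_y f y t = gauss_avg (\<lambda>x. x) f y (sqrt (2 * t)) / sqrt (2 * t)"

definition heat_flow_yy :: "(real \<Rightarrow> real) \<Rightarrow> real \<Rightarrow> real \<Rightarrow> real" where
  "heat_flow_yy f y t = gauss_avg (\<lambda>x. x\<^sup>2 - 1) f y (sqrt (2 * t)) / (2 * t)"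

lemma gauss_avg_heat_kernel:
  assumes "t > 0"
  shows "gauss_avg P f y (sqrt (2 * t)) = (\<integral>z. heat_kernel t (y - z) * P ((z - y) / sqrt (2 * t)) * f z \<partial>lborel)"
proof -
  define r where "r = sqrt (2 * t)"
  have r: "r > 0" "r\<^sup>2 = 2 * t" using assms by (auto simp: r_def)
  have s: "sqrt (4 * pi * t) = sqrt (2 * pi) * r"
    unfolding r_def real_sqrt_mult[symmetric] by (simp add: mult_ac)
  have "(\<integral>z. heat_kernel t (y - z) * P ((z - y) / r) * f z \<partial>lborel) =
      r * (\<integral>x. heat_kernel t (y - (y + r * x)) * P ((y + r * x - y) / r) * f (y + r * x) \<partial>lborel)"
    using lborel_integral_real_affine[of r "\<lambda>z. heat_kernel t (y - z) * P ((z - y) / r) * f z" y] r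
    by simp
  also have "\<dots> = (\<integral>x. r * (heat_kernel t (y - (y + r * x)) * P ((y + r * x - y) / r) * f (y + r * x)) \<partial>lborel)"
    by simp
  also have "\<dots> = (\<integral>x. std_normal_density x * P x * f (y + r * x) \<partial>lborel)"
  proof (rule Bochner_Integration.integral_cong[OF refl])
    fix x
    have "(r * x)\<^sup>2 / (4 * t) = x\<^sup>2 / 2" using r assms by (simp add: power_mult_distrib)
    then have "r * heat_kernel t (y - (y + r * x)) = std_normal_density x"
      unfolding heat_kernel_def std_normal_density_def s using r by simp
    then show "r * (heat_kernel t (y - (y + r * x)) * P ((y + r * x - y) / r) * f (y + r * x)) =
        std_normal_density x * P x * f (y + r * x)"
      using r by (simp add: mult_ac)
  qed
  finally show ?thesis by (simp add: gauss_avg_def r_def)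
qed

text \<open>
  For positive times the variable of \<open>f\<close> can be made the integration variable. The parameters then enter
  through the kernel only, so that all derivatives fall on the kernel.
\<close>

lemma heat_flow_kernel:
  assumes "t > 0"
  shows "heat_flow f y t = (\<integral>z. heat_kernel t (y - z) * f z \<partial>lborel)"
    and "heat_flow_y f y t = (\<integral>z. heat_kernel t (y - z) * (- (y - z) / (2 * t)) * f z \<partial>lborel)"
    and "heat_flow_yy f y t = (\<integral>z. heat_kernel t (y - z) * ((y - z)\<^sup>2 / (4 * t\<^sup>2) - 1 / (2 * t)) * f z \<partial>lborel)"
proof -
  define r where "r = sqrt (2 * t)"
  have r: "r > 0" "r\<^sup>2 = 2 * t" using assms by (auto simp: r_def)
  show "heat_flow f y t = (\<integral>z. heat_kernel t (y - z) * f z \<partial>lborel)"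
    unfolding heat_flow_def gauss_avg_heat_kernel[OF assms] by simp
  have "heat_flow_y f y t = (\<integral>z. heat_kernel t (y - z) * ((z - y) / r) * f z / r \<partial>lborel)"
    unfolding heat_flow_y_def gauss_avg_heat_kernel[OF assms] r_def by simp
  also have "(\<lambda>z. heat_kernel t (y - z) * ((z - y) / r) * f z / r) = (\<lambda>z. heat_kernel t (y - z) * (- (y - z) / (2 * t)) * f z)"
    using r by (auto simp: r(2)[symmetric] power2_eq_square field_simps)
  finally show "heat_flow_y f y t = (\<integral>z. heat_kernel t (y - z) * (- (y - z) / (2 * t)) * f z \<partial>lborel)" .
  have "heat_flow_yy f y t = (\<integral>z. heat_kernel t (y - z) * (((z - y) / r)\<^sup>2 - 1) * f z / (2 * t) \<partial>lborel)"
    unfolding heat_flow_yy_def gauss_avg_heat_kernel[OF assms] r_def by simp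
  also have "(\<lambda>z. heat_kernel t (y - z) * (((z - y) / r)\<^sup>2 - 1) * f z / (2 * t)) =
      (\<lambda>z. heat_kernel t (y - z) * ((y - z)\<^sup>2 / (4 * t\<^sup>2) - 1 / (2 * t)) * f z)"
  proof
    fix z
    have *: "(((z - y) / r)\<^sup>2 - 1) / (2 * t) = ((y - z)\<^sup>2 / (4 * t\<^sup>2) - 1 / (2 * t))"
      unfolding power_divide r(2) power2_commute[of z y] using assms
      by (simp add: diff_divide_distrib power2_eq_square)
    show "heat_kernel t (y - z) * (((z - y) / r)\<^sup>2 - 1) * f z / (2 * t) =
      heat_kernel t (y - z) * ((y - z)\<^sup>2 / (4 * t\<^sup>2) - 1 / (2 * t)) * f z"
      by (simp only: times_divide_eq_right times_divide_eq_left flip: *)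
  qed
  finally show "heat_flow_yy f y t = (\<integral>z. heat_kernel t (y - z) * ((y - z)\<^sup>2 / (4 * t\<^sup>2) - 1 / (2 * t)) * f z \<partial>lborel)" .
qed

text \<open>
  Completing the square in \<open>x\<^sup>2 / (4 t) - k \<bar>x\<bar> + k\<^sup>2 t \<ge> 0\<close>.
\<close>

lemma heat_kernel_le_exp:
  assumes "0 < a" "a \<le> t" "t \<le> b"
  shows "heat_kernel t x \<le> exp (k\<^sup>2 * b) / sqrt (4 * pi * a) * exp (- (k * \<bar>x\<bar>))"
proof -
  have "heat_kernel t x \<le> exp (k\<^sup>2 * b + - (k * \<bar>x\<bar>)) / sqrt (4 * pi * a)"
    unfolding heat_kernel_def
  proof (intro frac_le)
    have "k * \<bar>x\<bar> \<le> x\<^sup>2 / (4 * t) + k\<^sup>2 * t"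
    proof -
      have "0 \<le> (\<bar>x\<bar> - 2 * k * t)\<^sup>2 / (4 * t)" using assms by simp
      also have "\<dots> = x\<^sup>2 / (4 * t) + k\<^sup>2 * t - k * \<bar>x\<bar>"
        using assms by (simp add: power2_diff power_mult_distrib field_simps power2_eq_square)
      finally show ?thesis by simp
    qed
    moreover have "k\<^sup>2 * t \<le> k\<^sup>2 * b" using assms by (intro mult_left_mono) auto
    ultimately show "exp (- x\<^sup>2 / (4 * t)) \<le> exp (k\<^sup>2 * b + - (k * \<bar>x\<bar>))" by simp
    show "0 < sqrt (4 * pi * a)" using assms by simp
    show "sqrt (4 * pi * a) \<le> sqrt (4 * pi * t)" using assms by simp
  qed simp
  then show ?thesis by (simp only: exp_add times_divide_eq_left)
qed

lemma heat_kernel_weighted_bound: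
  assumes "0 < a" and P: "\<And>t x. a \<le> t \<Longrightarrow> t \<le> b \<Longrightarrow> \<bar>P t x\<bar> \<le> B * exp \<bar>x\<bar>" and f: "exp_growth f"
  obtains C where "\<And>t y z. a \<le> t \<Longrightarrow> t \<le> b \<Longrightarrow> \<bar>y\<bar> \<le> M \<Longrightarrow>
    \<bar>heat_kernel t (y - z) * P t (y - z) * f z\<bar> \<le> C * exp (- \<bar>z\<bar>)"
proof -
  obtain A k where f: "A > 0" "k > 0" "\<And>z. \<bar>f z\<bar> \<le> A * exp (k * \<bar>z\<bar>)" using exp_growthE[OF f] by blast
  define D where "D = exp ((k + 2)\<^sup>2 * b) / sqrt (4 * pi * a)"
  have "\<bar>heat_kernel t (y - z) * P t (y - z) * f z\<bar> \<le> (D * \<bar>B\<bar> * A * exp ((k + 1) * M)) * exp (- \<bar>z\<bar>)"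
    if t: "a \<le> t" "t \<le> b" and y: "\<bar>y\<bar> \<le> M" for t y z
  proof -
    let ?x = "y - z"
    have 1: "\<bar>heat_kernel t ?x\<bar> \<le> D * exp (- ((k + 2) * \<bar>?x\<bar>))"
      using heat_kernel_le_exp[OF assms(1) t, of ?x "k + 2"] t assms(1)
      by (simp add: D_def heat_kernel_def)
    have 2: "\<bar>P t ?x\<bar> \<le> \<bar>B\<bar> * exp \<bar>?x\<bar>"
      by (rule order.trans[OF P[OF t]]) (simp add: mult_right_mono)
    have D: "D \<ge> 0" using assms(1) by (simp add: D_def)
    have "\<bar>heat_kernel t ?x * P t ?x * f z\<bar> \<le> (D * exp (- ((k + 2) * \<bar>?x\<bar>))) * (\<bar>B\<bar> * exp \<bar>?x\<bar>) * (A * exp (k * \<bar>z\<bar>))"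
      unfolding abs_mult using 1 2 f D by (intro mult_mono) auto
    also have "\<dots> = (D * \<bar>B\<bar> * A) * exp (- ((k + 1) * \<bar>?x\<bar>) + k * \<bar>z\<bar>)"
      by (simp add: exp_add[symmetric] algebra_simps)
    also have "\<dots> \<le> (D * \<bar>B\<bar> * A) * exp ((k + 1) * M - \<bar>z\<bar>)"
    proof -
      have "\<bar>z\<bar> \<le> \<bar>?x\<bar> + M" using y by linarith
      then have "(k + 1) * \<bar>z\<bar> \<le> (k + 1) * (\<bar>?x\<bar> + M)" using f by (intro mult_left_mono) auto
      then have "- ((k + 1) * \<bar>?x\<bar>) + k * \<bar>z\<bar> \<le> (k + 1) * M - \<bar>z\<bar>" by (simp add: algebra_simps)
      then show ?thesis using D f by (intro mult_left_mono) auto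
    qed
    finally show ?thesis by (simp add: exp_diff exp_minus field_simps)
  qed
  then show ?thesis using that by blast
qed

lemma heat_kernel_deriv_x:
  assumes "t > 0"
  shows "((\<lambda>x. heat_kernel t (x - z)) has_real_derivative heat_kernel t (x - z) * (- (x - z) / (2 * t))) (at x within S)"
    and "((\<lambda>x. heat_kernel t (x - z) * (- (x - z) / (2 * t))) has_real_derivative
      heat_kernel t (x - z) * ((x - z)\<^sup>2 / (4 * t\<^sup>2) - 1 / (2 * t))) (at x within S)"
proof -
  show *: "((\<lambda>x. heat_kernel t (x - z)) has_real_derivative heat_kernel t (x - z) * (- (x - z) / (2 * t))) (at x within S)" for x S
    unfolding heat_kernel_def
  proof (rule DERIV_cong[OF DERIV_cdivide])
    show "((\<lambda>x. exp (- (x - z)\<^sup>2 / (4 * t))) has_real_derivative exp (- (x - z)\<^sup>2 / (4 * t)) * (- (x - z) / (2 * t))) (at x within S)"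
    proof (rule DERIV_chain2[OF DERIV_exp])
      show "((\<lambda>x. - (x - z)\<^sup>2 / (4 * t)) has_real_derivative - (x - z) / (2 * t)) (at x within S)"
      proof -
        have "((\<lambda>x. (- 1 / (4 * t)) * (x - z)\<^sup>2) has_real_derivative (- 1 / (4 * t)) * (2 * (x - z))) (at x within S)"
          by (rule DERIV_cmult) (auto intro!: derivative_eq_intros)
        moreover have "(- 1 / (4 * t)) * (2 * (x - z)) = - (x - z) / (2 * t)"
          using assms by (simp add: divide_simps)
        ultimately show ?thesis by simp
      qed
    qed
  qed simp
  have alg: "h * (- d / (2 * t)) * (- d / (2 * t)) + (-1 / (2 * t)) * h = h * (d\<^sup>2 / (4 * t\<^sup>2) - 1 / (2 * t))" for h d
    using assms by (simp add: field_simps power2_eq_square)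
  show "((\<lambda>x. heat_kernel t (x - z) * (- (x - z) / (2 * t))) has_real_derivative
      heat_kernel t (x - z) * ((x - z)\<^sup>2 / (4 * t\<^sup>2) - 1 / (2 * t))) (at x within S)"
  proof (rule DERIV_cong[OF DERIV_mult[OF *]])
    show "((\<lambda>x. - (x - z) / (2 * t)) has_real_derivative (-1 / (2 * t))) (at x within S)"
      using assms by (auto intro!: derivative_eq_intros)
    show "heat_kernel t (x - z) * (- (x - z) / (2 * t)) * (- (x - z) / (2 * t)) + (-1 / (2 * t)) * heat_kernel t (x - z)
       = heat_kernel t (x - z) * ((x - z)\<^sup>2 / (4 * t\<^sup>2) - 1 / (2 * t))"
      by (rule alg)
  qed
qed

lemma heat_kernel_deriv_t:
  assumes "t > 0"
  shows "((\<lambda>t. heat_kernel t x) has_real_derivative heat_kernel t x * (x\<^sup>2 / (4 * t\<^sup>2) - 1 / (2 * t))) (at t)"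
proof -
  define s where "s = sqrt (4 * pi * t)"
  have s: "s > 0" "s\<^sup>2 = 4 * pi * t" using assms by (auto simp: s_def)
  have alg: "(E * X * s - E * (c * (inverse s / 2))) / (s * s) = E / s * (X - c / (2 * s\<^sup>2))"
    if "s > 0" for E X c s :: real
    using that by (simp add: field_simps power2_eq_square)
  have "((\<lambda>t. exp (- x\<^sup>2 / (4 * t)) / sqrt (4 * pi * t)) has_real_derivative
     (exp (- x\<^sup>2 / (4 * t)) * (x\<^sup>2 / (4 * t\<^sup>2)) * sqrt (4 * pi * t) - exp (- x\<^sup>2 / (4 * t)) * (4 * pi * (inverse s / 2))) /
     (sqrt (4 * pi * t) * sqrt (4 * pi * t))) (at t)"
  proof (rule DERIV_divide)
    have "((\<lambda>t. (- x\<^sup>2 / 4) * inverse t) has_real_derivative (- x\<^sup>2 / 4) * (- (inverse t ^ Suc (Suc 0)))) (at t)"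
      using assms by (intro DERIV_cmult DERIV_inverse) simp
    moreover have "(\<lambda>t. (- x\<^sup>2 / 4) * inverse t) = (\<lambda>t. - x\<^sup>2 / (4 * t))"
      by (simp add: fun_eq_iff divide_simps)
    moreover have "(- x\<^sup>2 / 4) * (- (inverse t ^ Suc (Suc 0))) = x\<^sup>2 / (4 * t\<^sup>2)"
      by (simp add: power2_eq_square divide_simps)
    ultimately have "((\<lambda>t. - x\<^sup>2 / (4 * t)) has_real_derivative x\<^sup>2 / (4 * t\<^sup>2)) (at t)"
      by (simp only:)
    then show "((\<lambda>t. exp (- x\<^sup>2 / (4 * t))) has_real_derivative exp (- x\<^sup>2 / (4 * t)) * (x\<^sup>2 / (4 * t\<^sup>2))) (at t)"
      by (rule DERIV_chain2[OF DERIV_exp])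
    have "((\<lambda>t. sqrt (4 * pi * t)) has_real_derivative inverse s / 2 * (4 * pi)) (at t)"
      unfolding s_def
      by (rule DERIV_chain2[OF DERIV_real_sqrt]) (use assms in \<open>auto intro!: derivative_eq_intros\<close>)
    then show "((\<lambda>t. sqrt (4 * pi * t)) has_real_derivative 4 * pi * (inverse s / 2)) (at t)"
      by (simp only: mult.commute)
    show "sqrt (4 * pi * t) \<noteq> 0" using assms by simp
  qed
  also have "(exp (- x\<^sup>2 / (4 * t)) * (x\<^sup>2 / (4 * t\<^sup>2)) * sqrt (4 * pi * t) - exp (- x\<^sup>2 / (4 * t)) * (4 * pi * (inverse s / 2))) /
      (sqrt (4 * pi * t) * sqrt (4 * pi * t))
     = exp (- x\<^sup>2 / (4 * t)) / s * ((x\<^sup>2 / (4 * t\<^sup>2)) - 4 * pi / (2 * s\<^sup>2))"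
    unfolding s_def[symmetric] by (rule alg[OF s(1)])
  also have "4 * pi / (2 * s\<^sup>2) = 1 / (2 * t)" using s assms by simp
  finally show ?thesis unfolding heat_kernel_def s_def .
qed

lemma abs_le_exp_abs: "\<bar>x::real\<bar> \<le> exp \<bar>x\<bar>" and square_le_exp_abs: "x\<^sup>2 \<le> 2 * exp \<bar>x\<bar>"
proof -
  show "\<bar>x\<bar> \<le> exp \<bar>x\<bar>" using exp_ge_add_one_self[of "\<bar>x\<bar>"] by linarith
  show "x\<^sup>2 \<le> 2 * exp \<bar>x\<bar>"
    using exp_lower_Taylor_quadratic[of "\<bar>x\<bar>"] by simp
qed

lemma heat_kernel_weights:
  assumes "0 < a" "a \<le> t"
  shows "\<bar>1::real\<bar> \<le> (1 + 1 / (2 * a) + 1 / (2 * a\<^sup>2)) * exp \<bar>x\<bar>"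
    "\<bar>- x / (2 * t)\<bar> \<le> (1 + 1 / (2 * a) + 1 / (2 * a\<^sup>2)) * exp \<bar>x\<bar>"
    "\<bar>x\<^sup>2 / (4 * t\<^sup>2) - 1 / (2 * t)\<bar> \<le> (1 + 1 / (2 * a) + 1 / (2 * a\<^sup>2)) * exp \<bar>x\<bar>"
proof -
  define B where "B = 1 + 1 / (2 * a) + 1 / (2 * a\<^sup>2)"
  have B: "B \<ge> 1" "B \<ge> 1 / (2 * a)" "B \<ge> 1 / (2 * a) + 1 / (2 * a\<^sup>2)" using assms by (auto simp: B_def)
  have e: "exp \<bar>x\<bar> \<ge> 1" by simp
  have "1 * 1 \<le> B * exp \<bar>x\<bar>" using B e by (intro mult_mono) auto
  then show "\<bar>1::real\<bar> \<le> (1 + 1 / (2 * a) + 1 / (2 * a\<^sup>2)) * exp \<bar>x\<bar>" by (simp add: B_def)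
  have "\<bar>- x / (2 * t)\<bar> = 1 / (2 * t) * \<bar>x\<bar>" using assms by simp
  also have "\<dots> \<le> B * exp \<bar>x\<bar>"
    using assms B abs_le_exp_abs[of x] by (intro mult_mono order.trans[OF _ B(2)]) (auto intro!: frac_le)
  finally show "\<bar>- x / (2 * t)\<bar> \<le> (1 + 1 / (2 * a) + 1 / (2 * a\<^sup>2)) * exp \<bar>x\<bar>" by (simp add: B_def)
  have "\<bar>x\<^sup>2 / (4 * t\<^sup>2) - 1 / (2 * t)\<bar> \<le> x\<^sup>2 / (4 * t\<^sup>2) + 1 / (2 * t)" using assms by (intro abs_leI) auto
  also have "\<dots> \<le> (2 * exp \<bar>x\<bar>) / (4 * a\<^sup>2) + exp \<bar>x\<bar> / (2 * a)"
    using assms square_le_exp_abs[of x] by (intro add_mono frac_le power_mono mult_left_mono) auto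
  also have "\<dots> = (1 / (2 * a) + 1 / (2 * a\<^sup>2)) * exp \<bar>x\<bar>" using assms by (simp add: field_simps)
  also have "\<dots> \<le> B * exp \<bar>x\<bar>" using B by (intro mult_right_mono) auto
  finally show "\<bar>x\<^sup>2 / (4 * t\<^sup>2) - 1 / (2 * t)\<bar> \<le> (1 + 1 / (2 * a) + 1 / (2 * a\<^sup>2)) * exp \<bar>x\<bar>" by (simp add: B_def)
qed

lemma heat_kernel_measurable [measurable]: "(\<lambda>z. heat_kernel t (y - z)) \<in> borel_measurable borel"
  unfolding heat_kernel_def by measurable

lemma integrable_heat_kernel_weighted:
  assumes "0 < a" and P: "\<And>x. \<bar>P x\<bar> \<le> B * exp \<bar>x\<bar>" "P \<in> borel_measurable borel"
    and f: "continuous_on UNIV f" "exp_growth f"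
  shows "integrable lborel (\<lambda>z. heat_kernel a (y - z) * P (y - z) * f z)"
proof -
  obtain C where C: "\<And>z. \<bar>heat_kernel a (y - z) * P (y - z) * f z\<bar> \<le> C * exp (- \<bar>z\<bar>)"
    using heat_kernel_weighted_bound[OF assms(1) _ f(2), of a "\<lambda>t. P" B "\<bar>y\<bar>"] P(1) by (metis order_refl)
  show ?thesis
  proof (rule Bochner_Integration.integrable_bound[where f = "\<lambda>x. C * exp (- \<bar>x\<bar>)"])
    show "integrable lborel (\<lambda>x. C * exp (- \<bar>x\<bar>))"
      using integrable_exp_neg_abs by simp
    show "(\<lambda>z. heat_kernel a (y - z) * P (y - z) * f z) \<in> borel_measurable lborel"
      using P(2) borel_measurable_continuous_onI[OF f(1)] by measurable
    show "AE x in lborel. norm (heat_kernel a (y - x) * P (y - x) * f x) \<le> norm (C * exp (- \<bar>x\<bar>))"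
      using C by (auto intro!: AE_I2 intro: order.trans[OF _ abs_ge_self])
  qed
qed

text \<open>
  The kernel solves the heat equation, and differentiation under the integral passes this on to the
  flow.
\<close>

lemma heat_flow_derivs:
  assumes f: "continuous_on UNIV f" "exp_growth f" and t: "t > 0"
  shows "((\<lambda>y. heat_flow f y t) has_real_derivative heat_flow_y f y t) (at y)"
    and "((\<lambda>y. heat_flow_y f y t) has_real_derivative heat_flow_yy f y t) (at y)"
    and "((\<lambda>t. heat_flow f y t) has_real_derivative heat_flow_yy f y t) (at t)"
proof -
  define a where "a = t / 2"
  have a: "a > 0" "a \<le> t" "t \<le> 2 * t" using t by (auto simp: a_def)
  note w = heat_kernel_weights[OF a(1)]
  define B where "B = (1 + 1 / (2 * a) + 1 / (2 * a\<^sup>2))"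
  note w = w[folded B_def]
  note k = heat_flow_kernel
  let ?k1 = "\<lambda>t x. - x / (2 * t)" and ?k2 = "\<lambda>t x. x\<^sup>2 / (4 * t\<^sup>2) - 1 / (2 * t)"
  obtain C1 where C1: "\<And>s y' z. a \<le> s \<Longrightarrow> s \<le> 2 * t \<Longrightarrow> \<bar>y'\<bar> \<le> \<bar>y\<bar> + 1 \<Longrightarrow>
    \<bar>heat_kernel s (y' - z) * ?k1 s (y' - z) * f z\<bar> \<le> C1 * exp (- \<bar>z\<bar>)"
    using heat_kernel_weighted_bound[OF a(1) _ f(2), of "2 * t" "?k1" B "\<bar>y\<bar> + 1"] w(2) by blast
  obtain C2 where C2: "\<And>s y' z. a \<le> s \<Longrightarrow> s \<le> 2 * t \<Longrightarrow> \<bar>y'\<bar> \<le> \<bar>y\<bar> + 1 \<Longrightarrow>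
    \<bar>heat_kernel s (y' - z) * ?k2 s (y' - z) * f z\<bar> \<le> C2 * exp (- \<bar>z\<bar>)"
    using heat_kernel_weighted_bound[OF a(1) _ f(2), of "2 * t" "?k2" B "\<bar>y\<bar> + 1"] w(3) by blast
  have int0: "integrable lborel (\<lambda>z. heat_kernel s (y' - z) * f z)" if "a \<le> s" for s y'
    using integrable_heat_kernel_weighted[of s "\<lambda>x. 1", OF _ w(1)[OF that] _ f] a that by simp
  have int1: "integrable lborel (\<lambda>z. heat_kernel s (y' - z) * ?k1 s (y' - z) * f z)" if "a \<le> s" for s y'
    using integrable_heat_kernel_weighted[of s "?k1 s", OF _ w(2)[OF that] _ f] a that by simp
  have int2: "integrable lborel (\<lambda>z. heat_kernel s (y' - z) * ?k2 s (y' - z) * f z)" if "a \<le> s" for s y'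
    using integrable_heat_kernel_weighted[of s "?k2 s", OF _ w(3)[OF that] _ f] a that by simp
  have inth: "integrable lborel (\<lambda>z. C * exp (- \<bar>z\<bar>))" for C :: real
    using integrable_exp_neg_abs by simp
  have S: "\<bar>y'\<bar> \<le> \<bar>y\<bar> + 1" if "y' \<in> ball y 1" for y' using that by (auto simp: dist_real_def)
  show "((\<lambda>y. heat_flow f y t) has_real_derivative heat_flow_y f y t) (at y)"
    unfolding k[OF t]
  proof (rule has_field_derivative_lborel_integral[where S = "ball y 1" and h = "\<lambda>z. C1 * exp (- \<bar>z\<bar>)"
        and K' = "\<lambda>y z. heat_kernel t (y - z) * ?k1 t (y - z) * f z"])
    fix p z assume p: "p \<in> ball y 1"
    show "((\<lambda>p. heat_kernel t (p - z) * f z) has_real_derivative heat_kernel t (p - z) * ?k1 t (p - z) * f z) (at p)"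
      by (rule DERIV_cmult_right[OF heat_kernel_deriv_x(1)[OF t]])
    show "norm (heat_kernel t (p - z) * ?k1 t (p - z) * f z) \<le> C1 * exp (- \<bar>z\<bar>)"
      using C1[OF a(2,3) S[OF p]] by simp
  qed (use int0 int1 inth a in auto)
  show "((\<lambda>y. heat_flow_y f y t) has_real_derivative heat_flow_yy f y t) (at y)"
    unfolding k[OF t]
  proof (rule has_field_derivative_lborel_integral[where S = "ball y 1" and h = "\<lambda>z. C2 * exp (- \<bar>z\<bar>)"
        and K' = "\<lambda>y z. heat_kernel t (y - z) * ?k2 t (y - z) * f z"])
    fix p z assume p: "p \<in> ball y 1"
    show "((\<lambda>p. heat_kernel t (p - z) * ?k1 t (p - z) * f z) has_real_derivative heat_kernel t (p - z) * ?k2 t (p - z) * f z) (at p)"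
      by (rule DERIV_cmult_right[OF heat_kernel_deriv_x(2)[OF t]])
    show "norm (heat_kernel t (p - z) * ?k2 t (p - z) * f z) \<le> C2 * exp (- \<bar>z\<bar>)"
      using C2[OF a(2,3) S[OF p]] by simp
  qed (use int1 int2 inth a in auto)
  have "((\<lambda>s. \<integral>z. heat_kernel s (y - z) * f z \<partial>lborel) has_real_derivative heat_flow_yy f y t) (at t)"
    unfolding k[OF t]
  proof (rule has_field_derivative_lborel_integral[where S = "{a<..<2*t}" and h = "\<lambda>z. C2 * exp (- \<bar>z\<bar>)"
        and K' = "\<lambda>t z. heat_kernel t (y - z) * ?k2 t (y - z) * f z"])
    fix p z assume p: "p \<in> {a<..<2*t}"
    show "((\<lambda>p. heat_kernel p (y - z) * f z) has_real_derivative heat_kernel p (y - z) * ?k2 p (y - z) * f z) (at p)"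
      using p a by (intro DERIV_cmult_right heat_kernel_deriv_t) auto
    show "norm (heat_kernel p (y - z) * ?k2 p (y - z) * f z) \<le> C2 * exp (- \<bar>z\<bar>)"
      using C2[of p y z] p by simp
  qed (use int0 int2 inth a t in \<open>auto simp: a_def\<close>)
  then show "((\<lambda>t. heat_flow f y t) has_real_derivative heat_flow_yy f y t) (at t)"
    by (rule DERIV_cong_ev[OF refl _ refl, THEN iffD1, rotated])
      (use t in \<open>auto intro!: eventually_mono[OF eventually_nhds_in_open[of "{0<..}" t]] simp: k(1)\<close>)
qed

lemma exp_growth_weights:
  "exp_growth (\<lambda>x. 1)" "exp_growth (\<lambda>x. x)" "exp_growth (\<lambda>x. x\<^sup>2 - 1)" "exp_growth (\<lambda>x. x\<^sup>2 / 2)"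
proof -
  show 1: "exp_growth (\<lambda>x. 1)" unfolding exp_growth_def by (rule exI[of _ 1], rule exI[of _ 0]) simp
  show "exp_growth (\<lambda>x. x)"
    unfolding exp_growth_def by (rule exI[of _ 1], rule exI[of _ 1]) (simp add: abs_le_exp_abs)
  have "exp_growth (\<lambda>x. x\<^sup>2)"
    unfolding exp_growth_def by (rule exI[of _ 2], rule exI[of _ 1]) (simp add: square_le_exp_abs)
  from exp_growth_add[OF this exp_growth_cmult[OF 1, of "-1"]] exp_growth_cmult[OF this, of "1/2"]
  show "exp_growth (\<lambda>x. x\<^sup>2 - 1)" "exp_growth (\<lambda>x. x\<^sup>2 / 2)" by simp_all
qed

lemma heat_flow_continuous:
  assumes f: "continuous_on UNIV f" "exp_growth f"
  shows "continuous_on UNIV (\<lambda>(y, t). heat_flow f y t)"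
    and "continuous_on (UNIV \<times> {0<..}) (\<lambda>(y, t). heat_flow_y f y t)"
    and "continuous_on (UNIV \<times> {0<..}) (\<lambda>(y, t). heat_flow_yy f y t)"
proof -
  have c: "continuous_on S (\<lambda>(y, t). gauss_avg P f y (sqrt (2 * t)))"
    if "continuous_on UNIV P" "exp_growth P" for P and S :: "(real \<times> real) set"
  proof -
    have "continuous_on S (\<lambda>p. (\<lambda>(y, r). gauss_avg P f y r) (fst p, sqrt (2 * snd p)))"
      by (rule continuous_on_compose2[OF continuous_on_gauss_avg[OF that f]]) (auto intro!: continuous_intros)
    then show ?thesis by (simp add: case_prod_beta)
  qed
  show "continuous_on UNIV (\<lambda>(y, t). heat_flow f y t)"
    unfolding heat_flow_def by (intro c exp_growth_weights continuous_intros)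
  show "continuous_on (UNIV \<times> {0<..}) (\<lambda>(y, t). heat_flow_y f y t)"
    using c[of "\<lambda>x. x" "UNIV \<times> {0<..}"] exp_growth_weights unfolding heat_flow_y_def case_prod_beta
    by (intro continuous_intros) auto
  have "continuous_on UNIV (\<lambda>x::real. x\<^sup>2 - 1)" by (intro continuous_intros)
  then show "continuous_on (UNIV \<times> {0<..}) (\<lambda>(y, t). heat_flow_yy f y t)"
    using c[of "\<lambda>x. x\<^sup>2 - 1" "UNIV \<times> {0<..}"] exp_growth_weights unfolding heat_flow_yy_def case_prod_beta
    by (intro continuous_intros) (auto intro!: continuous_intros)
qed

lemma heat_flow_initial: "heat_flow f y 0 = f y"
proof -
  have "has_bochner_integral lborel std_normal_density 1"
    using has_bochner_integral_integrable[OF integrable_std_normal_moment[of 0]] std_normal_moment_even[of 0]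
    using integral_std_normal_moment_even[of 0] by simp
  then show ?thesis
    by (simp add: heat_flow_def gauss_avg_def has_bochner_integral_iff)
qed

lemma heat_flow_square: "t \<ge> 0 \<Longrightarrow> heat_flow (\<lambda>z. z\<^sup>2 / 2) 0 t = t"
  using integral_std_normal_moment_even[of 1]
  by (simp add: heat_flow_def gauss_avg_def power_mult_distrib mult.assoc mult.left_commute[of _ t])

lemma heat_flow_lincomb:
  assumes f: "continuous_on UNIV f" "exp_growth f" and g: "continuous_on UNIV g" "exp_growth g"
  shows "heat_flow (\<lambda>z. f z + c * g z) y t = heat_flow f y t + c * heat_flow g y t"
proof -
  have 1: "integrable lborel (\<lambda>x. std_normal_density x * f (y + r * x))"
    and 2: "integrable lborel (\<lambda>x. std_normal_density x * g (y + r * x))" for r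
    using integrable_gauss_avg[OF _ exp_growth_weights(1) f] integrable_gauss_avg[OF _ exp_growth_weights(1) g]
    by (auto intro: continuous_intros)
  have "integrable lborel (\<lambda>x. c * (std_normal_density x * g (y + r * x)))" for r using 2 by simp
  from Bochner_Integration.integral_add[OF 1 this, of "sqrt (2 * t)" "sqrt (2 * t)"]
  show ?thesis by (simp add: heat_flow_def gauss_avg_def algebra_simps)
qed

lemma heat_flow_sum:
  assumes "finite I" "\<And>i. i \<in> I \<Longrightarrow> continuous_on UNIV (f i)" "\<And>i. i \<in> I \<Longrightarrow> exp_growth (f i)"
  shows "heat_flow (\<lambda>z. \<Sum>i\<in>I. f i z) y t = (\<Sum>i\<in>I. heat_flow (f i) y t)"
proof -
  have "integrable lborel (\<lambda>x. std_normal_density x * f i (y + r * x))" if "i \<in> I" for i r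
    using integrable_gauss_avg[OF _ exp_growth_weights(1) assms(2,3)[OF that]]
    by (auto intro: continuous_intros)
  then show ?thesis
    by (simp add: heat_flow_def gauss_avg_def sum_distrib_left)
qed

lemma heat_flow_reflect: "heat_flow (\<lambda>z. f (a - z)) y t = heat_flow f (a - y) t"
proof -
  let ?g = "\<lambda>x. std_normal_density x * f (a - y + sqrt (2 * t) * x)"
  have "heat_flow f (a - y) t = (\<integral>x. ?g (0 + - 1 * x) \<partial>lborel)"
    unfolding heat_flow_def gauss_avg_def using lborel_integral_real_affine[of "-1" ?g 0] by simp
  then show ?thesis
    by (simp add: heat_flow_def gauss_avg_def std_normal_density_def algebra_simps)
qed

section \<open>Classical regularity on an edge\<close>

text \<open>
  The derivatives are arguments of the predicate, so that products and compositions come with formulas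
  for them. A solution of the heat equation is expressed by using the same function for \<open>wyy\<close> and \<open>wt\<close>.
\<close>

definition C21 :: "real \<Rightarrow> real \<Rightarrow> (real \<Rightarrow> real \<Rightarrow> real) \<Rightarrow> (real \<Rightarrow> real \<Rightarrow> real) \<Rightarrow>
    (real \<Rightarrow> real \<Rightarrow> real) \<Rightarrow> (real \<Rightarrow> real \<Rightarrow> real) \<Rightarrow> bool" where
  "C21 L T w wy wyy wt \<longleftrightarrow>
     continuous_on ({0..L} \<times> {0..T}) (\<lambda>(y, t). w y t) \<and>
     (\<forall>y\<in>{0..L}. \<forall>t\<in>{0<..<T}.
        ((\<lambda>y. w y t) has_real_derivative wy y t) (at y within {0..L}) \<and>
        ((\<lambda>y. wy y t) has_real_derivative wyy y t) (at y within {0..L}) \<and>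
        ((\<lambda>t. w y t) has_real_derivative wt y t) (at t)) \<and>
     continuous_on ({0..L} \<times> {0<..<T}) (\<lambda>(y, t). wy y t) \<and>
     continuous_on ({0..L} \<times> {0<..<T}) (\<lambda>(y, t). wyy y t) \<and>
     continuous_on ({0..L} \<times> {0<..<T}) (\<lambda>(y, t). wt y t)"

lemma C21D:
  assumes "C21 L T w wy wyy wt"
  shows "continuous_on ({0..L} \<times> {0..T}) (\<lambda>(y, t). w y t)"
    and "\<lbrakk>y \<in> {0..L}; t \<in> {0<..<T}\<rbrakk> \<Longrightarrow> ((\<lambda>y. w y t) has_real_derivative wy y t) (at y within {0..L})"
    and "\<lbrakk>y \<in> {0..L}; t \<in> {0<..<T}\<rbrakk> \<Longrightarrow> ((\<lambda>y. wy y t) has_real_derivative wyy y t) (at y within {0..L})"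
    and "\<lbrakk>y \<in> {0..L}; t \<in> {0<..<T}\<rbrakk> \<Longrightarrow> ((\<lambda>t. w y t) has_real_derivative wt y t) (at t)"
    and "continuous_on ({0..L} \<times> {0<..<T}) (\<lambda>(y, t). wy y t)"
    and "continuous_on ({0..L} \<times> {0<..<T}) (\<lambda>(y, t). wyy y t)"
    and "continuous_on ({0..L} \<times> {0<..<T}) (\<lambda>(y, t). wt y t)"
  using assms unfolding C21_def by auto

lemma C21_lincomb:
  assumes "C21 L T w wy wyy wt" "C21 L T v vy vyy vt"
  shows "C21 L T (\<lambda>y t. w y t + c * v y t) (\<lambda>y t. wy y t + c * vy y t)
    (\<lambda>y t. wyy y t + c * vyy y t) (\<lambda>y t. wt y t + c * vt y t)"
  using assms unfolding C21_def case_prod_beta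
  by (auto intro!: continuous_intros DERIV_add DERIV_cmult)

lemma has_field_derivative_transform:
  assumes "x \<in> S" "\<And>y. y \<in> S \<Longrightarrow> f y = g y" "(f has_field_derivative D) (at x within S)"
  shows "(g has_field_derivative D) (at x within S)"
  using has_field_derivative_transform_within[OF assms(3) zero_less_one assms(1)] assms(2) by blast

lemma C21_cong:
  assumes w: "C21 L T w wy wyy wt"
    and eq: "\<And>y t. y \<in> {0..L} \<Longrightarrow> t \<in> {0..T} \<Longrightarrow> w y t = v y t"
      "\<And>y t. y \<in> {0..L} \<Longrightarrow> t \<in> {0<..<T} \<Longrightarrow> wy y t = vy y t"
      "\<And>y t. y \<in> {0..L} \<Longrightarrow> t \<in> {0<..<T} \<Longrightarrow> wyy y t = vyy y t"
      "\<And>y t. y \<in> {0..L} \<Longrightarrow> t \<in> {0<..<T} \<Longrightarrow> wt y t = vt y t"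
  shows "C21 L T v vy vyy vt"
  unfolding C21_def
proof (intro conjI ballI)
  note D = C21D[OF w]
  show "continuous_on ({0..L} \<times> {0..T}) (\<lambda>(y, t). v y t)"
    by (rule continuous_on_eq[OF D(1)]) (use eq in auto)
  show "continuous_on ({0..L} \<times> {0<..<T}) (\<lambda>(y, t). vy y t)"
    by (rule continuous_on_eq[OF D(5)]) (use eq in auto)
  show "continuous_on ({0..L} \<times> {0<..<T}) (\<lambda>(y, t). vyy y t)"
    by (rule continuous_on_eq[OF D(6)]) (use eq in auto)
  show "continuous_on ({0..L} \<times> {0<..<T}) (\<lambda>(y, t). vt y t)"
    by (rule continuous_on_eq[OF D(7)]) (use eq in auto)
  fix y t assume y: "y \<in> {0..L}" and t: "t \<in> {0<..<T}"
  then have t': "t \<in> {0..T}" by auto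
  show "((\<lambda>y. v y t) has_real_derivative vy y t) (at y within {0..L})"
    by (rule has_field_derivative_transform[OF y eq(1)[OF _ t'] D(2)[OF y t, unfolded eq(2)[OF y t]]])
  show "((\<lambda>y. vy y t) has_real_derivative vyy y t) (at y within {0..L})"
    by (rule has_field_derivative_transform[OF y eq(2)[OF _ t] D(3)[OF y t, unfolded eq(3)[OF y t]]])
  show "((\<lambda>t. v y t) has_real_derivative vt y t) (at t)"
    by (rule has_field_derivative_transform_within_open[OF D(4)[OF y t, unfolded eq(4)[OF y t]], of "{0<..<T}"])
      (use t eq(1)[OF y] in auto)
qed

lemma C21_reverse:
  assumes w: "C21 L T w wy wyy wt"
  shows "C21 L T (\<lambda>y t. w y (T - t)) (\<lambda>y t. wy y (T - t)) (\<lambda>y t. wyy y (T - t)) (\<lambda>y t. - wt y (T - t))"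
  unfolding C21_def
proof (intro conjI ballI)
  note D = C21D[OF w]
  have c: "continuous_on ({0..L} \<times> {0<..<T}) (\<lambda>(y, t). k y (T - t))"
    if "continuous_on ({0..L} \<times> {0<..<T}) (\<lambda>(y, t). k y t)" for k :: "real \<Rightarrow> real \<Rightarrow> real"
  proof -
    have "continuous_on ({0..L} \<times> {0<..<T}) (\<lambda>q. (\<lambda>(y, t). k y t) (fst q, T - snd q))"
      by (rule continuous_on_compose2[OF that]) (auto intro!: continuous_intros)
    then show ?thesis by (simp add: case_prod_beta)
  qed
  have "continuous_on ({0..L} \<times> {0..T}) (\<lambda>q. (\<lambda>(y, t). w y t) (fst q, T - snd q))"
    by (rule continuous_on_compose2[OF D(1)]) (auto intro!: continuous_intros)
  then show "continuous_on ({0..L} \<times> {0..T}) (\<lambda>(y, t). w y (T - t))" by (simp add: case_prod_beta)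
  show "continuous_on ({0..L} \<times> {0<..<T}) (\<lambda>(y, t). wy y (T - t))" by (rule c[OF D(5)])
  show "continuous_on ({0..L} \<times> {0<..<T}) (\<lambda>(y, t). wyy y (T - t))" by (rule c[OF D(6)])
  show "continuous_on ({0..L} \<times> {0<..<T}) (\<lambda>(y, t). - wt y (T - t))"
    using continuous_on_minus[OF c[OF D(7)]] by (simp add: case_prod_beta)
  fix y t assume y: "y \<in> {0..L}" and t: "t \<in> {0<..<T}"
  then have t': "T - t \<in> {0<..<T}" by auto
  show "((\<lambda>y. w y (T - t)) has_real_derivative wy y (T - t)) (at y within {0..L})" by (rule D(2)[OF y t'])
  show "((\<lambda>y. wy y (T - t)) has_real_derivative wyy y (T - t)) (at y within {0..L})" by (rule D(3)[OF y t'])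
  have "((\<lambda>t. w y (T - t)) has_real_derivative wt y (T - t) * (-1)) (at t)"
    by (rule DERIV_chain2[of "w y"], rule D(4)[OF y t']) (auto intro!: derivative_eq_intros)
  then show "((\<lambda>t. w y (T - t)) has_real_derivative - wt y (T - t)) (at t)" by simp
qed

lemma C21_mult:
  assumes p: "C21 L T p py pyy pt" and q: "C21 L T q qy qyy qt"
  shows "C21 L T (\<lambda>y t. p y t * q y t) (\<lambda>y t. py y t * q y t + p y t * qy y t)
    (\<lambda>y t. pyy y t * q y t + 2 * py y t * qy y t + p y t * qyy y t) (\<lambda>y t. pt y t * q y t + p y t * qt y t)"
  unfolding C21_def
proof (intro conjI ballI)
  note P = C21D[OF p] and Q = C21D[OF q]
  have sub: "{0..L} \<times> {0<..<T} \<subseteq> {0..L} \<times> {0..T}" by auto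
  note c = P(5-7) Q(5-7) continuous_on_subset[OF P(1) sub] continuous_on_subset[OF Q(1) sub]
  show "continuous_on ({0..L} \<times> {0..T}) (\<lambda>(y, t). p y t * q y t)"
    using P(1) Q(1) unfolding case_prod_beta by (intro continuous_intros)
  show "continuous_on ({0..L} \<times> {0<..<T}) (\<lambda>(y, t). py y t * q y t + p y t * qy y t)"
    "continuous_on ({0..L} \<times> {0<..<T}) (\<lambda>(y, t). pyy y t * q y t + 2 * py y t * qy y t + p y t * qyy y t)"
    "continuous_on ({0..L} \<times> {0<..<T}) (\<lambda>(y, t). pt y t * q y t + p y t * qt y t)"
    using c unfolding case_prod_beta by (auto intro!: continuous_intros)
  fix y t assume y: "y \<in> {0..L}" and t: "t \<in> {0<..<T}"
  show "((\<lambda>y. p y t * q y t) has_real_derivative py y t * q y t + p y t * qy y t) (at y within {0..L})"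
    by (rule DERIV_cong[OF DERIV_mult[OF P(2)[OF y t] Q(2)[OF y t]]]) (simp add: algebra_simps)
  show "((\<lambda>y. py y t * q y t + p y t * qy y t) has_real_derivative pyy y t * q y t + 2 * py y t * qy y t + p y t * qyy y t) (at y within {0..L})"
    by (rule DERIV_cong[OF DERIV_add[OF DERIV_mult[OF P(3)[OF y t] Q(2)[OF y t]] DERIV_mult[OF P(2)[OF y t] Q(3)[OF y t]]]])
      simp
  show "((\<lambda>t. p y t * q y t) has_real_derivative pt y t * q y t + p y t * qt y t) (at t)"
    by (rule DERIV_cong[OF DERIV_mult[OF P(4)[OF y t] Q(4)[OF y t]]]) (simp add: algebra_simps)
qed

lemma C21_compose:
  assumes u: "C21 L T u uy uyy ut" and S: "\<And>y t. y \<in> {0..L} \<Longrightarrow> t \<in> {0..T} \<Longrightarrow> u y t \<in> S"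
    and h: "\<And>x. x \<in> S \<Longrightarrow> (h has_real_derivative h1 x) (at x)"
    and h1: "\<And>x. x \<in> S \<Longrightarrow> (h1 has_real_derivative h2 x) (at x)"
    and h2: "continuous_on S h2"
  shows "C21 L T (\<lambda>y t. h (u y t)) (\<lambda>y t. h1 (u y t) * uy y t)
    (\<lambda>y t. h2 (u y t) * (uy y t)\<^sup>2 + h1 (u y t) * uyy y t) (\<lambda>y t. h1 (u y t) * ut y t)"
  unfolding C21_def
proof (intro conjI ballI)
  note U = C21D[OF u]
  have ch: "continuous_on S h" "continuous_on S h1"
    by (rule DERIV_continuous_on, rule has_field_derivative_at_within, (rule h h1), assumption)+
  have cc: "continuous_on ({0..L} \<times> {0..T}) (\<lambda>q. k (u (fst q) (snd q)))" if "continuous_on S k" for k :: "real \<Rightarrow> real"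
    by (rule continuous_on_compose2[OF that]) (use U(1) S in \<open>auto simp: case_prod_beta\<close>)
  show "continuous_on ({0..L} \<times> {0..T}) (\<lambda>(y, t). h (u y t))"
    using cc[OF ch(1)] by (simp add: case_prod_beta)
  have sub: "{0..L} \<times> {0<..<T} \<subseteq> {0..L} \<times> {0..T}" by auto
  note c = U(5-7) continuous_on_subset[OF cc[OF ch(2)] sub] continuous_on_subset[OF cc[OF h2] sub]
  show "continuous_on ({0..L} \<times> {0<..<T}) (\<lambda>(y, t). h1 (u y t) * uy y t)"
    "continuous_on ({0..L} \<times> {0<..<T}) (\<lambda>(y, t). h2 (u y t) * (uy y t)\<^sup>2 + h1 (u y t) * uyy y t)"
    "continuous_on ({0..L} \<times> {0<..<T}) (\<lambda>(y, t). h1 (u y t) * ut y t)"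
    using c unfolding case_prod_beta by (auto intro!: continuous_intros)
  fix y t assume y: "y \<in> {0..L}" and t: "t \<in> {0<..<T}"
  then have s: "u y t \<in> S" by (intro S) auto
  show "((\<lambda>y. h (u y t)) has_real_derivative h1 (u y t) * uy y t) (at y within {0..L})"
    by (rule DERIV_chain2[OF h[OF s] U(2)[OF y t]])
  show "((\<lambda>y. h1 (u y t) * uy y t) has_real_derivative h2 (u y t) * (uy y t)\<^sup>2 + h1 (u y t) * uyy y t) (at y within {0..L})"
    by (rule DERIV_cong[OF DERIV_mult[OF DERIV_chain2[OF h1[OF s] U(2)[OF y t]] U(3)[OF y t]]])
      (simp add: power2_eq_square)
  show "((\<lambda>t. h (u y t)) has_real_derivative h1 (u y t) * ut y t) (at t)"
    by (rule DERIV_chain2[OF h[OF s] U(4)[OF y t]])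
qed

lemma C21_exp:
  assumes u: "C21 L T u uy uyy ut"
  shows "C21 L T (\<lambda>y t. exp (c * u y t)) (\<lambda>y t. c * exp (c * u y t) * uy y t)
    (\<lambda>y t. c\<^sup>2 * exp (c * u y t) * (uy y t)\<^sup>2 + c * exp (c * u y t) * uyy y t) (\<lambda>y t. c * exp (c * u y t) * ut y t)"
  by (rule C21_compose[OF u, of UNIV]) (auto intro!: derivative_eq_intros continuous_intros simp: power2_eq_square)

lemma C21_ln:
  assumes u: "C21 L T u uy uyy ut" and pos: "\<And>y t. y \<in> {0..L} \<Longrightarrow> t \<in> {0..T} \<Longrightarrow> u y t > 0"
  shows "C21 L T (\<lambda>y t. c * ln (u y t)) (\<lambda>y t. c / u y t * uy y t)
    (\<lambda>y t. - c / (u y t)\<^sup>2 * (uy y t)\<^sup>2 + c / u y t * uyy y t) (\<lambda>y t. c / u y t * ut y t)"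
  by (rule C21_compose[OF u, of "{0<..}"]) (use pos in \<open>auto intro!: derivative_eq_intros continuous_intros simp: power2_eq_square\<close>)

lemma vector_derivative_Icc:
  fixes f :: "real \<Rightarrow> real"
  assumes "L > 0" "y \<in> {0..L}" "(f has_real_derivative D) (at y within {0..L})"
  shows "vector_derivative f (at y within {0..L}) = D"
  using vector_derivative_within_closed_interval[of 0 L y f D] assms
  by (simp add: has_real_derivative_iff_has_vector_derivative)

lemma deriv_within_C21:
  assumes L: "L > 0" and w: "C21 L T w wy wyy wt" and y: "y \<in> {0..L}" and t: "t \<in> {0<..<T}"
  shows "deriv_within {0..L} 1 (\<lambda>y. w y t) y = wy y t"
    and "deriv_within {0..L} 2 (\<lambda>y. w y t) y = wyy y t"
proof -
  have 1: "deriv_within {0..L} 1 (\<lambda>y. w y t) y = wy y t" if "y \<in> {0..L}" for y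
    using vector_derivative_Icc[OF L that C21D(2)[OF w that t]] by simp
  show "deriv_within {0..L} 1 (\<lambda>y. w y t) y = wy y t" by (rule 1[OF y])
  have "(deriv_within {0..L} 1 (\<lambda>y. w y t) has_real_derivative wyy y t) (at y within {0..L})"
    by (rule has_field_derivative_transform[OF y 1[symmetric] C21D(3)[OF w y t]])
  from vector_derivative_Icc[OF L y this]
  show "deriv_within {0..L} 2 (\<lambda>y. w y t) y = wyy y t"
    by (simp add: numeral_2_eq_2)
qed

lemma has_real_derivative_deriv_within:
  fixes f :: "real \<Rightarrow> real"
  assumes "deriv_within S k f differentiable (at x within S)"
    and "at x within S \<noteq> bot"
  shows "(deriv_within S k f has_real_derivative deriv_within S (Suc k) f x) (at x within S)"
  using assms by (simp add: has_real_derivative_iff_has_vector_derivative vector_derivative_works)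

lemma zero_on_closed_interval:
  fixes h :: "real \<Rightarrow> real"
  assumes L: "L > 0" and h: "continuous_on {0..L} h" and z: "\<And>y. y \<in> {0<..<L} \<Longrightarrow> h y = 0" and y: "y \<in> {0..L}"
  shows "h y = 0"
proof -
  have "closure {0<..<L} = {0..L}" using L by simp
  then show ?thesis
    using continuous_constant_on_closure[of "{0<..<L}" h 0 y] h z y by simp
qed

lemma has_real_derivative_imp_differentiable:
  fixes f :: "real \<Rightarrow> real"
  shows "(f has_real_derivative D) (at x within S) \<Longrightarrow> f differentiable (at x within S)"
  by (auto simp: real_differentiable_def)

lemma Ck_on_C21:
  assumes L: "L > 0" and w: "C21 L T w wy wyy wt" and t: "t \<in> {0<..<T}"
  shows "Ck_on {0..L} 2 (\<lambda>y. w y t)"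
proof -
  note d = deriv_within_C21[OF L w _ t]
  have 0: "(\<lambda>y. w y t) differentiable (at y within {0..L})" if "y \<in> {0..L}" for y
    using C21D(2)[OF w that t] by (rule has_real_derivative_imp_differentiable)
  have 1: "deriv_within {0..L} 1 (\<lambda>y. w y t) differentiable (at y within {0..L})" if "y \<in> {0..L}" for y
    using has_field_derivative_transform[OF that d(1)[symmetric] C21D(3)[OF w that t]] by (rule has_real_derivative_imp_differentiable)
  have "continuous_on {0..L} (\<lambda>y. wyy y t)"
    by (rule continuous_on_compose2[OF C21D(6)[OF w], of _ "\<lambda>y. (y, t)", simplified]) (use t in \<open>auto intro!: continuous_intros\<close>)
  then have "continuous_on {0..L} (deriv_within {0..L} 2 (\<lambda>y. w y t))"
    by (rule continuous_on_eq) (use d(2) in auto)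
  moreover have "deriv_within {0..L} k (\<lambda>y. w y t) differentiable (at y within {0..L})" if "k < 2" "y \<in> {0..L}" for k y
    using 0[OF that(2)] 1[OF that(2)] that(1) by (cases "k = 0") (auto simp: less_2_cases_iff)
  ultimately show ?thesis by (auto simp: Ck_on_def)
qed

section \<open>The heat equation on a metric graph and its maximum principle\<close>

text \<open>
  The second derivative test at a point that may be an end of the interval: a critical point is compared
  with the points on whichever side is available.
\<close>

lemma not_max_if_second_deriv_pos:
  fixes f f' :: "real \<Rightarrow> real"
  assumes L: "L > 0" and y: "y \<in> {0..L}"
    and f: "\<And>z. z \<in> {0..L} \<Longrightarrow> (f has_real_derivative f' z) (at z within {0..L})"
    and f': "(f' has_real_derivative D) (at y within {0..L})" "f' y = 0" and D: "D > 0"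
  shows "\<exists>z\<in>{0..L}. f z > f y"
proof -
  have mvt: "\<exists>x\<in>{a<..<b}. f b - f a = f' x * (b - a)" if "a < b" "0 \<le> a" "b \<le> L" for a b
  proof -
    have "(f has_derivative (\<lambda>h. f' x * h)) (at x within {a..b})" if "x \<in> {a..b}" for x
      using has_field_derivative_subset[OF f[of x], of "{a..b}"] that \<open>0 \<le> a\<close> \<open>b \<le> L\<close>
      by (auto simp: has_field_derivative_def)
    from mvt_simple[OF \<open>a < b\<close> this] show ?thesis by auto
  qed
  show ?thesis
  proof (cases "y < L")
    case True
    obtain d where d: "d > 0" "\<And>h. \<lbrakk>h > 0; y + h \<in> {0..L}; h < d\<rbrakk> \<Longrightarrow> f' y < f' (y + h)"
      using has_real_derivative_pos_inc_right[OF f'(1) D] by blast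
    define z where "z = y + min (d / 2) (L - y)"
    have z: "y < z" "z \<le> L" "z < y + d" using d True by (auto simp: z_def)
    obtain x where x: "x \<in> {y<..<z}" "f z - f y = f' x * (z - y)" using mvt[of y z] z y by auto
    have "f' x > 0" using d(2)[of "x - y"] x z y f'(2) by auto
    then have "f z > f y" using x(2) z by (metis diff_gt_0_iff_gt mult_pos_pos)
    then show ?thesis using z y by auto
  next
    case False
    then have yL: "y = L" using y by auto
    obtain d where d: "d > 0" "\<And>h. \<lbrakk>h > 0; y - h \<in> {0..L}; h < d\<rbrakk> \<Longrightarrow> f' (y - h) < f' y"
      using has_real_derivative_pos_inc_left[OF f'(1) D] by blast
    define z where "z = y - min (d / 2) L"
    have z: "z < y" "0 \<le> z" "y < z + d" using d L yL by (auto simp: z_def)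
    obtain x where x: "x \<in> {z<..<y}" "f y - f z = f' x * (y - z)" using mvt[of z y] z y by auto
    have "f' x < 0" using d(2)[of "y - x"] x z yL f'(2) by auto
    then have "f' x * (y - z) < 0" using z by (simp add: mult_neg_pos)
    then have "f z > f y" using x(2) by linarith
    then show ?thesis using z y by auto
  qed
qed

text \<open>
  The ends of the edges are the pairs \<open>(j, b)\<close>, where \<open>b = False\<close> is the end with parameter \<open>0\<close>; the graph
  is given by saying which ends lie at the same vertex. The vertex \<open>v0\<close> carries the Dirichlet condition.
\<close>

locale metric_graph =
  fixes J :: "'j set" and len :: "'j \<Rightarrow> real" and vx :: "'j \<times> bool \<Rightarrow> 'v" and v0 :: 'v
  assumes finJ [simp]: "finite J" and len_pos: "j \<in> J \<Longrightarrow> len j > 0"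
begin

definition ends_at :: "'v \<Rightarrow> ('j \<times> bool) set" where
  "ends_at v = {e \<in> J \<times> UNIV. vx e = v}"

definition end_pos :: "'j \<times> bool \<Rightarrow> real" where
  "end_pos e = (if snd e then len (fst e) else 0)"

definition end_sign :: "'j \<times> bool \<Rightarrow> real" where
  "end_sign e = (if snd e then -1 else 1)"

text \<open>
  The function as seen by a traveller who starts at the end \<open>e\<close>; negative \<open>z\<close> lie beyond this end.
\<close>

definition from_end :: "('j \<Rightarrow> real \<Rightarrow> real) \<Rightarrow> 'j \<times> bool \<Rightarrow> real \<Rightarrow> real" where
  "from_end f e z = f (fst e) (end_pos e + end_sign e * z)"

lemma finite_ends_at [simp]: "finite (ends_at v)"
  unfolding ends_at_def by (rule finite_subset[of _ "J \<times> UNIV"]) auto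

lemma ends_atD: "e \<in> ends_at v \<Longrightarrow> fst e \<in> J" "e \<in> ends_at v \<Longrightarrow> vx e = v"
  by (auto simp: ends_at_def)

lemma ends_atI: "fst e \<in> J \<Longrightarrow> e \<in> ends_at (vx e)"
  by (cases e) (auto simp: ends_at_def)

lemma end_pos_in: "fst e \<in> J \<Longrightarrow> end_pos e \<in> {0..len (fst e)}"
  using len_pos[of "fst e"] by (auto simp: end_pos_def)

text \<open>
  The condition at \<open>v0\<close> is left open, since the Dirichlet values differ between the applications.
\<close>

definition heat_sol :: "real \<Rightarrow> ('j \<Rightarrow> real \<Rightarrow> real \<Rightarrow> real) \<Rightarrow> ('j \<Rightarrow> real \<Rightarrow> real \<Rightarrow> real) \<Rightarrow>
    ('j \<Rightarrow> real \<Rightarrow> real \<Rightarrow> real) \<Rightarrow> bool" where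
  "heat_sol T w wy wt \<longleftrightarrow>
     (\<forall>j\<in>J. C21 (len j) T (w j) (wy j) (wt j) (wt j)) \<and>
     (\<forall>v. \<forall>e\<in>ends_at v. \<forall>e'\<in>ends_at v. \<forall>t\<in>{0..T}. w (fst e) (end_pos e) t = w (fst e') (end_pos e') t) \<and>
     (\<forall>v. v \<noteq> v0 \<longrightarrow> (\<forall>t\<in>{0<..<T}. (\<Sum>e\<in>ends_at v. end_sign e * wy (fst e) (end_pos e) t) = 0))"

lemma heat_solD:
  assumes "heat_sol T w wy wt"
  shows "j \<in> J \<Longrightarrow> C21 (len j) T (w j) (wy j) (wt j) (wt j)"
    and "\<lbrakk>e \<in> ends_at v; e' \<in> ends_at v; t \<in> {0..T}\<rbrakk> \<Longrightarrow> w (fst e) (end_pos e) t = w (fst e') (end_pos e') t"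
    and "\<lbrakk>v \<noteq> v0; t \<in> {0<..<T}\<rbrakk> \<Longrightarrow> (\<Sum>e\<in>ends_at v. end_sign e * wy (fst e) (end_pos e) t) = 0"
  using assms unfolding heat_sol_def by blast+

lemma heat_sol_lincomb:
  assumes w: "heat_sol T w wy wt" and v: "heat_sol T v vy vt"
  shows "heat_sol T (\<lambda>j y t. w j y t + c * v j y t) (\<lambda>j y t. wy j y t + c * vy j y t) (\<lambda>j y t. wt j y t + c * vt j y t)"
  unfolding heat_sol_def
proof (intro conjI allI impI ballI)
  fix j assume "j \<in> J" then show "C21 (len j) T (\<lambda>y t. w j y t + c * v j y t) (\<lambda>y t. wy j y t + c * vy j y t)
    (\<lambda>y t. wt j y t + c * vt j y t) (\<lambda>y t. wt j y t + c * vt j y t)"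
    by (intro C21_lincomb heat_solD[OF w] heat_solD[OF v])
next
  fix u e e' t assume "e \<in> ends_at u" "e' \<in> ends_at u" "t \<in> {0..T}"
  then show "w (fst e) (end_pos e) t + c * v (fst e) (end_pos e) t = w (fst e') (end_pos e') t + c * v (fst e') (end_pos e') t"
    using heat_solD(2)[OF w, of e u e' t] heat_solD(2)[OF v, of e u e' t] by simp
next
  fix u t assume u: "u \<noteq> v0" "t \<in> {0<..<T}"
  have "(\<Sum>e\<in>ends_at u. end_sign e * (wy (fst e) (end_pos e) t + c * vy (fst e) (end_pos e) t)) =
     (\<Sum>e\<in>ends_at u. end_sign e * wy (fst e) (end_pos e) t) + c * (\<Sum>e\<in>ends_at u. end_sign e * vy (fst e) (end_pos e) t)"
    by (simp add: sum_distrib_left sum.distrib algebra_simps)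
  then show "(\<Sum>e\<in>ends_at u. end_sign e * (wy (fst e) (end_pos e) t + c * vy (fst e) (end_pos e) t)) = 0"
    using heat_solD(3)[OF w u] heat_solD(3)[OF v u] by simp
qed

lemma end_deriv_nonpos_at_max:
  assumes j: "fst e \<in> J" and f: "(f has_real_derivative D) (at (end_pos e) within {0..len (fst e)})"
    and max: "\<And>z. z \<in> {0..len (fst e)} \<Longrightarrow> f z \<le> f (end_pos e)"
  shows "end_sign e * D \<le> 0"
proof (cases "snd e")
  case True
  let ?L = "len (fst e)"
  have L: "?L > 0" by (rule len_pos[OF j])
  have "D \<ge> 0"
  proof (rule ccontr)
    assume "\<not> D \<ge> 0"
    then obtain d where d: "d > 0" "\<And>h. \<lbrakk>h > 0; ?L - h \<in> {0..?L}; h < d\<rbrakk> \<Longrightarrow> f ?L < f (?L - h)"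
      using has_real_derivative_neg_dec_left[of f D ?L "{0..?L}"] f True by (auto simp: end_pos_def)
    define h where "h = min (d / 2) ?L"
    have "h > 0" "h < d" "?L - h \<in> {0..?L}" using d(1) L by (auto simp: h_def)
    then show False using d(2)[of h] max[of "?L - h"] True by (auto simp: end_pos_def)
  qed
  then show ?thesis using True by (simp add: end_sign_def)
next
  case False
  let ?L = "len (fst e)"
  have L: "?L > 0" by (rule len_pos[OF j])
  have "D \<le> 0"
  proof (rule ccontr)
    assume "\<not> D \<le> 0"
    then obtain d where d: "d > 0" "\<And>h. \<lbrakk>h > 0; 0 + h \<in> {0..?L}; h < d\<rbrakk> \<Longrightarrow> f 0 < f (0 + h)"
      using has_real_derivative_pos_inc_right[of f D 0 "{0..?L}"] f False by (auto simp: end_pos_def)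
    define h where "h = min (d / 2) ?L"
    have "h > 0" "h < d" "0 + h \<in> {0..?L}" using d(1) L by (auto simp: h_def)
    then show False using d(2)[of h] max[of h] False by (auto simp: end_pos_def)
  qed
  then show ?thesis using False by (simp add: end_sign_def)
qed

text \<open>
  At a maximum of \<open>w - \<epsilon> t\<close> off the parabolic boundary the time derivative, hence also the second space
  derivative, is at least \<open>\<epsilon>\<close>. The first space derivative vanishes there: inside an edge as usual, and at
  a vertex because the outgoing derivatives are all nonpositive while their sum is zero. So some point
  of the same edge has a larger value. The final time is reached by continuity.
\<close>

lemma max_principle:
  assumes w: "heat_sol T w wy wt" and T: "T > 0"
    and init: "\<And>j y. j \<in> J \<Longrightarrow> y \<in> {0..len j} \<Longrightarrow> w j y 0 \<le> M"
    and bdry: "\<And>e t. e \<in> ends_at v0 \<Longrightarrow> t \<in> {0..T} \<Longrightarrow> w (fst e) (end_pos e) t \<le> M"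
    and j: "j \<in> J" and y: "y \<in> {0..len j}" and t: "t \<in> {0..T}"
  shows "w j y t \<le> M"
proof -
  have main: "w j y t \<le> M" if j: "j \<in> J" and y: "y \<in> {0..len j}" and t: "t \<in> {0..<T}" for j y t
  proof (rule ccontr)
    assume gt: "\<not> w j y t \<le> M"
    define \<epsilon> where "\<epsilon> = (w j y t - M) / (2 * (t + 1))"
    have \<epsilon>: "\<epsilon> > 0" using gt t by (simp add: \<epsilon>_def)
    have "\<epsilon> * t \<le> (w j y t - M) / 2" using gt t by (simp add: \<epsilon>_def field_simps)
    then have big: "w j y t - \<epsilon> * t > M" using gt by (simp add: field_simps)
    define h where "h k p = w k (fst p) (snd p) - \<epsilon> * snd p" for k p
    have "\<exists>p\<in>{0..len k} \<times> {0..t}. \<forall>q\<in>{0..len k} \<times> {0..t}. h k q \<le> h k p" if "k \<in> J" for k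
    proof (rule continuous_attains_sup)
      show "compact ({0..len k} \<times> {0..t})" by (intro compact_Times) auto
      show "{0..len k} \<times> {0..t} \<noteq> {}" using len_pos[OF that] t by auto
      show "continuous_on ({0..len k} \<times> {0..t}) (h k)"
      proof -
        have "{0..len k} \<times> {0..t} \<subseteq> {0..len k} \<times> {0..T}" using t by auto
        from continuous_on_subset[OF C21D(1)[OF heat_solD(1)[OF w that]] this] show ?thesis
          unfolding h_def case_prod_beta by (intro continuous_intros)
      qed
    qed
    then obtain P where P: "\<And>k. k \<in> J \<Longrightarrow> P k \<in> {0..len k} \<times> {0..t}"
      "\<And>k q. k \<in> J \<Longrightarrow> q \<in> {0..len k} \<times> {0..t} \<Longrightarrow> h k q \<le> h k (P k)" by metis
    have "Max ((\<lambda>k. h k (P k)) ` J) \<in> (\<lambda>k. h k (P k)) ` J" using j by (intro Max_in) auto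
    then obtain k where k: "k \<in> J" "h k (P k) = Max ((\<lambda>k. h k (P k)) ` J)" by auto
    have max: "h i q \<le> h k (P k)" if "i \<in> J" "q \<in> {0..len i} \<times> {0..t}" for i q
      using P(2)[OF that] that(1) unfolding k(2) by (intro order.trans[OF _ Max_ge]) auto
    obtain x s where xs: "P k = (x, s)" by (cases "P k")
    have x: "x \<in> {0..len k}" and s: "s \<in> {0..t}" using P(1)[OF k(1)] xs by auto
    have hM: "h k (x, s) > M" using max[OF j, of "(y, t)"] big t y xs by (simp add: h_def)
    have wM: "w k x s > M" using hM mult_nonneg_nonneg[of \<epsilon> s] \<epsilon> s unfolding h_def fst_conv snd_conv atLeastAtMost_iff by linarith
    have s0: "s \<in> {0<..<T}" using init[OF k(1) x] wM s t by (cases "s = 0") auto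
    note D = C21D[OF heat_solD(1)[OF w]]
    have wtpos: "wt k x s \<ge> \<epsilon>"
    proof (rule ccontr)
      assume "\<not> wt k x s \<ge> \<epsilon>"
      moreover have "((\<lambda>r. h k (x, r)) has_real_derivative wt k x s - \<epsilon>) (at s)"
        unfolding h_def fst_conv snd_conv using D(4)[OF k(1) x s0] by (auto intro!: derivative_eq_intros)
      ultimately obtain d where d: "d > 0" "\<And>r. r > 0 \<Longrightarrow> r < d \<Longrightarrow> h k (x, s) < h k (x, s - r)"
        using DERIV_neg_dec_left[of "\<lambda>r. h k (x, r)" "wt k x s - \<epsilon>" s] by auto
      define r where "r = min (d / 2) s"
      have "r > 0" "r < d" "s - r \<in> {0..t}" using d(1) s0 s by (auto simp: r_def)
      then show False using d(2)[of r] max[OF k(1), of "(x, s - r)"] x xs by auto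
    qed
    have smax: "w i z s \<le> w k x s" if "i \<in> J" "z \<in> {0..len i}" for i z
      using max[OF that(1), of "(z, s)"] that s xs by (simp add: h_def)
    have "wy k x s = 0"
    proof (cases "0 < x \<and> x < len k")
      case True
      then have "at x within {0..len k} = at x" by (intro at_within_interior) auto
      then have "((\<lambda>y. w k y s) has_real_derivative wy k x s) (at x)" using D(2)[OF k(1) x s0] by simp
      then show ?thesis
        using True smax[OF k(1)]
        by (intro DERIV_local_max[of "\<lambda>y. w k y s" _ x "min x (len k - x)"]) (auto simp: abs_less_iff)
    next
      case False
      define e where "e = (k, x \<noteq> 0)"
      have e: "fst e = k" "end_pos e = x" using False x by (auto simp: e_def end_pos_def)
      have eE: "e \<in> ends_at (vx e)" using ends_atI[of e] e k by simp
      have v: "vx e \<noteq> v0" using bdry[of e s] eE e wM s0 by auto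
      have le: "end_sign e' * wy (fst e') (end_pos e') s \<le> 0" if e': "e' \<in> ends_at (vx e)" for e'
      proof (rule end_deriv_nonpos_at_max[where f = "\<lambda>y. w (fst e') y s"])
        show J: "fst e' \<in> J" by (rule ends_atD[OF e'])
        show "((\<lambda>y. w (fst e') y s) has_real_derivative wy (fst e') (end_pos e') s) (at (end_pos e') within {0..len (fst e')})"
          by (rule D(2)[OF J end_pos_in[OF J] s0])
        have "w (fst e') (end_pos e') s = w k x s"
          using heat_solD(2)[OF w e' eE, of s] e s0 by simp
        then show "w (fst e') z s \<le> w (fst e') (end_pos e') s" if "z \<in> {0..len (fst e')}" for z
          using smax[OF J that] by simp
      qed
      have "(\<Sum>e'\<in>ends_at (vx e). - (end_sign e' * wy (fst e') (end_pos e') s)) = 0"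
        using heat_solD(3)[OF w v s0] by (simp add: sum_negf)
      then have "end_sign e * wy (fst e) (end_pos e) s = 0"
        using sum_nonneg_eq_0_iff[of "ends_at (vx e)" "\<lambda>e'. - (end_sign e' * wy (fst e') (end_pos e') s)"] le eE by auto
      then show ?thesis unfolding e by (auto simp: end_sign_def split: if_splits)
    qed
    from not_max_if_second_deriv_pos[of "len k" x "\<lambda>y. w k y s" "\<lambda>y. wy k y s" "wt k x s"]
    have "\<exists>z\<in>{0..len k}. w k z s > w k x s"
      using len_pos[OF k(1)] x D(2)[OF k(1) _ s0] D(3)[OF k(1) x s0] \<open>wy k x s = 0\<close> wtpos \<epsilon> by auto
    then show False using smax[OF k(1)] by force
  qed
  show ?thesis
  proof (cases "t = T")
    case True
    have "continuous_on {0..T} (\<lambda>s. (\<lambda>(y, t). w j y t) (y, s))"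
      by (rule continuous_on_compose2[OF C21D(1)[OF heat_solD(1)[OF w j]]]) (use y in \<open>auto intro!: continuous_intros\<close>)
    then have "((\<lambda>s. w j y s) \<longlongrightarrow> w j y T) (at T within {0..T})"
      using T by (auto simp: continuous_on_def)
    then have "((\<lambda>s. w j y s) \<longlongrightarrow> w j y T) (at_left T)"
      using T by (simp add: at_within_Icc_at_left)
    moreover have "\<forall>\<^sub>F s in at_left T. w j y s \<le> M"
      using eventually_at_left_real[OF T] by eventually_elim (use main[OF j y] in auto)
    ultimately have "w j y T \<le> M" by (intro tendsto_upperbound) auto
    then show ?thesis using True by simp
  qed (use main[OF j y] t in auto)
qed

lemma heat_sol_uminus:
  assumes "heat_sol T w wy wt" shows "heat_sol T (\<lambda>j y t. - w j y t) (\<lambda>j y t. - wy j y t) (\<lambda>j y t. - wt j y t)"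
  using heat_sol_lincomb[OF assms assms, of "-2"] by simp

text \<open>
  With \<open>M = 0\<close> this is uniqueness, with small \<open>M\<close> it is stability with respect to the data.
\<close>

lemma heat_sol_compare:
  assumes w: "heat_sol T w wy wt" and v: "heat_sol T v vy vt" and T: "T > 0"
    and init: "\<And>j y. j \<in> J \<Longrightarrow> y \<in> {0..len j} \<Longrightarrow> \<bar>w j y 0 - v j y 0\<bar> \<le> M"
    and bdry: "\<And>e t. e \<in> ends_at v0 \<Longrightarrow> t \<in> {0..T} \<Longrightarrow> \<bar>w (fst e) (end_pos e) t - v (fst e) (end_pos e) t\<bar> \<le> M"
    and j: "j \<in> J" and y: "y \<in> {0..len j}" and t: "t \<in> {0..T}"
  shows "\<bar>w j y t - v j y t\<bar> \<le> M"
proof -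
  have "w j y t + - 1 * v j y t \<le> M"
    by (rule max_principle[OF heat_sol_lincomb[OF w v] T _ _ j y t]) (use init bdry in \<open>force simp: abs_le_iff\<close>)+
  moreover have "v j y t + - 1 * w j y t \<le> M"
    by (rule max_principle[OF heat_sol_lincomb[OF v w] T _ _ j y t]) (use init bdry in \<open>force simp: abs_le_iff\<close>)+
  ultimately show ?thesis by (simp add: abs_le_iff)
qed

section \<open>Solutions obtained by reflection at the vertices\<close>

text \<open>
  How far a point of the line lies outside the edge; the reflection procedure recurses on it.
\<close>

definition overshoot :: "'j \<Rightarrow> real \<Rightarrow> real" where
  "overshoot j z = max 0 (max (- z) (z - len j))"

text \<open>
  The value beyond the end \<open>e\<close>, at distance \<open>z\<close> from it. The rule says that \<open>from_end g e\<close> minus the mean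
  over the incident edges is odd, and that at \<open>v0\<close> the difference \<open>from_end g e - B\<close> is odd.
\<close>

definition mirror_value :: "(real \<Rightarrow> real) \<Rightarrow> ('j \<Rightarrow> real \<Rightarrow> real) \<Rightarrow> 'j \<times> bool \<Rightarrow> real \<Rightarrow> real" where
  "mirror_value B g e z = (if vx e = v0 then 2 * B z
     else 2 / card (ends_at (vx e)) * (\<Sum>e'\<in>ends_at (vx e). from_end g e' z)) - from_end g e z"

definition reflect :: "(real \<Rightarrow> real) \<Rightarrow> ('j \<Rightarrow> real \<Rightarrow> real) \<Rightarrow> ('j \<Rightarrow> real \<Rightarrow> real) \<Rightarrow> 'j \<Rightarrow> real \<Rightarrow> real" where
  "reflect B f0 g j z = (if z < 0 then mirror_value B g (j, False) (- z)
     else if z > len j then mirror_value B g (j, True) (z - len j) else f0 j z)"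

text \<open>
  A reflection at distance \<open>z\<close> beyond an end looks up values at distance \<open>z\<close> from an end, towards the
  edge; they lie on the edge or overshoot it at its other end, by at most \<open>z - min_len\<close>. So if the
  iteration starts from an arbitrary continuation of \<open>f0\<close>, the values are final up to an overshoot of
  \<open>n * min_len\<close> after \<open>n\<close> steps; the constant continuation is used because it is continuous.
\<close>

definition iter_reflect :: "(real \<Rightarrow> real) \<Rightarrow> ('j \<Rightarrow> real \<Rightarrow> real) \<Rightarrow> nat \<Rightarrow> 'j \<Rightarrow> real \<Rightarrow> real" where
  "iter_reflect B f0 n = (reflect B f0 ^^ n) (\<lambda>j z. f0 j (max 0 (min (len j) z)))"

definition min_len :: real where
  "min_len = Min (insert 1 (len ` J))"

lemma min_len: "min_len > 0" "j \<in> J \<Longrightarrow> min_len \<le> len j"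
  using len_pos by (auto simp: min_len_def)

definition extension :: "(real \<Rightarrow> real) \<Rightarrow> ('j \<Rightarrow> real \<Rightarrow> real) \<Rightarrow> 'j \<Rightarrow> real \<Rightarrow> real" where
  "extension B f0 j z = iter_reflect B f0 (nat \<lceil>overshoot j z / min_len\<rceil>) j z"

lemma mirror_value_cong:
  assumes "fst e \<in> J" "\<And>e'. fst e' \<in> J \<Longrightarrow> from_end g e' z = from_end h e' z"
  shows "mirror_value B g e z = mirror_value B h e z"
  using assms ends_atD(1) by (auto simp: mirror_value_def intro!: sum.cong)

lemma overshoot_from_end:
  assumes "fst e \<in> J" "z \<ge> 0"
  shows "overshoot (fst e) (end_pos e + end_sign e * z) \<le> max 0 (z - min_len)"
  using min_len(2)[OF assms(1)] min_len(1) assms(2)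
  by (auto simp: overshoot_def end_pos_def end_sign_def)

lemma reflect_cong:
  assumes j: "j \<in> J" and "\<And>k x. k \<in> J \<Longrightarrow> overshoot k x \<le> max 0 (overshoot j z - min_len) \<Longrightarrow> g k x = h k x"
  shows "reflect B f0 g j z = reflect B f0 h j z"
proof -
  have "from_end g e' x = from_end h e' x" if "fst e' \<in> J" "x \<ge> 0" "x \<le> overshoot j z" for e' x
    unfolding from_end_def using overshoot_from_end[OF that(1,2)] that by (intro assms(2)) auto
  then show ?thesis
    using j unfolding reflect_def by (auto intro!: mirror_value_cong simp: overshoot_def)
qed

lemma iter_reflect_Suc: "iter_reflect B f0 (Suc n) = reflect B f0 (iter_reflect B f0 n)"
  by (simp add: iter_reflect_def)

lemma iter_reflect_on_edge: "j \<in> J \<Longrightarrow> z \<in> {0..len j} \<Longrightarrow> iter_reflect B f0 n j z = f0 j z"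
  by (cases n) (auto simp: iter_reflect_Suc reflect_def iter_reflect_def)

lemma overshoot_zero_iff: "j \<in> J \<Longrightarrow> overshoot j z \<le> 0 \<longleftrightarrow> z \<in> {0..len j}"
  by (auto simp: overshoot_def)

lemma iter_reflect_stable1:
  assumes "j \<in> J" "overshoot j z \<le> n * min_len"
  shows "iter_reflect B f0 (Suc n) j z = iter_reflect B f0 n j z"
  using assms
proof (induction n arbitrary: j z)
  case 0 then show ?case by (simp add: overshoot_zero_iff iter_reflect_on_edge)
next
  case (Suc n)
  have "reflect B f0 (iter_reflect B f0 (Suc n)) j z = reflect B f0 (iter_reflect B f0 n) j z"
  proof (rule reflect_cong[OF Suc.prems(1)])
    fix k x assume "k \<in> J" "overshoot k x \<le> max 0 (overshoot j z - min_len)"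
    then show "iter_reflect B f0 (Suc n) k x = iter_reflect B f0 n k x"
      using Suc.prems(2) min_len(1) by (intro Suc.IH) (auto simp: algebra_simps max_def split: if_splits intro: order.trans)
  qed
  then show ?case by (simp only: iter_reflect_Suc)
qed

lemma iter_reflect_stable:
  assumes j: "j \<in> J" and "overshoot j z \<le> n * min_len" "n \<le> m"
  shows "iter_reflect B f0 m j z = iter_reflect B f0 n j z"
  using assms(3)
proof (induction m rule: dec_induct)
  case (step m)
  have "overshoot j z \<le> m * min_len"
    using assms(2) step.hyps min_len(1) by (elim order.trans) (auto intro!: mult_right_mono)
  from iter_reflect_stable1[OF j this] step.IH show ?case by simp
qed simp

lemma extension_eq_iter:
  assumes j: "j \<in> J" and n: "overshoot j z \<le> n * min_len"
  shows "extension B f0 j z = iter_reflect B f0 n j z"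
proof -
  let ?m = "nat \<lceil>overshoot j z / min_len\<rceil>"
  have "overshoot j z / min_len \<le> ?m" by linarith
  then have "overshoot j z \<le> ?m * min_len" using min_len(1) by (simp add: field_simps)
  moreover have "?m \<le> n"
    using n min_len(1) by (simp add: nat_le_iff ceiling_le_iff divide_le_eq)
  ultimately show ?thesis unfolding extension_def using iter_reflect_stable[OF j] by metis
qed

lemma ex_iter_bound: "\<exists>n::nat. a \<le> n * min_len"
  using reals_Archimedean3[OF min_len(1)] less_imp_le by blast

lemma extension_fixpoint:
  assumes j: "j \<in> J"
  shows "extension B f0 j z = reflect B f0 (extension B f0) j z"
proof -
  obtain n :: nat where n: "overshoot j z \<le> n * min_len" using ex_iter_bound by blast
  have "extension B f0 j z = iter_reflect B f0 (Suc n) j z"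
    using n min_len(1) by (intro extension_eq_iter[OF j]) (simp add: algebra_simps)
  also have "\<dots> = reflect B f0 (extension B f0) j z"
    unfolding iter_reflect_Suc
  proof (rule reflect_cong[OF j])
    fix k x assume k: "k \<in> J" "overshoot k x \<le> max 0 (overshoot j z - min_len)"
    have "0 \<le> n * min_len" using min_len(1) by simp
    then have "overshoot k x \<le> n * min_len" using n k min_len(1) by linarith
    then show "iter_reflect B f0 n k x = extension B f0 k x"
      using extension_eq_iter[OF k(1)] by simp
  qed
  finally show ?thesis .
qed

lemma extension_on_edge: "j \<in> J \<Longrightarrow> z \<in> {0..len j} \<Longrightarrow> extension B f0 j z = f0 j z"
  using extension_eq_iter[of j z 0] by (simp add: overshoot_zero_iff iter_reflect_on_edge)

definition compatible :: "(real \<Rightarrow> real) \<Rightarrow> ('j \<Rightarrow> real \<Rightarrow> real) \<Rightarrow> bool" where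
  "compatible B f0 \<longleftrightarrow> (\<forall>j\<in>J. continuous_on {0..len j} (f0 j)) \<and>
     (\<forall>v. \<forall>e\<in>ends_at v. \<forall>e'\<in>ends_at v. f0 (fst e) (end_pos e) = f0 (fst e') (end_pos e')) \<and>
     (\<forall>e\<in>ends_at v0. f0 (fst e) (end_pos e) = B 0)"

text \<open>
  Compatibility at the vertices is what makes the two pieces meet at an end of the edge, so that the
  reflected function is continuous.
\<close>

lemma mirror_value_0:
  assumes c: "compatible B f0" and j: "fst e \<in> J" and g: "\<And>j z. j \<in> J \<Longrightarrow> z \<in> {0..len j} \<Longrightarrow> g j z = f0 j z"
  shows "mirror_value B g e 0 = f0 (fst e) (end_pos e)"
proof -
  have fe: "from_end g e' 0 = f0 (fst e') (end_pos e')" if "fst e' \<in> J" for e'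
    using g[OF that end_pos_in[OF that]] by (simp add: from_end_def)
  have eE: "e \<in> ends_at (vx e)" by (rule ends_atI[OF j])
  show ?thesis
  proof (cases "vx e = v0")
    case True
    then have "e \<in> ends_at v0" using eE by simp
    moreover have "\<forall>e\<in>ends_at v0. f0 (fst e) (end_pos e) = B 0" using c unfolding compatible_def by blast
    ultimately have "f0 (fst e) (end_pos e) = B 0" by blast
    then show ?thesis using True fe[OF j] by (simp add: mirror_value_def)
  next
    case False
    have "(\<Sum>e'\<in>ends_at (vx e). from_end g e' 0) = (\<Sum>e'\<in>ends_at (vx e). f0 (fst e) (end_pos e))"
    proof (rule sum.cong[OF refl])
      fix e' assume e': "e' \<in> ends_at (vx e)"
      then have "f0 (fst e') (end_pos e') = f0 (fst e) (end_pos e)" using c eE unfolding compatible_def by blast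
      then show "from_end g e' 0 = f0 (fst e) (end_pos e)" using fe[OF ends_atD(1)[OF e']] by simp
    qed
    also have "\<dots> = card (ends_at (vx e)) * f0 (fst e) (end_pos e)" by simp
    finally have S: "(\<Sum>e'\<in>ends_at (vx e). from_end g e' 0) = card (ends_at (vx e)) * f0 (fst e) (end_pos e)" .
    have ne: "ends_at (vx e) \<noteq> {}" using eE by blast
    then show ?thesis using False fe[OF j] unfolding mirror_value_def S by simp
  qed
qed

lemma continuous_on_mirror_value:
  assumes B: "continuous_on UNIV B" and g: "\<And>j. j \<in> J \<Longrightarrow> continuous_on UNIV (g j)" and j: "fst e \<in> J"
  shows "continuous_on UNIV (mirror_value B g e)"
proof -
  have fe: "continuous_on UNIV (from_end g e')" if "fst e' \<in> J" for e'
    unfolding from_end_def by (intro continuous_on_compose2[OF g[OF that]] continuous_intros) auto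
  show ?thesis
  proof (cases "vx e = v0")
    case True
    show ?thesis unfolding mirror_value_def if_P[OF True]
      by (intro continuous_on_diff continuous_on_mult_left B fe j)
  next
    case False
    show ?thesis unfolding mirror_value_def if_not_P[OF False]
      by (intro continuous_on_diff continuous_on_mult_left continuous_on_sum fe j) (rule ends_atD(1))
  qed
qed

lemma continuous_on_reflect:
  assumes c: "compatible B f0" and B: "continuous_on UNIV B" and g: "\<And>j. j \<in> J \<Longrightarrow> continuous_on UNIV (g j)"
    and gf: "\<And>j z. j \<in> J \<Longrightarrow> z \<in> {0..len j} \<Longrightarrow> g j z = f0 j z" and j: "j \<in> J"
  shows "continuous_on UNIV (reflect B f0 g j)"
proof -
  let ?l = "mirror_value B g (j, False)" and ?r = "mirror_value B g (j, True)"
  have L: "len j > 0" by (rule len_pos[OF j])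
  have v: "?l 0 = f0 j 0" "?r 0 = f0 j (len j)"
    using mirror_value_0[OF c _ gf, of "(j, False)"] mirror_value_0[OF c _ gf, of "(j, True)"] j by (auto simp: end_pos_def)
  have cl: "continuous_on {..0} (\<lambda>z. ?l (- z))"
    by (intro continuous_on_compose2[OF continuous_on_mirror_value[OF B g]] continuous_intros) (use j in auto)
  have cr: "continuous_on {len j..} (\<lambda>z. ?r (z - len j))"
    by (intro continuous_on_compose2[OF continuous_on_mirror_value[OF B g]] continuous_intros) (use j in auto)
  have cf: "continuous_on {0..len j} (f0 j)" using c j by (auto simp: compatible_def)
  have 1: "continuous_on {..0} (reflect B f0 g j)"
    by (rule continuous_on_eq[OF cl]) (use v L in \<open>auto simp: reflect_def\<close>)
  have 2: "continuous_on {0..len j} (reflect B f0 g j)"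
    by (rule continuous_on_eq[OF cf]) (auto simp: reflect_def)
  have 3: "continuous_on {len j..} (reflect B f0 g j)"
    by (rule continuous_on_eq[OF cr]) (use v L in \<open>auto simp: reflect_def\<close>)
  have "continuous_on ({..0} \<union> ({0..len j} \<union> {len j..})) (reflect B f0 g j)"
    by (intro continuous_on_closed_Un 1 2 3 closed_Un) auto
  moreover have "{..0} \<union> ({0..len j} \<union> {len j..}) = UNIV" by auto
  ultimately show ?thesis by simp
qed

lemma continuous_on_iter_reflect:
  assumes c: "compatible B f0" and B: "continuous_on UNIV B"
  shows "j \<in> J \<Longrightarrow> continuous_on UNIV (iter_reflect B f0 n j)"
proof (induction n arbitrary: j)
  case 0
  have cf: "continuous_on {0..len j} (f0 j)" using c 0 by (auto simp: compatible_def)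
  show ?case unfolding iter_reflect_def
    by (simp, rule continuous_on_compose2[OF cf]) (use len_pos[OF 0] in \<open>auto intro!: continuous_intros\<close>)
next
  case (Suc n)
  show ?case unfolding iter_reflect_Suc
    by (intro continuous_on_reflect[OF c B] Suc iter_reflect_on_edge)
qed

lemma continuous_on_extension:
  assumes c: "compatible B f0" and B: "continuous_on UNIV B" and j: "j \<in> J"
  shows "continuous_on UNIV (extension B f0 j)"
proof -
  have "continuous_on {z. overshoot j z < real n * min_len} (extension B f0 j)" for n
    by (rule continuous_on_eq[OF continuous_on_subset[OF continuous_on_iter_reflect[OF c B j, of n]]])
      (auto simp: extension_eq_iter[OF j, OF less_imp_le])
  moreover have "open {z. overshoot j z < real n * min_len}" for n
    unfolding overshoot_def by (intro open_Collect_less continuous_intros)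
  ultimately have "continuous_on (\<Union>n. {z. overshoot j z < real n * min_len}) (extension B f0 j)"
    by (intro continuous_on_open_UN) auto
  moreover have "(\<Union>n. {z. overshoot j z < real n * min_len}) = UNIV"
    using reals_Archimedean3[OF min_len(1)] by auto
  ultimately show ?thesis by simp
qed

text \<open>
  A value beyond an end is bounded by three values whose overshoot is smaller by \<open>min_len\<close>, or by one
  such value and twice a value of \<open>B\<close>. Induction on the number of reflections therefore gives
  exponential growth in the overshoot, with a rate that exceeds the one of \<open>B\<close>.
\<close>

lemma exp_growth_extension:
  assumes c: "compatible B f0" and B: "exp_growth B" and j: "j \<in> J"
  shows "exp_growth (extension B f0 j)"
proof -
  obtain A k where A: "A > 0" "k > 0" "\<And>z. \<bar>B z\<bar> \<le> A * exp (k * \<bar>z\<bar>)" using exp_growthE[OF B] by blast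
  have "\<exists>D. \<forall>z\<in>{0..len j}. \<bar>f0 j z\<bar> \<le> D" if "j \<in> J" for j
  proof -
    have "compact (f0 j ` {0..len j})"
      using c that by (intro compact_continuous_image) (auto simp: compatible_def)
    then have "bounded (f0 j ` {0..len j})" by (rule compact_imp_bounded)
    then show ?thesis by (auto simp: bounded_iff)
  qed
  then obtain D where D: "\<And>j z. j \<in> J \<Longrightarrow> z \<in> {0..len j} \<Longrightarrow> \<bar>f0 j z\<bar> \<le> D j" by metis
  define D0 where "D0 = A + Max (insert 0 (D ` J))"
  have D0: "\<bar>f0 j z\<bar> \<le> D0" if "j \<in> J" "z \<in> {0..len j}" for j z
  proof -
    have "D j \<le> Max (insert 0 (D ` J))" using that by (intro Max_ge) auto
    then show ?thesis using D[OF that] A unfolding D0_def by linarith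
  qed
  have "0 \<le> Max (insert 0 (D ` J))" by (intro Max_ge) auto
  then have AD: "A \<le> D0" by (simp add: D0_def)
  \<comment> \<open>The rate below makes \<open>exp (\<kappa> * min_len) \<ge> 5\<close>, so a decrease of the overshoot by \<open>min_len\<close> improves the
    bound from \<open>M\<close> to \<open>D0\<close>, and a combination of three such values stays below \<open>M\<close>.\<close>
  define M where "M = 5 * D0"
  define \<kappa> where "\<kappa> = k + 4 / min_len"
  have \<kappa>: "\<kappa> > 0" "k \<le> \<kappa>" using A min_len(1) by (auto simp: \<kappa>_def add_pos_pos)
  have e5: "5 \<le> exp (\<kappa> * min_len)"
  proof -
    have "1 + \<kappa> * min_len \<le> exp (\<kappa> * min_len)" by (rule exp_ge_add_one_self)
    moreover have "\<kappa> * min_len \<ge> 4" using A min_len(1) by (simp add: \<kappa>_def algebra_simps)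
    ultimately show ?thesis by linarith
  qed
  have D0pos: "D0 > 0" using A AD by linarith
  have main: "\<bar>extension B f0 j z\<bar> \<le> M * exp (\<kappa> * overshoot j z)"
    if "j \<in> J" "overshoot j z \<le> n * min_len" for j z and n :: nat
    using that
  proof (induction n arbitrary: j z)
    case 0
    then have "z \<in> {0..len j}" "overshoot j z = 0" using overshoot_zero_iff[of j z] by (auto simp: overshoot_def)
    then show ?case using D0[of j z] 0 D0pos by (simp add: extension_on_edge M_def)
  next
    case (Suc n)
    show ?case
    proof (cases "overshoot j z \<le> 0")
      case True
      then have "z \<in> {0..len j}" "overshoot j z = 0" using overshoot_zero_iff[of j z] Suc by (auto simp: overshoot_def)
      then show ?thesis using D0[of j z] Suc D0pos by (simp add: extension_on_edge M_def)
    next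
      case False
      define r where "r = overshoot j z"
      define e where "e = (j, z > 0)"
      have r: "r > 0" using False by (simp add: r_def)
      have fe: "\<bar>from_end (extension B f0) e' r\<bar> \<le> D0 * exp (\<kappa> * r)" if e': "fst e' \<in> J" for e'
      proof -
        let ?z = "end_pos e' + end_sign e' * r"
        have o: "overshoot (fst e') ?z \<le> max 0 (r - min_len)" using overshoot_from_end[OF e'] r by simp
        show ?thesis
        proof (cases "overshoot (fst e') ?z \<le> 0")
          case True
          then have "?z \<in> {0..len (fst e')}" using overshoot_zero_iff[OF e'] by blast
          then have "\<bar>from_end (extension B f0) e' r\<bar> \<le> D0" using D0[OF e'] e' by (simp add: from_end_def extension_on_edge)
          also have "\<dots> \<le> D0 * exp (\<kappa> * r)" using D0pos \<kappa> r by simp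
          finally show ?thesis .
        next
          case False
          then have o': "overshoot (fst e') ?z \<le> r - min_len" using o by auto
          moreover have "r \<le> Suc n * min_len" using Suc.prems(2) by (simp add: r_def)
          ultimately have "overshoot (fst e') ?z \<le> n * min_len" by (simp add: algebra_simps)
          then have "\<bar>from_end (extension B f0) e' r\<bar> \<le> M * exp (\<kappa> * overshoot (fst e') ?z)"
            unfolding from_end_def by (rule Suc.IH[OF e'])
          also have "\<dots> \<le> M * exp (\<kappa> * (r - min_len))" using o' \<kappa> D0pos by (simp add: M_def)
          also have "\<dots> = D0 * (5 * exp (\<kappa> * (r - min_len)))" by (simp add: M_def)
          also have "\<dots> \<le> D0 * (exp (\<kappa> * min_len) * exp (\<kappa> * (r - min_len)))"
            using e5 D0pos by (intro mult_left_mono mult_right_mono) auto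
          also have "\<dots> = D0 * exp (\<kappa> * r)" by (simp add: exp_add[symmetric] algebra_simps)
          finally show ?thesis .
        qed
      qed
      have eJ: "fst e \<in> J" using Suc.prems by (simp add: e_def)
      have "extension B f0 j z = mirror_value B (extension B f0) e r"
        unfolding extension_fixpoint[OF Suc.prems(1)] reflect_def e_def r_def
        using False len_pos[OF Suc.prems(1)] by (auto simp: overshoot_def max_def split: if_splits)
      also have "\<bar>\<dots>\<bar> \<le> 2 * (D0 * exp (\<kappa> * r)) + D0 * exp (\<kappa> * r)"
      proof (cases "vx e = v0")
        case True
        have "\<bar>B r\<bar> \<le> A * exp (k * r)" using A(3)[of r] r by simp
        also have "\<dots> \<le> D0 * exp (\<kappa> * r)" using AD A \<kappa> r D0pos by (intro mult_mono) auto
        finally have "\<bar>B r\<bar> \<le> D0 * exp (\<kappa> * r)" .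
        then show ?thesis using fe[OF eJ] True by (simp add: mirror_value_def)
      next
        case False
        let ?d = "card (ends_at (vx e))"
        have d: "?d > 0" using ends_atI[OF eJ] by (auto simp: card_gt_0_iff)
        have "\<bar>\<Sum>e'\<in>ends_at (vx e). from_end (extension B f0) e' r\<bar> \<le> (\<Sum>e'\<in>ends_at (vx e). D0 * exp (\<kappa> * r))"
          by (intro order.trans[OF sum_abs] sum_mono fe) (auto dest: ends_atD)
        then have "\<bar>\<Sum>e'\<in>ends_at (vx e). from_end (extension B f0) e' r\<bar> \<le> ?d * (D0 * exp (\<kappa> * r))" by simp
        then have "\<bar>2 / ?d * (\<Sum>e'\<in>ends_at (vx e). from_end (extension B f0) e' r)\<bar> \<le> 2 * (D0 * exp (\<kappa> * r))"
          using d by (simp add: abs_mult field_simps)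
        then show ?thesis using fe[OF eJ] unfolding mirror_value_def if_not_P[OF False] by linarith
      qed
      also have "\<dots> \<le> M * exp (\<kappa> * overshoot j z)" using D0pos by (simp add: M_def r_def algebra_simps)
      finally show ?thesis by simp
    qed
  qed
  have "\<bar>extension B f0 j z\<bar> \<le> M * exp (\<kappa> * \<bar>z\<bar>)" for z
  proof -
    obtain n :: nat where n: "overshoot j z \<le> n * min_len" using ex_iter_bound by blast
    have "\<bar>extension B f0 j z\<bar> \<le> M * exp (\<kappa> * overshoot j z)" by (rule main[OF j n])
    also have "\<dots> \<le> M * exp (\<kappa> * \<bar>z\<bar>)"
      using \<kappa> D0pos len_pos[OF j] by (auto simp: M_def overshoot_def)
    finally show ?thesis .
  qed
  then show ?thesis unfolding exp_growth_def by blast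
qed

lemma extension_mirror:
  assumes j: "fst e \<in> J" and z: "z > 0"
  shows "from_end (extension B f0) e (- z) = mirror_value B (extension B f0) e z"
  using len_pos[OF j] z unfolding from_end_def extension_fixpoint[OF j, of _ _ "end_pos e + end_sign e * - z"] reflect_def
  by (cases e) (auto simp: end_pos_def end_sign_def)

lemma heat_flow_even_deriv:
  assumes f: "continuous_on UNIV f" "exp_growth f" and t: "t > 0" and even: "\<And>z. f (- z) = f z"
  shows "heat_flow_y f 0 t = 0"
proof -
  have d: "((\<lambda>y. heat_flow f y t) has_real_derivative heat_flow_y f 0 t) (at 0)" by (rule heat_flow_derivs(1)[OF f t])
  have "((\<lambda>y. heat_flow f (- y) t) has_real_derivative heat_flow_y f 0 t * (- 1)) (at 0)"
    by (rule DERIV_chain2[of "\<lambda>y. heat_flow f y t"]) (use d in \<open>auto intro!: derivative_eq_intros\<close>)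
  moreover have eq: "heat_flow f (- y) t = heat_flow f y t" for y
  proof -
    have "(\<lambda>z. f (0 - z)) = f" by (simp add: even)
    from heat_flow_reflect[of f 0 y t, unfolded this] show ?thesis by (simp only: diff_0)
  qed
  ultimately have "((\<lambda>y. heat_flow f y t) has_real_derivative heat_flow_y f 0 t * (- 1)) (at 0)"
    by (simp only: eq)
  from DERIV_unique[OF d this] show ?thesis by simp
qed

text \<open>
  Parity is preserved by the heat flow; this lemma and the preceding one are the two ways in which the
  reflection rule is used.
\<close>

lemma heat_flow_odd:
  assumes odd: "\<And>z. f (- z) = - f z"
  shows "heat_flow f 0 t = 0"
proof -
  have "heat_flow f 0 t = heat_flow (\<lambda>z. - f z) 0 t" using heat_flow_reflect[of f 0 0 t] odd by simp
  also have "\<dots> = - heat_flow f 0 t" by (simp add: heat_flow_def gauss_avg_def)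
  finally show ?thesis by simp
qed

lemma heat_flow_from_end: "heat_flow (from_end g e) y t = heat_flow (g (fst e)) (end_pos e + end_sign e * y) t"
  using heat_flow_reflect[of "g (fst e)" "len (fst e)" y t]
  by (cases "snd e") (simp_all add: from_end_def[abs_def] end_pos_def end_sign_def)

context
  fixes B f0
  assumes c: "compatible B f0" and B: "continuous_on UNIV B" "exp_growth B" and even: "\<And>z. B (- z) = B z"
begin

abbreviation (input) "X \<equiv> extension B f0"

lemma X_regular: "j \<in> J \<Longrightarrow> continuous_on UNIV (X j)" "j \<in> J \<Longrightarrow> exp_growth (X j)"
  using continuous_on_extension[OF c B(1)] exp_growth_extension[OF c B(2)] by auto

lemma from_end_regular:
  assumes "fst e \<in> J"
  shows "continuous_on UNIV (from_end X e)" "exp_growth (from_end X e)"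
proof -
  show "continuous_on UNIV (from_end X e)"
    unfolding from_end_def by (intro continuous_on_compose2[OF X_regular(1)[OF assms]] continuous_intros) auto
  show "exp_growth (from_end X e)"
    unfolding from_end_def by (rule exp_growth_affine[OF X_regular(2)[OF assms]])
qed

lemma X_mirror:
  assumes j: "fst e \<in> J" and z: "z \<ge> 0"
  shows "from_end X e (- z) = mirror_value B X e z"
proof (cases "z = 0")
  case True
  have "mirror_value B X e 0 = f0 (fst e) (end_pos e)"
    by (rule mirror_value_0[OF c j]) (rule extension_on_edge)
  also have "\<dots> = from_end X e 0" using extension_on_edge[OF j end_pos_in[OF j]] by (simp add: from_end_def)
  finally show ?thesis using True by simp
qed (use extension_mirror[OF j] z in auto)

definition "vsum v z = (\<Sum>e\<in>ends_at v. from_end X e z)"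

lemma vsum_regular: "continuous_on UNIV (vsum v)" "exp_growth (vsum v)"
  unfolding vsum_def
  by (intro continuous_intros exp_growth_sum from_end_regular; auto dest: ends_atD)+

lemma mirror_inner:
  assumes "e \<in> ends_at v" "v \<noteq> v0" "z \<ge> 0"
  shows "from_end X e (- z) = 2 / card (ends_at v) * vsum v z - from_end X e z"
  using X_mirror[OF ends_atD(1)[OF assms(1)] assms(3)] ends_atD(2)[OF assms(1)] assms(2)
  by (simp add: mirror_value_def vsum_def)

text \<open>
  Summing the reflection rule over the \<open>d\<close> ends at a vertex gives \<open>2 S(z) - S(z) = S(z)\<close>.
\<close>

lemma vsum_even:
  assumes v: "v \<noteq> v0" shows "vsum v (- z) = vsum v z"
proof -
  have *: "vsum v (- z) = vsum v z" if z: "z \<ge> 0" for z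
  proof (cases "ends_at v = {}")
    case False
    then have d: "card (ends_at v) \<noteq> 0" by simp
    have "vsum v (- z) = (\<Sum>e\<in>ends_at v. 2 / card (ends_at v) * vsum v z - from_end X e z)"
      unfolding vsum_def[of v "- z"] using mirror_inner[OF _ v z] by (rule sum.cong[OF refl])
    also have "\<dots> = card (ends_at v) * (2 / card (ends_at v) * vsum v z) - vsum v z"
      by (simp add: sum_subtractf vsum_def)
    also have "\<dots> = vsum v z" using d by simp
    finally show ?thesis .
  qed (simp add: vsum_def)
  show ?thesis using *[of z] *[of "- z"] by (cases "z \<ge> 0") auto
qed

text \<open>
  \<open>from_end X e - S / d\<close> is odd, where \<open>S\<close> is the sum over the ends at the vertex, so its heat flow
  vanishes there. The value is thus the same for all ends at the vertex.
\<close>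

lemma end_value:
  assumes e: "e \<in> ends_at v" and v: "v \<noteq> v0"
  shows "heat_flow (X (fst e)) (end_pos e) t = heat_flow (vsum v) 0 t / card (ends_at v)"
proof -
  let ?d = "real (card (ends_at v))"
  let ?h = "\<lambda>z. from_end X e z + (- 1 / ?d) * vsum v z"
  have odd: "?h (- z) = - ?h z" for z
  proof -
    have "?h (- z) = - ?h z" if z: "z \<ge> 0" for z
      unfolding mirror_inner[OF e v z] vsum_even[OF v] by (simp add: field_simps)
    from this[of z] this[of "- z"] show ?thesis by (cases "z \<ge> 0") auto
  qed
  have "0 = heat_flow ?h 0 t" using heat_flow_odd[of ?h, OF odd] by simp
  also have "\<dots> = heat_flow (from_end X e) 0 t + (- 1 / ?d) * heat_flow (vsum v) 0 t"
    by (rule heat_flow_lincomb[OF from_end_regular vsum_regular]) (use ends_atD[OF e] in auto)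
  finally show ?thesis by (simp add: heat_flow_from_end field_simps)
qed

lemma end_value_bdry:
  assumes e: "e \<in> ends_at v0"
  shows "heat_flow (X (fst e)) (end_pos e) t = heat_flow B 0 t"
proof -
  let ?h = "\<lambda>z. from_end X e z + (- 1) * B z"
  have odd: "?h (- z) = - ?h z" for z
  proof -
    have *: "from_end X e (- z) = 2 * B z - from_end X e z" if z: "z \<ge> 0" for z
      using X_mirror[OF ends_atD(1)[OF e] z] ends_atD(2)[OF e] by (simp add: mirror_value_def)
    show ?thesis using *[of z] *[of "- z"] even[of z] by (cases "z \<ge> 0") auto
  qed
  have "0 = heat_flow ?h 0 t" using heat_flow_odd[of ?h, OF odd] by simp
  also have "\<dots> = heat_flow (from_end X e) 0 t + (- 1) * heat_flow B 0 t"
    by (rule heat_flow_lincomb[OF from_end_regular B]) (use ends_atD[OF e] in auto)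
  finally show ?thesis by (simp add: heat_flow_from_end)
qed

text \<open>
  The sum of the outgoing derivatives is the derivative of the heat flow of the even function \<open>vsum v\<close>
  at its centre of symmetry.
\<close>

lemma kirchhoff:
  assumes v: "v \<noteq> v0" and t: "t > 0"
  shows "(\<Sum>e\<in>ends_at v. end_sign e * heat_flow_y (X (fst e)) (end_pos e) t) = 0"
proof -
  have "((\<lambda>y. heat_flow (X (fst e)) (end_pos e + end_sign e * y) t) has_real_derivative
      heat_flow_y (X (fst e)) (end_pos e) t * end_sign e) (at 0)" if e: "e \<in> ends_at v" for e
  proof (rule DERIV_chain2[of "\<lambda>y. heat_flow (X (fst e)) y t"])
    show "((\<lambda>y. heat_flow (X (fst e)) y t) has_real_derivative heat_flow_y (X (fst e)) (end_pos e) t)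
       (at (end_pos e + end_sign e * 0))"
      using heat_flow_derivs(1)[OF X_regular t] ends_atD(1)[OF e] by simp
    show "((\<lambda>y. end_pos e + end_sign e * y) has_real_derivative end_sign e) (at 0)"
      by (auto intro!: derivative_eq_intros)
  qed
  then have "((\<lambda>y. \<Sum>e\<in>ends_at v. heat_flow (X (fst e)) (end_pos e + end_sign e * y) t) has_real_derivative
      (\<Sum>e\<in>ends_at v. heat_flow_y (X (fst e)) (end_pos e) t * end_sign e)) (at 0)"
    by (intro DERIV_sum)
  moreover have "(\<lambda>y. \<Sum>e\<in>ends_at v. heat_flow (X (fst e)) (end_pos e + end_sign e * y) t) = (\<lambda>y. heat_flow (vsum v) y t)"
  proof
    fix y
    have "heat_flow (\<lambda>z. \<Sum>e\<in>ends_at v. from_end X e z) y t = (\<Sum>e\<in>ends_at v. heat_flow (from_end X e) y t)"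
      by (intro heat_flow_sum from_end_regular finite_ends_at) (rule ends_atD(1), assumption)+
    then show "(\<Sum>e\<in>ends_at v. heat_flow (X (fst e)) (end_pos e + end_sign e * y) t) = heat_flow (vsum v) y t"
      unfolding vsum_def heat_flow_from_end by (rule sym)
  qed
  ultimately have "((\<lambda>y. heat_flow (vsum v) y t) has_real_derivative
      (\<Sum>e\<in>ends_at v. heat_flow_y (X (fst e)) (end_pos e) t * end_sign e)) (at 0)" by (simp only:)
  then have "(\<Sum>e\<in>ends_at v. heat_flow_y (X (fst e)) (end_pos e) t * end_sign e) = heat_flow_y (vsum v) 0 t"
    by (rule DERIV_unique[OF _ heat_flow_derivs(1)[OF vsum_regular t]])
  also have "\<dots> = 0" by (rule heat_flow_even_deriv[OF vsum_regular t vsum_even[OF v]])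
  finally show ?thesis by (simp add: mult.commute)
qed

lemma heat_sol_extension:
  "heat_sol T (\<lambda>j. heat_flow (X j)) (\<lambda>j. heat_flow_y (X j)) (\<lambda>j. heat_flow_yy (X j))"
  unfolding heat_sol_def
proof (intro conjI allI impI ballI)
  fix j assume j: "j \<in> J"
  note X = X_regular[OF j]
  show "C21 (len j) T (heat_flow (X j)) (heat_flow_y (X j)) (heat_flow_yy (X j)) (heat_flow_yy (X j))"
    unfolding C21_def
  proof (intro conjI ballI)
    show "continuous_on ({0..len j} \<times> {0..T}) (\<lambda>(y, t). heat_flow (X j) y t)"
      by (rule continuous_on_subset[OF heat_flow_continuous(1)[OF X]]) auto
    show "continuous_on ({0..len j} \<times> {0<..<T}) (\<lambda>(y, t). heat_flow_y (X j) y t)"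
      by (rule continuous_on_subset[OF heat_flow_continuous(2)[OF X]]) auto
    show "continuous_on ({0..len j} \<times> {0<..<T}) (\<lambda>(y, t). heat_flow_yy (X j) y t)"
      by (rule continuous_on_subset[OF heat_flow_continuous(3)[OF X]]) auto
    then show "continuous_on ({0..len j} \<times> {0<..<T}) (\<lambda>(y, t). heat_flow_yy (X j) y t)" .
    fix y t :: real assume "t \<in> {0<..<T}"
    then have t: "t > 0" by simp
    note d = heat_flow_derivs[OF X t]
    show "((\<lambda>y. heat_flow (X j) y t) has_real_derivative heat_flow_y (X j) y t) (at y within {0..len j})"
      by (rule has_field_derivative_at_within[OF d(1)])
    show "((\<lambda>y. heat_flow_y (X j) y t) has_real_derivative heat_flow_yy (X j) y t) (at y within {0..len j})"
      by (rule has_field_derivative_at_within[OF d(2)])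
    show "((\<lambda>t. heat_flow (X j) y t) has_real_derivative heat_flow_yy (X j) y t) (at t)"
      by (rule d(3))
  qed
next
  fix v e e' t assume "e \<in> ends_at v" "e' \<in> ends_at v"
  then show "heat_flow (X (fst e)) (end_pos e) t = heat_flow (X (fst e')) (end_pos e') t"
    using end_value[of e v t] end_value[of e' v t] end_value_bdry[of e t] end_value_bdry[of e' t]
    by (cases "v = v0") auto
next
  fix v t assume "v \<noteq> v0" "t \<in> {0<..<T}"
  then show "(\<Sum>e\<in>ends_at v. end_sign e * heat_flow_y (X (fst e)) (end_pos e) t) = 0"
    by (intro kirchhoff) auto
qed

end

lemma heat_sol_exists:
  assumes "compatible B f0" "continuous_on UNIV B" "exp_growth B" "\<And>z. B (- z) = B z"
  obtains X where "\<And>j. j \<in> J \<Longrightarrow> continuous_on UNIV (X j)" "\<And>j. j \<in> J \<Longrightarrow> exp_growth (X j)"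
    "\<And>T. heat_sol T (\<lambda>j. heat_flow (X j)) (\<lambda>j. heat_flow_y (X j)) (\<lambda>j. heat_flow_yy (X j))"
    "\<And>j y. j \<in> J \<Longrightarrow> y \<in> {0..len j} \<Longrightarrow> heat_flow (X j) y 0 = f0 j y"
    "\<And>e t. e \<in> ends_at v0 \<Longrightarrow> heat_flow (X (fst e)) (end_pos e) t = heat_flow B 0 t"
  by (rule that[of "extension B f0"])
    (use X_regular[OF assms] heat_sol_extension[OF assms] end_value_bdry[OF assms] extension_on_edge
      in \<open>auto simp: heat_flow_initial\<close>)

end

section \<open>Solutions with time-dependent boundary data\<close>

lemma integral_stretch01:
  fixes f :: "real \<Rightarrow> real"
  assumes "a \<le> r" and f: "continuous_on {a..r} f"
  shows "integral {a..r} f = (r - a) * integral {0..1} (\<lambda>u. f (a + (r - a) * u))"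
proof (cases "a = r")
  case False
  then have ar: "a < r" using assms by simp
  have "(f has_integral integral {a..r} f) {a..r}"
    using f by (intro integrable_integral integrable_continuous_real)
  from has_integral_affinity[of f _ a r, unfolded cbox_interval, OF this, of "r - a" a]
  have "((\<lambda>x. f ((r - a) * x + a)) has_integral (1 / (r - a)) * integral {a..r} f)
      ((\<lambda>x. (1 / (r - a)) * x + - ((1 / (r - a)) * a)) ` {a..r})"
    using ar by simp
  moreover have "(\<lambda>x. (1 / (r - a)) * x + - ((1 / (r - a)) * a)) ` {a..r} = {0..1}"
    using ar image_affinity_atLeastAtMost[of "1 / (r - a)" "- ((1 / (r - a)) * a)" a r]
    by (simp add: diff_divide_distrib[symmetric])
  ultimately have "integral {0..1} (\<lambda>u. f (a + (r - a) * u)) = (1 / (r - a)) * integral {a..r} f"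
    by (simp add: add.commute integral_unique)
  then show ?thesis using ar by simp
qed simp

text \<open>
  Rescaling to the unit interval moves the variable end point into the integrand.
\<close>

lemma continuous_on_integral_upper:
  fixes f :: "'a::topological_space \<Rightarrow> real \<Rightarrow> real"
  assumes f: "continuous_on (A \<times> {a..b}) (\<lambda>(x, s). f x s)"
  shows "continuous_on (A \<times> {a..b}) (\<lambda>(x, r). integral {a..r} (f x))"
proof -
  have fx: "continuous_on {a..r} (f x)" if "x \<in> A" "r \<in> {a..b}" for x r
    by (rule continuous_on_compose2[OF f, of _ "\<lambda>s. (x, s)", simplified]) (use that in \<open>auto intro!: continuous_intros\<close>)
  have "continuous_on (A \<times> {a..b}) (\<lambda>p. integral (cbox 0 1) (\<lambda>u::real. f (fst p) (a + (snd p - a) * u)))"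
  proof (rule integral_continuous_on_param)
    have "continuous_on ((A \<times> {a..b}) \<times> {0..1}) (\<lambda>q. (\<lambda>(x, s). f x s) (fst (fst q), a + (snd (fst q) - a) * snd q))"
    proof (rule continuous_on_compose2[OF f])
      show "(\<lambda>q. (fst (fst q), a + (snd (fst q) - a) * snd q)) ` ((A \<times> {a..b}) \<times> {0..1}) \<subseteq> A \<times> {a..b}"
      proof -
        have "0 \<le> (s - a) * u \<and> a + (s - a) * u \<le> b" if "a \<le> s" "s \<le> b" "0 \<le> u" "u \<le> 1" for s u :: real

          using mult_left_le[of u "s - a"] that by auto
        then show ?thesis by auto
      qed
    qed (intro continuous_intros)
    then show "continuous_on ((A \<times> {a..b}) \<times> cbox 0 1) (\<lambda>(p, u). f (fst p) (a + (snd p - a) * u))"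
      by (simp add: case_prod_beta)
  qed
  then have "continuous_on (A \<times> {a..b}) (\<lambda>p. (snd p - a) * integral (cbox 0 1) (\<lambda>u::real. f (fst p) (a + (snd p - a) * u)))"
    by (intro continuous_intros)
  then show ?thesis
    by (rule continuous_on_eq) (auto simp: integral_stretch01[OF _ fx])
qed

lemma green_identity:
  fixes f f' f'' :: "real \<Rightarrow> real"
  assumes L: "L > 0" and y: "y \<in> {0..L}"
    and f: "\<And>z. z \<in> {0..L} \<Longrightarrow> (f has_real_derivative f' z) (at z within {0..L})"
    and f': "\<And>z. z \<in> {0..L} \<Longrightarrow> (f' has_real_derivative f'' z) (at z within {0..L})"
  shows "((\<lambda>z. f'' z) has_integral (f' y - f' 0)) {0..y}"
    and "((\<lambda>z. (y - z) * f'' z) has_integral (f y - f 0 - y * f' 0)) {0..y}"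
proof -
  have "(f' has_vector_derivative f'' z) (at z within {0..y})" if "z \<in> {0..y}" for z
    using f'[of z] y that
    by (auto simp: has_real_derivative_iff_has_vector_derivative[symmetric] intro: has_field_derivative_subset)
  from fundamental_theorem_of_calculus[OF _ this] y
  show "((\<lambda>z. f'' z) has_integral (f' y - f' 0)) {0..y}" by auto
  have "((\<lambda>z. (y - z) * f' z + f z) has_vector_derivative (y - z) * f'' z) (at z within {0..y})" if "z \<in> {0..y}" for z
  proof -
    have 1: "(f' has_real_derivative f'' z) (at z within {0..y})" "(f has_real_derivative f' z) (at z within {0..y})"
      using f'[of z] f[of z] y that by (auto intro: has_field_derivative_subset)
    show ?thesis unfolding has_real_derivative_iff_has_vector_derivative[symmetric]
      by (rule derivative_eq_intros 1 refl)+ (simp add: algebra_simps)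
  qed
  from fundamental_theorem_of_calculus[OF _ this] y
  show "((\<lambda>z. (y - z) * f'' z) has_integral (f y - f 0 - y * f' 0)) {0..y}" by (auto simp: algebra_simps)
qed

lemma deriv_double_integral:
  fixes h :: "real \<Rightarrow> real"
  assumes h: "continuous_on {0..L} h" and y: "y \<in> {0..L}"
  shows "((\<lambda>y. integral {0..y} (\<lambda>z. (y - z) * h z)) has_real_derivative integral {0..y} h) (at y within {0..L})"
proof -
  have zh: "continuous_on {0..L} (\<lambda>z. z * h z)" by (intro continuous_intros h)
  have eq: "integral {0..x} (\<lambda>z. (x - z) * h z) = x * integral {0..x} h - integral {0..x} (\<lambda>z. z * h z)" if "x \<in> {0..L}" for x
  proof -
    have "h integrable_on {0..x}" "(\<lambda>z. z * h z) integrable_on {0..x}"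
      using that by (auto intro!: integrable_continuous_real continuous_on_subset[OF h] continuous_on_subset[OF zh])
    then show ?thesis
      using integral_diff[of "\<lambda>z. x * h z" "{0..x}" "\<lambda>z. z * h z"] integrable_on_cmult_left[of h "{0..x}" x]
      by (simp add: left_diff_distrib)
  qed
  have "((\<lambda>x. x * integral {0..x} h - integral {0..x} (\<lambda>z. z * h z)) has_real_derivative integral {0..y} h) (at y within {0..L})"
    by (rule derivative_eq_intros integral_has_real_derivative[OF h y] integral_has_real_derivative[OF zh y] refl)+ simp
  then show ?thesis
    by (rule has_field_derivative_transform[OF y, rotated]) (simp add: eq)
qed

text \<open>
  The time integral of a solution with zero initial value. Differentiating such an integral twice in
  space directly would need control of \<open>wyy\<close> as time tends to zero. Instead, the Green function of the
  second derivative on the edge expresses the integral through the end values and \<open>w\<close>, and this formula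
  can be differentiated.
\<close>

locale edge_heat =
  fixes L T :: real and w wy wt :: "real \<Rightarrow> real \<Rightarrow> real"
  assumes L: "L > 0" and T: "T > 0" and w: "C21 L T w wy wt wt"
    and w0: "\<And>y. y \<in> {0..L} \<Longrightarrow> w y 0 = 0"
begin

text \<open>
  \<open>b\<close> continues \<open>w\<close> by zero to negative times and \<open>v\<close> is its time integral. Continuity is kept since \<open>w\<close>
  vanishes initially, and convolutions in time can run over a fixed interval.
\<close>

definition "b y s = w y (max 0 s)"
definition "v y r = integral {-T..r} (b y)"

text \<open>
  The space derivative of \<open>v\<close>, in the form that results from the Green formula for \<open>v\<close> below.
\<close>

definition "vy y r = (v L r - v 0 r) / L + integral {0..y} (\<lambda>z. b z r) - integral {0..L} (\<lambda>z. (L - z) * b z r) / L"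

lemma b_cont: "continuous_on ({0..L} \<times> {-T..T}) (\<lambda>(y, s). b y s)"
  unfolding b_def case_prod_beta
  by (rule continuous_on_compose2[OF C21D(1)[OF w], of _ "\<lambda>p. (fst p, max 0 (snd p))", simplified])
    (use T in \<open>auto intro!: continuous_intros\<close>)

lemma b_cont_time: "y \<in> {0..L} \<Longrightarrow> continuous_on {-T..T} (b y)"
  by (rule continuous_on_compose2[OF b_cont, of _ "\<lambda>s. (y, s)", simplified]) (auto intro!: continuous_intros)

lemma b_cont_space: "r \<in> {-T..T} \<Longrightarrow> continuous_on {0..L} (\<lambda>z. b z r)"
  by (rule continuous_on_compose2[OF b_cont, of _ "\<lambda>z. (z, r)", simplified]) (auto intro!: continuous_intros)

lemma v_cont: "continuous_on ({0..L} \<times> {-T..T}) (\<lambda>(y, r). v y r)"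
  unfolding v_def by (rule continuous_on_integral_upper[OF b_cont])

lemma v_cont_time: "y \<in> {0..L} \<Longrightarrow> continuous_on {-T..T} (v y)"
  by (rule continuous_on_compose2[OF v_cont, of _ "\<lambda>s. (y, s)", simplified]) (auto intro!: continuous_intros)

lemma v_deriv_time:
  assumes "y \<in> {0..L}" "r \<in> {-T<..<T}" shows "((\<lambda>r. v y r) has_real_derivative b y r) (at r)"
proof -
  have "((\<lambda>r. v y r) has_real_derivative b y r) (at r within {-T..T})"
    unfolding v_def by (rule integral_has_real_derivative[OF b_cont_time]) (use assms in auto)
  moreover have "at r within {-T..T} = at r" using assms by (intro at_within_interior) auto
  ultimately show ?thesis by simp
qed

lemma nonpos_time:
  assumes "r \<le> 0" "y \<in> {0..L}"
  shows "b y r = 0" "v y r = 0" "vy y r = 0"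
proof -
  have b: "b z s = 0" if "s \<le> 0" "z \<in> {0..L}" for z s using that w0 by (simp add: b_def max_def)
  show "b y r = 0" by (rule b[OF assms])
  have v: "v z r = 0" if "z \<in> {0..L}" for z
    unfolding v_def using integral_cong[of "{-T..r}" "b z" "\<lambda>s. 0"] b[OF _ that] assms(1) by auto
  show "v y r = 0" by (rule v[OF assms(2)])
  have "integral {0..y} (\<lambda>z. b z r) = 0"
    using integral_cong[of "{0..y}" "\<lambda>z. b z r" "\<lambda>z. 0"] b[OF assms(1)] assms(2) by auto
  moreover have "integral {0..L} (\<lambda>z. (L - z) * b z r) = 0"
    using integral_cong[of "{0..L}" "\<lambda>z. (L - z) * b z r" "\<lambda>z. 0"] b[OF assms(1)] by auto
  ultimately show "vy y r = 0" using v L by (simp add: vy_def)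
qed

lemma moment_deriv:
  assumes y: "y \<in> {0..L}" and r: "r \<in> {0<..<T}" and p: "continuous_on UNIV p"
  shows "((\<lambda>r. integral {0..y} (\<lambda>z. p z * b z r)) has_real_derivative integral {0..y} (\<lambda>z. p z * wt z r)) (at r)"
proof -
  define a c where "a = r / 2" and "c = (r + T) / 2"
  have ac: "0 < a" "a < r" "r < c" "c < T" using r by (auto simp: a_def c_def)
  have "((\<lambda>r. integral (cbox 0 y) (\<lambda>z. p z * b z r)) has_real_derivative integral (cbox 0 y) (\<lambda>z. p z * wt z r)) (at r within {a..c})"
  proof (rule leibniz_rule_field_derivative)
    fix s z assume s: "s \<in> {a..c}" and z: "z \<in> cbox 0 y"
    have "((\<lambda>s. w z s) has_real_derivative wt z s) (at s)"
      using s z ac y by (intro C21D(4)[OF w]) auto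
    then have "((\<lambda>s. b z s) has_real_derivative wt z s) (at s within {a..c})"
    proof (rule has_field_derivative_transform[OF s, rotated, OF has_field_derivative_at_within])
      show "w z x = b z x" if "x \<in> {a..c}" for x using that ac by (simp add: b_def)
    qed
    then show "((\<lambda>s. p z * b z s) has_real_derivative p z * wt z s) (at s within {a..c})"
      by (rule DERIV_cmult)
  next
    fix s assume "s \<in> {a..c}"
    then show "(\<lambda>z. p z * b z s) integrable_on cbox 0 y"
      using ac y by (intro integrable_continuous continuous_intros continuous_on_subset[OF b_cont_space] continuous_on_subset[OF p]) auto
  next
    have "continuous_on ({a..c} \<times> cbox 0 y) (\<lambda>q. (\<lambda>(y, t). wt y t) (snd q, fst q))"
      by (rule continuous_on_compose2[OF C21D(7)[OF w]]) (use ac y in \<open>auto intro!: continuous_intros\<close>)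
    then show "continuous_on ({a..c} \<times> cbox 0 y) (\<lambda>(s, z). p z * wt z s)"
      unfolding case_prod_beta by (intro continuous_intros continuous_on_compose2[OF p]) auto
  qed (use ac in auto)
  moreover have "at r within {a..c} = at r" using ac by (intro at_within_interior) auto
  ultimately show ?thesis by simp
qed

lemma vy_deriv_time:
  assumes y: "y \<in> {0..L}" and r: "r \<in> {0<..<T}"
  shows "((\<lambda>r. vy y r) has_real_derivative wy y r) (at r)"
proof -
  have r': "r \<in> {-T<..<T}" and L': "L \<in> {0..L}" and z': "0 \<in> {0..L}" using r L by auto
  have b: "b z r = w z r" for z using r by (simp add: b_def)
  note d = C21D(2,3)[OF w _ r]
  have 1: "integral {0..y} (\<lambda>z. 1 * wt z r) = wy y r - wy 0 r"
    using green_identity(1)[OF L y d] by (simp add: integral_unique)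
  have 2: "integral {0..L} (\<lambda>z. (L - z) * wt z r) = w L r - w 0 r - L * wy 0 r"
    using green_identity(2)[OF L L' d] by (simp add: integral_unique)
  have p: "continuous_on UNIV (\<lambda>z. L - z)" "continuous_on UNIV (\<lambda>z::real. 1::real)" by (auto intro: continuous_intros)
  have "((\<lambda>r. (v L r - v 0 r) / L + integral {0..y} (\<lambda>z. 1 * b z r) - integral {0..L} (\<lambda>z. (L - z) * b z r) / L)
     has_real_derivative (w L r - w 0 r) / L + (wy y r - wy 0 r) - (w L r - w 0 r - L * wy 0 r) / L) (at r)"
    using v_deriv_time[OF L' r', unfolded b] v_deriv_time[OF z' r', unfolded b]
      moment_deriv[OF y r p(2), unfolded 1] moment_deriv[OF L' r p(1), unfolded 2]
    by (intro DERIV_diff DERIV_add DERIV_cdivide)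
  moreover have "(w L r - w 0 r) / L + (wy y r - wy 0 r) - (w L r - w 0 r - L * wy 0 r) / L = wy y r"
    using L by (simp add: field_simps)
  ultimately show ?thesis unfolding vy_def by simp
qed

lemma moment_cont:
  assumes y: "y \<in> {0..L}" and p: "continuous_on UNIV p"
  shows "continuous_on {-T..T} (\<lambda>r. integral {0..y} (\<lambda>z. p z * b z r))"
proof -
  have "continuous_on ({-T..T} \<times> cbox 0 y) (\<lambda>q. (\<lambda>(y, t). b y t) (snd q, fst q))"
    by (rule continuous_on_compose2[OF b_cont]) (use y in \<open>auto intro!: continuous_intros\<close>)
  then have "continuous_on ({-T..T} \<times> cbox 0 y) (\<lambda>(s, z). p z * b z s)"
    unfolding case_prod_beta by (intro continuous_intros continuous_on_compose2[OF p]) auto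
  from integral_continuous_on_param[OF this] show ?thesis by simp
qed

lemma vy_cont: "continuous_on ({0..L} \<times> {-T..T}) (\<lambda>(y, r). vy y r)"
proof -
  have "continuous_on ({-T..T} \<times> {0..L}) (\<lambda>q. (\<lambda>(y, t). b y t) (snd q, fst q))"
    by (rule continuous_on_compose2[OF b_cont]) (auto intro!: continuous_intros)
  then have 1: "continuous_on ({-T..T} \<times> {0..L}) (\<lambda>(r, y). integral {0..y} (\<lambda>z. b z r))"
    by (intro continuous_on_integral_upper) (simp add: case_prod_beta)
  have 2: "continuous_on ({0..L} \<times> {-T..T}) (\<lambda>q. (\<lambda>(r, y). integral {0..y} (\<lambda>z. b z r)) (snd q, fst q))"
    by (rule continuous_on_compose2[OF 1]) (auto intro!: continuous_intros)
  have 3: "continuous_on ({0..L} \<times> {-T..T}) (\<lambda>q. v y (snd q))" if "y \<in> {0..L}" for y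
    by (rule continuous_on_compose2[OF v_cont_time[OF that]]) (auto intro!: continuous_intros)
  have "continuous_on UNIV (\<lambda>z. L - z)" by (intro continuous_intros)
  then have 4: "continuous_on ({0..L} \<times> {-T..T}) (\<lambda>q. integral {0..L} (\<lambda>z. (L - z) * b z (snd q)))"
    by (intro continuous_on_compose2[OF moment_cont[of L "\<lambda>z. L - z"]]) (use L in \<open>auto intro!: continuous_intros\<close>)
  show ?thesis
    unfolding vy_def case_prod_beta using 2 3[of 0] 3[of L] 4 L
    by (intro continuous_on_add continuous_on_diff continuous_on_divide continuous_on_const) (auto simp: case_prod_beta)
qed

text \<open>
  Both sides vanish for nonpositive times. For positive times their difference has derivative zero, by
  the Green identity for \<open>w\<close> and \<open>wyy = wt\<close>.
\<close>

lemma v_green: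
  assumes y: "y \<in> {0..L}" and r: "r \<in> {-T..T}"
  shows "v y r = v 0 r + y * (v L r - v 0 r) / L + integral {0..y} (\<lambda>z. (y - z) * b z r)
    - y / L * integral {0..L} (\<lambda>z. (L - z) * b z r)"
proof -
  have L': "L \<in> {0..L}" and z': "0 \<in> {0..L}" using L by auto
  have p: "continuous_on UNIV (\<lambda>z. L - z)" "continuous_on UNIV (\<lambda>z. y - z)" by (auto intro: continuous_intros)
  let ?D = "\<lambda>r. v y r - (v 0 r + y * (v L r - v 0 r) / L + integral {0..y} (\<lambda>z. (y - z) * b z r)
    - y / L * integral {0..L} (\<lambda>z. (L - z) * b z r))"
  have nonpos: "?D r = 0" if "r \<le> 0" for r
  proof -
    have "integral {0..x} (\<lambda>z. (x - z) * b z r) = 0" if "x \<in> {0..L}" for x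
      using integral_cong[of "{0..x}" "\<lambda>z. (x - z) * b z r" "\<lambda>z. 0"] nonpos_time(1)[OF \<open>r \<le> 0\<close>] that by auto
    from this[OF y] this[OF L'] show ?thesis using nonpos_time(2)[OF that] y L' z' by simp
  qed
  have "?D r = 0"
  proof (cases "r \<le> 0")
    case False
    have "?D r = ?D 0"
    proof (rule DERIV_isconst2[of 0 T ?D])
      show "continuous_on {0..T} ?D"
        by (intro continuous_intros continuous_on_subset[OF v_cont_time] continuous_on_subset[OF moment_cont] p y L' z')
          (use T L in auto)
      fix s assume "0 < s" "s < T"
      then have s: "s \<in> {0<..<T}" and s': "s \<in> {-T<..<T}" by auto
      have b: "b z s = w z s" for z using s by (simp add: b_def)
      note d = C21D(2,3)[OF w _ s]
      have 1: "integral {0..y} (\<lambda>z. (y - z) * wt z s) = w y s - w 0 s - y * wy 0 s"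
        using green_identity(2)[OF L y d] by (simp add: integral_unique)
      have 2: "integral {0..L} (\<lambda>z. (L - z) * wt z s) = w L s - w 0 s - L * wy 0 s"
        using green_identity(2)[OF L L' d] by (simp add: integral_unique)
      have "(?D has_real_derivative w y s - (w 0 s + y * (w L s - w 0 s) / L + (w y s - w 0 s - y * wy 0 s)
          - y / L * (w L s - w 0 s - L * wy 0 s))) (at s)"
        using v_deriv_time[OF y s', unfolded b] v_deriv_time[OF L' s', unfolded b] v_deriv_time[OF z' s', unfolded b]
          moment_deriv[OF y s p(2), unfolded 1] moment_deriv[OF L' s p(1), unfolded 2]
        by (intro DERIV_diff DERIV_add DERIV_cdivide DERIV_cmult)
      moreover have "w y s - (w 0 s + y * (w L s - w 0 s) / L + (w y s - w 0 s - y * wy 0 s)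
          - y / L * (w L s - w 0 s - L * wy 0 s)) = 0"
        using L by (simp add: field_simps)
      ultimately show "(?D has_real_derivative 0) (at s)" by simp
    qed (use T r False in auto)
    then show ?thesis using nonpos[of 0] by simp
  qed (rule nonpos)
  then show ?thesis by simp
qed

lemma v_deriv_space:
  assumes y: "y \<in> {0..L}" and r: "r \<in> {-T..T}"
  shows "((\<lambda>y. v y r) has_real_derivative vy y r) (at y within {0..L})"
    and "((\<lambda>y. vy y r) has_real_derivative b y r) (at y within {0..L})"
proof -
  have "((\<lambda>y. v 0 r + y * (v L r - v 0 r) / L + integral {0..y} (\<lambda>z. (y - z) * b z r)
    - y / L * integral {0..L} (\<lambda>z. (L - z) * b z r)) has_real_derivative vy y r) (at y within {0..L})"
    unfolding vy_def using L
    by (auto intro!: derivative_eq_intros deriv_double_integral[OF b_cont_space[OF r] y])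
  then show "((\<lambda>y. v y r) has_real_derivative vy y r) (at y within {0..L})"
    by (rule has_field_derivative_transform[OF y, rotated]) (rule v_green[OF _ r, symmetric])
  show "((\<lambda>y. vy y r) has_real_derivative b y r) (at y within {0..L})"
    unfolding vy_def
    by (rule derivative_eq_intros integral_has_real_derivative[OF b_cont_space[OF r] y] refl)+ simp
qed

lemma C21_v: "C21 L T v vy w w"
proof -
  have b: "b z r = w z r" if "r \<in> {0..T}" for z r using that by (simp add: b_def)
  note w_cont = continuous_on_subset[OF C21D(1)[OF w], of "{0..L} \<times> {0<..<T}"]
  have "C21 L T v vy b w"
    unfolding C21_def
  proof (intro conjI ballI)
    fix y t assume yt: "y \<in> {0..L}" "t \<in> {0<..<T}"
    show "((\<lambda>y. v y t) has_real_derivative vy y t) (at y within {0..L})"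
      "((\<lambda>y. vy y t) has_real_derivative b y t) (at y within {0..L})"
      "(v y has_real_derivative w y t) (at t)"
      using v_deriv_space[of y t] v_deriv_time[of y t] yt b[of t y] by auto
  qed (use T b in \<open>auto intro!: continuous_on_subset[OF v_cont] continuous_on_subset[OF vy_cont] continuous_on_subset[OF b_cont] w_cont\<close>)
  then show ?thesis
    unfolding C21_def using b w_cont by auto
qed

definition conv :: "(real \<Rightarrow> real) \<Rightarrow> (real \<Rightarrow> real \<Rightarrow> real) \<Rightarrow> real \<Rightarrow> real \<Rightarrow> real" where
  "conv g k y t = integral {0..T} (\<lambda>s. g s * k y (t - s))"

lemma conv_param_cont:
  fixes g :: "real \<Rightarrow> real" and k :: "real \<Rightarrow> real \<Rightarrow> real"
  assumes g: "continuous_on {0..T} g" and k: "continuous_on ({0..L} \<times> {-T..T}) (\<lambda>(y, r). k y r)"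
  shows "continuous_on (({0..L} \<times> {0..T}) \<times> cbox 0 T) (\<lambda>(p, s). g s * k (fst p) (snd p - s))"
  unfolding case_prod_beta
proof (rule continuous_on_mult)
  show "continuous_on (({0..L} \<times> {0..T}) \<times> cbox 0 T) (\<lambda>q. g (snd q))"
    by (rule continuous_on_compose2[OF g]) (auto intro!: continuous_intros)
  have "continuous_on (({0..L} \<times> {0..T}) \<times> cbox 0 T) (\<lambda>q. (\<lambda>(y, r). k y r) (fst (fst q), snd (fst q) - snd q))"
    by (rule continuous_on_compose2[OF k]) (auto intro!: continuous_intros)
  then show "continuous_on (({0..L} \<times> {0..T}) \<times> cbox 0 T) (\<lambda>q. k (fst (fst q)) (snd (fst q) - snd q))" by simp
qed

lemma conv_cont:
  fixes g :: "real \<Rightarrow> real" and k :: "real \<Rightarrow> real \<Rightarrow> real"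
  assumes g: "continuous_on {0..T} g" and k: "continuous_on ({0..L} \<times> {-T..T}) (\<lambda>(y, r). k y r)"
  shows "continuous_on ({0..L} \<times> {0..T}) (\<lambda>(y, t). conv g k y t)"
  using integral_continuous_on_param[OF conv_param_cont[OF g k]] by (simp add: conv_def case_prod_beta)

lemma conv_integrable:
  fixes g :: "real \<Rightarrow> real" and k :: "real \<Rightarrow> real \<Rightarrow> real"
  assumes g: "continuous_on {0..T} g" and k: "continuous_on ({0..L} \<times> {-T..T}) (\<lambda>(y, r). k y r)"
    and "y \<in> {0..L}" "t \<in> {0..T}"
  shows "(\<lambda>s. g s * k y (t - s)) integrable_on cbox 0 T"
proof -
  have "continuous_on (cbox 0 T) (\<lambda>s. (\<lambda>(p, s). g s * k (fst p) (snd p - s)) ((y, t), s))"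
    by (rule continuous_on_compose2[OF conv_param_cont[OF g k]]) (use assms in \<open>auto intro!: continuous_intros\<close>)
  then show ?thesis by (intro integrable_continuous) (simp add: case_prod_beta)
qed

lemma conv_deriv_space:
  fixes g :: "real \<Rightarrow> real" and k :: "real \<Rightarrow> real \<Rightarrow> real"
  assumes g: "continuous_on {0..T} g" and k: "continuous_on ({0..L} \<times> {-T..T}) (\<lambda>(y, r). k y r)"
    and k': "continuous_on ({0..L} \<times> {-T..T}) (\<lambda>(y, r). k' y r)"
    and d: "\<And>y r. y \<in> {0..L} \<Longrightarrow> r \<in> {-T..T} \<Longrightarrow> ((\<lambda>y. k y r) has_real_derivative k' y r) (at y within {0..L})"
    and y: "y \<in> {0..L}" and t: "t \<in> {0..T}"
  shows "((\<lambda>y. conv g k y t) has_real_derivative conv g k' y t) (at y within {0..L})"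
proof -
  have "((\<lambda>y. integral (cbox 0 T) (\<lambda>s. g s * k y (t - s))) has_real_derivative integral (cbox 0 T) (\<lambda>s. g s * k' y (t - s))) (at y within {0..L})"
  proof (rule leibniz_rule_field_derivative)
    fix x s assume "x \<in> {0..L}" "s \<in> cbox 0 T"
    then show "((\<lambda>x. g s * k x (t - s)) has_real_derivative g s * k' x (t - s)) (at x within {0..L})"
      using t by (intro DERIV_cmult d) auto
  next
    show "(\<lambda>s. g s * k x (t - s)) integrable_on cbox 0 T" if "x \<in> {0..L}" for x
      by (rule conv_integrable[OF g k that t])
    have "continuous_on ({0..L} \<times> cbox 0 T) (\<lambda>q. (\<lambda>(p, s). g s * k' (fst p) (snd p - s)) ((fst q, t), snd q))"
      by (rule continuous_on_compose2[OF conv_param_cont[OF g k']]) (use t in \<open>auto intro!: continuous_intros\<close>)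
    then show "continuous_on ({0..L} \<times> cbox 0 T) (\<lambda>(x, s). g s * k' x (t - s))"
      by (simp add: case_prod_beta)
  qed (use y in auto)
  then show ?thesis by (simp add: conv_def)
qed

lemma conv_deriv_time:
  assumes g: "continuous_on {0..T} g" and y: "y \<in> {0..L}" and t: "t \<in> {0<..<T}"
  shows "((\<lambda>t. conv g v y t) has_real_derivative conv g b y t) (at t)"
proof -
  define a c where "a = t / 2" and "c = (t + T) / 2"
  have ac: "0 < a" "a < t" "t < c" "c < T" using t by (auto simp: a_def c_def)
  have "((\<lambda>t. integral (cbox 0 T) (\<lambda>s. g s * v y (t - s))) has_real_derivative integral (cbox 0 T) (\<lambda>s. g s * b y (t - s))) (at t within {a..c})"
  proof (rule leibniz_rule_field_derivative)
    fix x s assume x: "x \<in> {a..c}" "s \<in> cbox 0 T"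
    then have "x - s \<in> {-T<..<T}" using ac by auto
    have "((\<lambda>x. v y (x - s)) has_real_derivative b y (x - s) * 1) (at x within {a..c})"
      by (rule DERIV_chain2[of "v y"], rule v_deriv_time[OF y \<open>x - s \<in> {-T<..<T}\<close>]) (auto intro!: derivative_eq_intros)
    then have "((\<lambda>x. v y (x - s)) has_real_derivative b y (x - s)) (at x within {a..c})" by simp
    then show "((\<lambda>x. g s * v y (x - s)) has_real_derivative g s * b y (x - s)) (at x within {a..c})"
      by (rule DERIV_cmult)
  next
    show "(\<lambda>s. g s * v y (x - s)) integrable_on cbox 0 T" if "x \<in> {a..c}" for x
      by (rule conv_integrable[OF g v_cont y]) (use that ac in auto)
    have "continuous_on ({a..c} \<times> cbox 0 T) (\<lambda>q. (\<lambda>(p, s). g s * b (fst p) (snd p - s)) ((y, fst q), snd q))"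
      by (rule continuous_on_compose2[OF conv_param_cont[OF g b_cont]]) (use ac y in \<open>auto intro!: continuous_intros\<close>)
    then show "continuous_on ({a..c} \<times> cbox 0 T) (\<lambda>(x, s). g s * b y (x - s))"
      by (simp add: case_prod_beta)
  qed (use ac in auto)
  moreover have "at t within {a..c} = at t" using ac by (intro at_within_interior) auto
  ultimately show ?thesis by (simp add: conv_def)
qed

lemma C21_conv:
  assumes g: "continuous_on {0..T} g"
  shows "C21 L T (conv g v) (conv g vy) (conv g b) (conv g b)"
  unfolding C21_def
proof (intro conjI ballI)
  fix y t assume yt: "y \<in> {0..L}" "t \<in> {0<..<T}"
  then have t': "t \<in> {0..T}" by auto
  show "((\<lambda>y. conv g v y t) has_real_derivative conv g vy y t) (at y within {0..L})"
    by (rule conv_deriv_space[OF g v_cont vy_cont v_deriv_space(1) yt(1) t'])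
  show "((\<lambda>y. conv g vy y t) has_real_derivative conv g b y t) (at y within {0..L})"
    by (rule conv_deriv_space[OF g vy_cont b_cont v_deriv_space(2) yt(1) t'])
  show "(conv g v y has_real_derivative conv g b y t) (at t)"
    by (rule conv_deriv_time[OF g yt])
qed (auto intro!: conv_cont[OF g v_cont] continuous_on_subset[OF conv_cont[OF g vy_cont]]
      continuous_on_subset[OF conv_cont[OF g b_cont]])

end

text \<open>
  Taylor's formula of second order with integral remainder; the integrand is the derivative of the
  Taylor polynomial as a function of its centre.
\<close>

lemma taylor_integral:
  fixes g :: "real \<Rightarrow> real"
  assumes "t \<ge> 0" and g: "\<And>s. (g has_real_derivative g1 s) (at s)" "\<And>s. (g1 has_real_derivative g2 s) (at s)"
    "\<And>s. (g2 has_real_derivative g3 s) (at s)"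
  shows "((\<lambda>s. g3 s * ((t - s)\<^sup>2 / 2)) has_integral (g t - g 0 - g1 0 * t - g2 0 * (t\<^sup>2 / 2))) {0..t}"
proof -
  let ?G = "\<lambda>s. g2 s * ((t - s)\<^sup>2 / 2) + g1 s * (t - s) + g s"
  have "(?G has_vector_derivative g3 s * ((t - s)\<^sup>2 / 2)) (at s within {0..t})" for s
  proof -
    have "(?G has_real_derivative g3 s * ((t - s)\<^sup>2 / 2)) (at s)"
    proof (rule DERIV_cong[OF DERIV_add[OF DERIV_add[OF DERIV_mult[OF g(3)] DERIV_mult[OF g(2)]] g(1)]])
      show "((\<lambda>s. (t - s)\<^sup>2 / 2) has_real_derivative - (t - s)) (at s)"
        and "((\<lambda>s. t - s) has_real_derivative -1) (at s)" by (auto intro!: derivative_eq_intros)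
    qed (simp add: algebra_simps)
    then show ?thesis
      by (simp add: has_real_derivative_iff_has_vector_derivative has_vector_derivative_at_within)
  qed
  from fundamental_theorem_of_calculus[OF assms(1) this]
  show ?thesis by (simp add: algebra_simps)
qed

context metric_graph
begin

lemma heat_sol_const: "heat_sol T (\<lambda>j y t. c) (\<lambda>j y t. 0) (\<lambda>j y t. 0)"
  by (auto simp: heat_sol_def C21_def)

text \<open>
  Let \<open>R\<close> be the solution with zero initial value and boundary value \<open>t\<close>, and \<open>V\<close> its time integral, with
  boundary value \<open>t\<^sup>2 / 2\<close>. By Taylor's formula, \<open>g(0) + g'(0) R + g''(0) V\<close> plus the convolution in time of the
  third derivative of \<open>g\<close> with \<open>V\<close> has boundary value \<open>g\<close>. The convolution kernel is \<open>V\<close> rather than \<open>R\<close> since \<open>V\<close> has two space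
  derivatives that are continuous up to the initial time.
\<close>

lemma heat_sol_with_boundary_data:
  assumes T: "T > 0" and g: "\<And>s. (g has_real_derivative g1 s) (at s)" "\<And>s. (g1 has_real_derivative g2 s) (at s)"
    "\<And>s. (g2 has_real_derivative g3 s) (at s)" and g3: "continuous_on UNIV g3"
  obtains w wy wt where "heat_sol T w wy wt"
    "\<And>j y. j \<in> J \<Longrightarrow> y \<in> {0..len j} \<Longrightarrow> w j y 0 = g 0"
    "\<And>e t. e \<in> ends_at v0 \<Longrightarrow> t \<in> {0..T} \<Longrightarrow> w (fst e) (end_pos e) t = g t"
proof -
  have "compatible (\<lambda>z. z\<^sup>2 / 2) (\<lambda>j y. 0)" by (auto simp: compatible_def)
  then obtain X where
    sol: "heat_sol T (\<lambda>j. heat_flow (X j)) (\<lambda>j. heat_flow_y (X j)) (\<lambda>j. heat_flow_yy (X j))"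
    and init: "\<And>j y. j \<in> J \<Longrightarrow> y \<in> {0..len j} \<Longrightarrow> heat_flow (X j) y 0 = 0"
    and bdry: "\<And>e t. e \<in> ends_at v0 \<Longrightarrow> heat_flow (X (fst e)) (end_pos e) t = heat_flow (\<lambda>z. z\<^sup>2 / 2) 0 t"
    by (rule heat_sol_exists) (auto intro!: continuous_intros exp_growth_weights)
  define R Ry Rt where "R j = heat_flow (X j)" and "Ry j = heat_flow_y (X j)" and "Rt j = heat_flow_yy (X j)" for j
  have sol: "heat_sol T R Ry Rt" using sol unfolding R_def Ry_def Rt_def .
  have eh: "edge_heat (len j) T (R j) (Ry j) (Rt j)" if "j \<in> J" for j
    by unfold_locales (use len_pos[OF that] T heat_solD(1)[OF sol that] init[OF that] in \<open>auto simp: R_def\<close>)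
  define b where "b j = edge_heat.b (R j)" for j
  define V where "V j = edge_heat.v T (R j)" for j
  define Vy where "Vy j = edge_heat.vy (len j) T (R j)" for j
  note defs = b_def V_def Vy_def
  note b_def' = edge_heat.b_def[OF eh, folded defs]
  note V_def' = edge_heat.v_def[OF eh, folded defs]
  note V_cont = edge_heat.v_cont[OF eh, folded defs]
  note Vy_cont = edge_heat.vy_cont[OF eh, folded defs]
  note nonpos = edge_heat.nonpos_time[OF eh, folded defs]
  have b_vertex: "b (fst e) (end_pos e) r = b (fst e') (end_pos e') r"
    if "e \<in> ends_at u" "e' \<in> ends_at u" "r \<in> {-T..T}" for u e e' r
    using heat_solD(2)[OF sol that(1,2), of "max 0 r"] that T
    by (auto simp: b_def'[OF ends_atD(1)[OF that(1)]] b_def'[OF ends_atD(1)[OF that(2)]])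
  have V_vertex: "V (fst e) (end_pos e) r = V (fst e') (end_pos e') r"
    if "e \<in> ends_at u" "e' \<in> ends_at u" "r \<in> {-T..T}" for u e e' r
    using that(3) b_vertex[OF that(1,2)]
    by (auto simp: V_def'[OF ends_atD(1)[OF that(1)]] V_def'[OF ends_atD(1)[OF that(2)]] intro!: integral_cong)
  have Vy_kirchhoff: "(\<Sum>e\<in>ends_at u. end_sign e * Vy (fst e) (end_pos e) r) = 0"
    if u: "u \<noteq> v0" and r: "r \<in> {-T..T}" for u r
  proof (cases "r \<le> 0")
    case True
    then show ?thesis using nonpos(3)[OF ends_atD(1) True end_pos_in[OF ends_atD(1)]] by (intro sum.neutral) auto
  next
    case False
    \<comment> \<open>The time derivative of \<open>Vy\<close> is \<open>Ry\<close>, which satisfies the Kirchhoff condition.\<close>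
    let ?S = "\<lambda>r. \<Sum>e\<in>ends_at u. end_sign e * Vy (fst e) (end_pos e) r"
    have "?S r = ?S 0"
    proof (rule DERIV_isconst2[of 0 T ?S])
      have "continuous_on {0..T} (Vy (fst e) (end_pos e))" if e: "e \<in> ends_at u" for e
        by (rule continuous_on_compose2[OF Vy_cont[OF ends_atD(1)[OF e]], of _ "\<lambda>s. (end_pos e, s)", simplified])
          (use end_pos_in[OF ends_atD(1)[OF e]] in \<open>auto intro!: continuous_intros\<close>)
      then show "continuous_on {0..T} ?S" by (intro continuous_intros)
      fix s assume "0 < s" "s < T"
      then have s: "s \<in> {0<..<T}" by simp
      have "(?S has_real_derivative (\<Sum>e\<in>ends_at u. end_sign e * Ry (fst e) (end_pos e) s)) (at s)"
        using edge_heat.vy_deriv_time[OF eh end_pos_in s, folded defs] ends_atD(1)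
        by (intro DERIV_sum DERIV_cmult) auto
      then show "(?S has_real_derivative 0) (at s)" using heat_solD(3)[OF sol u s] by simp
    qed (use T r False in auto)
    also have "?S 0 = 0" using nonpos(3)[OF ends_atD(1) order_refl end_pos_in[OF ends_atD(1)]] by (intro sum.neutral) auto
    finally show ?thesis .
  qed
  have solV: "heat_sol T V Vy R"
    unfolding heat_sol_def
  proof (intro conjI ballI allI impI)
    show "C21 (len j) T (V j) (Vy j) (R j) (R j)" if "j \<in> J" for j
      using edge_heat.C21_v[OF eh[OF that], folded defs] .
    show "V (fst e) (end_pos e) t = V (fst e') (end_pos e') t" if "e \<in> ends_at u" "e' \<in> ends_at u" "t \<in> {0..T}" for u e e' t
      using V_vertex[OF that(1,2), of t] that(3) T by simp
    show "(\<Sum>e\<in>ends_at u. end_sign e * Vy (fst e) (end_pos e) t) = 0" if "u \<noteq> v0" "t \<in> {0<..<T}" for u t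
      using Vy_kirchhoff[OF that(1), of t] that(2) T by simp
  qed
  have g3': "continuous_on {0..T} g3" using g3 by (rule continuous_on_subset) simp
  define cv where "cv k j = edge_heat.conv T g3 (k j)" for k :: "'j \<Rightarrow> real \<Rightarrow> real \<Rightarrow> real" and j
  have cv: "cv k j y t = integral {0..T} (\<lambda>s. g3 s * k j y (t - s))" if "j \<in> J" for k j y t
    unfolding cv_def by (rule edge_heat.conv_def[OF eh[OF that]])
  have solI: "heat_sol T (cv V) (cv Vy) (cv b)"
    unfolding heat_sol_def
  proof (intro conjI ballI allI impI)
    show "C21 (len j) T (cv V j) (cv Vy j) (cv b j) (cv b j)" if "j \<in> J" for j
      using edge_heat.C21_conv[OF eh[OF that] g3', folded defs] unfolding cv_def .
  next
    fix u e e' t assume e: "e \<in> ends_at u" "e' \<in> ends_at u" and t: "t \<in> {0..T}"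
    show "cv V (fst e) (end_pos e) t = cv V (fst e') (end_pos e') t"
      unfolding cv[OF ends_atD(1)[OF e(1)]] cv[OF ends_atD(1)[OF e(2)]]
      by (rule integral_cong) (use V_vertex[OF e] t in auto)
  next
    fix u t assume u: "u \<noteq> v0" and t: "t \<in> {0<..<T}"
    have t': "t \<in> {0..T}" using t by auto
    have int: "(\<lambda>s. g3 s * Vy (fst e) (end_pos e) (t - s)) integrable_on {0..T}" if e: "e \<in> ends_at u" for e
      using edge_heat.conv_integrable[OF eh g3' Vy_cont end_pos_in t'] ends_atD(1)[OF e] by simp
    have "(\<Sum>e\<in>ends_at u. end_sign e * cv Vy (fst e) (end_pos e) t) =
       (\<Sum>e\<in>ends_at u. integral {0..T} (\<lambda>s. end_sign e * (g3 s * Vy (fst e) (end_pos e) (t - s))))"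
      using cv ends_atD(1) by (intro sum.cong refl) simp
    also have "\<dots> = integral {0..T} (\<lambda>s. \<Sum>e\<in>ends_at u. end_sign e * (g3 s * Vy (fst e) (end_pos e) (t - s)))"
      using int by (intro integral_sum[symmetric] integrable_on_mult_right) auto
    also have "\<dots> = integral {0..T} (\<lambda>s. 0)"
    proof (rule integral_cong)
      fix s assume "s \<in> {0..T}"
      then have "t - s \<in> {-T..T}" using t by auto
      from Vy_kirchhoff[OF u this]
      show "(\<Sum>e\<in>ends_at u. end_sign e * (g3 s * Vy (fst e) (end_pos e) (t - s))) = 0"
        by (simp add: mult.left_commute[of _ "g3 s"] sum_distrib_left[symmetric])
    qed
    finally show "(\<Sum>e\<in>ends_at u. end_sign e * cv Vy (fst e) (end_pos e) t) = 0" by simp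
  qed
  \<comment> \<open>The four terms of the Taylor formula.\<close>
  note final = heat_sol_lincomb[OF heat_sol_lincomb[OF heat_sol_lincomb[OF heat_sol_const sol, of "g 0" "g1 0"] solV, of "g2 0"] solI, of 1]
  show ?thesis
  proof (rule that[OF final])
    fix j y assume j: "j \<in> J" and y: "y \<in> {0..len j}"
    have "cv V j y 0 = integral {0..T} (\<lambda>s. 0)"
      unfolding cv[OF j] by (rule integral_cong) (use nonpos(2)[OF j _ y] in auto)
    then show "g 0 + g1 0 * R j y 0 + g2 0 * V j y 0 + 1 * cv V j y 0 = g 0"
      using nonpos(2)[OF j order_refl y] init[OF j y] by (simp add: R_def)
  next
    fix e t assume e: "e \<in> ends_at v0" and t: "t \<in> {0..T}"
    let ?j = "fst e" and ?y = "end_pos e"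
    have j: "?j \<in> J" by (rule ends_atD(1)[OF e])
    have R: "R ?j ?y s = s" if "s \<ge> 0" for s
      using bdry[OF e, of s] heat_flow_square[OF that] by (simp add: R_def)
    have bb: "b ?j ?y s = max 0 s" for s using R[of "max 0 s"] by (simp add: b_def'[OF j])
    have VV: "V ?j ?y r = r\<^sup>2 / 2" if r: "r \<in> {0..T}" for r
    proof -
      have "V ?j ?y r = V ?j ?y 0 + integral {0..r} (b ?j ?y)"
        unfolding V_def'[OF j]
        by (rule Henstock_Kurzweil_Integration.integral_combine[symmetric])
          (use T r in \<open>auto intro!: integrable_continuous_real continuous_intros simp: bb[abs_def]\<close>)
      also have "integral {0..r} (b ?j ?y) = integral {0..r} (\<lambda>s. s)"
        by (rule integral_cong) (simp add: bb)
      also have "\<dots> = r\<^sup>2 / 2" using r ident_has_integral[of 0 r] by (auto simp: integral_unique)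
      finally show ?thesis using nonpos(2)[OF j order_refl end_pos_in[OF j]] by simp
    qed
    have "cv V ?j ?y t = integral {0..T} (\<lambda>s. g3 s * V ?j ?y (t - s))" by (rule cv[OF j])
    also have "\<dots> = integral {0..t} (\<lambda>s. g3 s * V ?j ?y (t - s)) + integral {t..T} (\<lambda>s. g3 s * V ?j ?y (t - s))"
      by (rule Henstock_Kurzweil_Integration.integral_combine[symmetric])
        (use t edge_heat.conv_integrable[OF eh[OF j] g3' V_cont[OF j] end_pos_in[OF j] t] in auto)
    also have "integral {t..T} (\<lambda>s. g3 s * V ?j ?y (t - s)) = integral {t..T} (\<lambda>s. 0)"
      by (rule integral_cong) (use nonpos(2)[OF j _ end_pos_in[OF j]] in auto)
    also have "integral {0..t} (\<lambda>s. g3 s * V ?j ?y (t - s)) = integral {0..t} (\<lambda>s. g3 s * ((t - s)\<^sup>2 / 2))"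
      by (rule integral_cong) (use VV t in auto)
    also have "\<dots> = g t - g 0 - g1 0 * t - g2 0 * (t\<^sup>2 / 2)"
      by (rule integral_unique[OF taylor_integral[OF _ g]]) (use t in auto)
    finally show "g 0 + g1 0 * R ?j ?y t + g2 0 * V ?j ?y t + 1 * cv V ?j ?y t = g t"
      using R[of t] VV[OF t] t by simp
  qed
qed

end

section \<open>Conservation of mass\<close>

lemma edge_mass_cont:
  assumes T: "T > 0" and p: "C21 L T p py pt pt" and w: "C21 L T w wy wt wt"
  shows "continuous_on {0..T} (\<lambda>s. integral {0..L} (\<lambda>y. p y s * w y (T - s)))"
proof -
  have "continuous_on ({0..T} \<times> cbox 0 L) (\<lambda>q. (\<lambda>(y, t). p y t) (snd q, fst q))"
    by (rule continuous_on_compose2[OF C21D(1)[OF p]]) (auto intro!: continuous_intros)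
  moreover have "continuous_on ({0..T} \<times> cbox 0 L) (\<lambda>q. (\<lambda>(y, t). w y t) (snd q, T - fst q))"
    by (rule continuous_on_compose2[OF C21D(1)[OF w]]) (auto intro!: continuous_intros)
  ultimately have "continuous_on ({0..T} \<times> cbox 0 L) (\<lambda>(s, y). p y s * w y (T - s))"
    by (auto simp: case_prod_beta intro!: continuous_intros)
  from integral_continuous_on_param[OF this] show ?thesis by simp
qed

text \<open>
  The integrand has time derivative \<open>pyy * w - p * wyy\<close>, because \<open>w\<close> runs backwards in time, and this is
  the space derivative of \<open>py * w - p * wy\<close>.
\<close>

lemma edge_mass_deriv:
  assumes L: "L > 0" and p: "C21 L T p py pt pt" and w: "C21 L T w wy wt wt" and s: "s \<in> {0<..<T}"
  shows "((\<lambda>s. integral {0..L} (\<lambda>y. p y s * w y (T - s))) has_real_derivative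
    (py L s * w L (T - s) - p L s * wy L (T - s)) - (py 0 s * w 0 (T - s) - p 0 s * wy 0 (T - s))) (at s)"
proof -
  define a c where "a = s / 2" and "c = (s + T) / 2"
  have ac: "0 < a" "a < s" "s < c" "c < T" using s by (auto simp: a_def c_def)
  have in_T: "r \<in> {0<..<T}" "T - r \<in> {0<..<T}" if "r \<in> {a..c}" for r using that ac by auto
  let ?d = "\<lambda>r y. pt y r * w y (T - r) - p y r * wt y (T - r)"
  have "((\<lambda>s. integral (cbox 0 L) (\<lambda>y. p y s * w y (T - s))) has_real_derivative integral (cbox 0 L) (?d s)) (at s within {a..c})"
  proof (rule leibniz_rule_field_derivative)
    fix r y assume r: "r \<in> {a..c}" and y: "y \<in> cbox 0 L"
    have "((\<lambda>r. w y (T - r)) has_real_derivative wt y (T - r) * (-1)) (at r)"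
      by (rule DERIV_chain2[of "w y"], rule C21D(4)[OF w]) (use in_T[OF r] y in \<open>auto intro!: derivative_eq_intros\<close>)
    moreover have "((\<lambda>r. p y r) has_real_derivative pt y r) (at r)"
      using in_T[OF r] y by (intro C21D(4)[OF p]) auto
    ultimately have "((\<lambda>r. p y r * w y (T - r)) has_real_derivative pt y r * w y (T - r) + wt y (T - r) * (-1) * p y r) (at r)"
      by (rule DERIV_mult[rotated])
    moreover have "pt y r * w y (T - r) + wt y (T - r) * (-1) * p y r = ?d r y" by simp
    ultimately show "((\<lambda>r. p y r * w y (T - r)) has_real_derivative ?d r y) (at r within {a..c})"
      by (simp only: has_field_derivative_at_within)
  next
    have c0: "continuous_on ({a..c} \<times> cbox 0 L) (\<lambda>q. (\<lambda>(y, t). p y t) (snd q, fst q))"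
      by (rule continuous_on_compose2[OF C21D(1)[OF p]]) (use ac in \<open>auto intro!: continuous_intros\<close>)
    have c1: "continuous_on ({a..c} \<times> cbox 0 L) (\<lambda>q. (\<lambda>(y, t). pt y t) (snd q, fst q))"
      by (rule continuous_on_compose2[OF C21D(7)[OF p]]) (use ac in \<open>auto intro!: continuous_intros\<close>)
    have c2: "continuous_on ({a..c} \<times> cbox 0 L) (\<lambda>q. (\<lambda>(y, t). w y t) (snd q, T - fst q))"
      by (rule continuous_on_compose2[OF C21D(1)[OF w]]) (use ac in \<open>auto intro!: continuous_intros\<close>)
    have c3: "continuous_on ({a..c} \<times> cbox 0 L) (\<lambda>q. (\<lambda>(y, t). wt y t) (snd q, T - fst q))"
      by (rule continuous_on_compose2[OF C21D(7)[OF w]]) (use ac in \<open>auto intro!: continuous_intros\<close>)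
    show "continuous_on ({a..c} \<times> cbox 0 L) (\<lambda>(r, y). ?d r y)"
      using c0 c1 c2 c3 by (auto simp: case_prod_beta intro!: continuous_intros)
    have cm: "continuous_on ({a..c} \<times> cbox 0 L) (\<lambda>q. p (snd q) (fst q) * w (snd q) (T - fst q))"
      using c0 c2 by (auto simp: case_prod_beta intro!: continuous_intros)
    show "(\<lambda>y. p y r * w y (T - r)) integrable_on cbox 0 L" if "r \<in> {a..c}" for r
      by (intro integrable_continuous continuous_on_compose2[OF cm, of _ "\<lambda>y. (r, y)", simplified])
        (use that in \<open>auto intro!: continuous_intros\<close>)
  qed (use ac in auto)
  moreover have "at s within {a..c} = at s" using ac by (intro at_within_interior) auto
  moreover have "integral (cbox 0 L) (?d s) =
    (py L s * w L (T - s) - p L s * wy L (T - s)) - (py 0 s * w 0 (T - s) - p 0 s * wy 0 (T - s))"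
  proof -
    have T': "T - s \<in> {0<..<T}" using s by auto
    have "((\<lambda>y. py y s * w y (T - s) - p y s * wy y (T - s)) has_vector_derivative ?d s y) (at y within {0..L})" if y: "y \<in> {0..L}" for y
    proof -
      have "((\<lambda>y. py y s * w y (T - s) - p y s * wy y (T - s)) has_real_derivative
        (pt y s * w y (T - s) + wy y (T - s) * py y s) - (py y s * wy y (T - s) + wt y (T - s) * p y s)) (at y within {0..L})"
        by (intro DERIV_diff DERIV_mult C21D(2,3)[OF p] C21D(2,3)[OF w] y s T')
      moreover have "(pt y s * w y (T - s) + wy y (T - s) * py y s) - (py y s * wy y (T - s) + wt y (T - s) * p y s) = ?d s y"
        by simp
      ultimately show ?thesis
        unfolding has_real_derivative_iff_has_vector_derivative by (simp only:)
    qed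
    from fundamental_theorem_of_calculus[OF _ this] L show ?thesis by (auto intro!: integral_unique)
  qed
  ultimately show ?thesis by simp
qed

context metric_graph
begin

definition mass :: "real \<Rightarrow> ('j \<Rightarrow> real \<Rightarrow> real \<Rightarrow> real) \<Rightarrow> ('j \<Rightarrow> real \<Rightarrow> real \<Rightarrow> real) \<Rightarrow> real \<Rightarrow> real" where
  "mass T p w s = (\<Sum>j\<in>J. integral {0..len j} (\<lambda>y. p j y s * w j y (T - s)))"

lemma mass_cont:
  assumes "T > 0" "heat_sol T p py pt" "heat_sol T w wy wt"
  shows "continuous_on {0..T} (mass T p w)"
  unfolding mass_def
  by (intro continuous_on_sum edge_mass_cont[OF assms(1) heat_solD(1)[OF assms(2)] heat_solD(1)[OF assms(3)]])

text \<open>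
  The boundary terms of the edges, grouped by vertices, cancel wherever both functions satisfy the
  Kirchhoff condition.
\<close>

lemma mass_deriv:
  assumes p: "heat_sol T p py pt" and w: "heat_sol T w wy wt" and s: "s \<in> {0<..<T}"
    and p0: "\<And>e. e \<in> ends_at v0 \<Longrightarrow> p (fst e) (end_pos e) s = 0"
  shows "(mass T p w has_real_derivative
    - (\<Sum>e\<in>ends_at v0. end_sign e * (py (fst e) (end_pos e) s * w (fst e) (end_pos e) (T - s)))) (at s)"
proof -
  have T': "T - s \<in> {0<..<T}" using s by auto
  define F where "F e = py (fst e) (end_pos e) s * w (fst e) (end_pos e) (T - s) - p (fst e) (end_pos e) s * wy (fst e) (end_pos e) (T - s)" for e
  have d: "(mass T p w has_real_derivative (\<Sum>j\<in>J. F (j, True) - F (j, False))) (at s)"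
    unfolding mass_def F_def fst_conv end_pos_def snd_conv if_True if_False
    by (intro DERIV_sum edge_mass_deriv[OF len_pos heat_solD(1)[OF p] heat_solD(1)[OF w] s])
  have e1: "(\<Sum>j\<in>J. F (j, True) - F (j, False)) = - (\<Sum>e\<in>J \<times> UNIV. end_sign e * F e)"
  proof -
    have "(\<Sum>e\<in>J \<times> UNIV. end_sign e * F e) = (\<Sum>j\<in>J. \<Sum>b\<in>UNIV. end_sign (j, b) * F (j, b))"
      unfolding sum.cartesian_product by (rule sum.cong) auto
    then show ?thesis by (simp add: UNIV_bool end_sign_def sum_negf[symmetric])
  qed
  have "(\<Sum>e\<in>J \<times> UNIV. end_sign e * F e) = (\<Sum>v\<in>vx ` (J \<times> UNIV). \<Sum>e\<in>ends_at v. end_sign e * F e)"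
    unfolding ends_at_def by (rule sum.image_gen) simp
  also have "\<dots> = (\<Sum>v\<in>vx ` (J \<times> UNIV). if v = v0 then \<Sum>e\<in>ends_at v0. end_sign e * F e else 0)"
  proof (rule sum.cong[OF refl])
    fix v assume "v \<in> vx ` (J \<times> UNIV)"
    then obtain e0 where e0: "e0 \<in> ends_at v" by (auto simp: ends_at_def)
    show "(\<Sum>e\<in>ends_at v. end_sign e * F e) = (if v = v0 then \<Sum>e\<in>ends_at v0. end_sign e * F e else 0)"
    proof (cases "v = v0")
      case False
      let ?W = "w (fst e0) (end_pos e0) (T - s)" and ?P = "p (fst e0) (end_pos e0) s"
      have "(\<Sum>e\<in>ends_at v. end_sign e * F e) =
          (\<Sum>e\<in>ends_at v. ?W * (end_sign e * py (fst e) (end_pos e) s) - ?P * (end_sign e * wy (fst e) (end_pos e) (T - s)))"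
      proof (rule sum.cong[OF refl])
        fix e assume e: "e \<in> ends_at v"
        have "w (fst e) (end_pos e) (T - s) = ?W" "p (fst e) (end_pos e) s = ?P"
          using heat_solD(2)[OF w e e0, of "T - s"] heat_solD(2)[OF p e e0, of s] s by auto
        then show "end_sign e * F e = ?W * (end_sign e * py (fst e) (end_pos e) s) - ?P * (end_sign e * wy (fst e) (end_pos e) (T - s))"
          by (simp add: F_def algebra_simps)
      qed
      also have "\<dots> = 0"
        using heat_solD(3)[OF p False s] heat_solD(3)[OF w False T']
        by (simp add: sum_subtractf sum_distrib_left[symmetric])
      finally show ?thesis using False by simp
    qed simp
  qed
  also have "\<dots> = (\<Sum>e\<in>ends_at v0. end_sign e * F e)"
  proof (cases "v0 \<in> vx ` (J \<times> UNIV)")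
    case False
    then have "ends_at v0 = {}" by (auto simp: ends_at_def)
    then show ?thesis by simp
  qed (simp add: sum.delta)
  also have "\<dots> = (\<Sum>e\<in>ends_at v0. end_sign e * (py (fst e) (end_pos e) s * w (fst e) (end_pos e) (T - s)))"
    by (rule sum.cong[OF refl]) (simp add: F_def p0)
  finally show ?thesis using d by (simp only: e1)
qed

end

section \<open>Time-analyticity of the outgoing flux\<close>

lemma gauss_poly_bound:
  assumes f: "exp_growth f" and \<delta>: "\<delta> > 0"
  obtains C where "\<And>z. \<bar>z\<bar> ^ 3 * \<bar>f z\<bar> * exp (- (\<delta> * z\<^sup>2)) \<le> C * exp (- \<bar>z\<bar>)"
    "\<And>z. \<bar>z\<bar> * \<bar>f z\<bar> * exp (- (\<delta> * z\<^sup>2)) \<le> C * exp (- \<bar>z\<bar>)"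
proof -
  obtain A k where f: "A > 0" "k > 0" "\<And>z. \<bar>f z\<bar> \<le> A * exp (k * \<bar>z\<bar>)" using exp_growthE[OF f] by blast
  define C where "C = 8 * A * exp ((k + 4)\<^sup>2 / (4 * \<delta>))"
  have main: "P * \<bar>f z\<bar> * exp (- (\<delta> * z\<^sup>2)) \<le> C * exp (- \<bar>z\<bar>)" if P: "0 \<le> P" "P \<le> 8 * exp (3 * \<bar>z\<bar>)" for P z
  proof -
    have "(k + 4) * \<bar>z\<bar> \<le> \<delta> * z\<^sup>2 + (k + 4)\<^sup>2 / (4 * \<delta>)"
    proof -
      have "0 \<le> (2 * \<delta> * \<bar>z\<bar> - (k + 4))\<^sup>2 / (4 * \<delta>)" using \<delta> by simp
      also have "\<dots> = \<delta> * z\<^sup>2 + (k + 4)\<^sup>2 / (4 * \<delta>) - (k + 4) * \<bar>z\<bar>"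
        using \<delta> by (simp add: power2_diff power_mult_distrib add_divide_distrib diff_divide_distrib) (simp add: power2_eq_square)
      finally show ?thesis by simp
    qed
    then have e: "exp (- (\<delta> * z\<^sup>2)) \<le> exp ((k + 4)\<^sup>2 / (4 * \<delta>) - (k + 4) * \<bar>z\<bar>)" by simp
    have "P * \<bar>f z\<bar> * exp (- (\<delta> * z\<^sup>2)) \<le> (8 * exp (3 * \<bar>z\<bar>)) * (A * exp (k * \<bar>z\<bar>)) * exp ((k + 4)\<^sup>2 / (4 * \<delta>) - (k + 4) * \<bar>z\<bar>)"
      using P f e by (intro mult_mono) auto
    also have "\<dots> = C * (exp (3 * \<bar>z\<bar>) * exp (k * \<bar>z\<bar>) * exp (- ((k + 4) * \<bar>z\<bar>)))"
      unfolding C_def diff_conv_add_uminus exp_add by (simp only: mult_ac)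
    also have "exp (3 * \<bar>z\<bar>) * exp (k * \<bar>z\<bar>) * exp (- ((k + 4) * \<bar>z\<bar>)) = exp (- \<bar>z\<bar>)"
      by (simp add: exp_add[symmetric] algebra_simps)
    finally show ?thesis .
  qed
  have e: "\<bar>z\<bar> \<le> exp \<bar>z\<bar>" for z :: real using abs_le_exp_abs .
  show ?thesis
  proof (rule that[of C])
    fix z :: real
    have "\<bar>z\<bar> ^ 3 \<le> exp \<bar>z\<bar> ^ 3" using e by (intro power_mono) auto
    also have "\<dots> = exp (3 * \<bar>z\<bar>)" by (simp add: exp_of_nat_mult[symmetric])
    finally have "\<bar>z\<bar> ^ 3 \<le> 8 * exp (3 * \<bar>z\<bar>)" using exp_gt_zero[of "3 * \<bar>z\<bar>"] by linarith
    then show "\<bar>z\<bar> ^ 3 * \<bar>f z\<bar> * exp (- (\<delta> * z\<^sup>2)) \<le> C * exp (- \<bar>z\<bar>)" by (intro main) auto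
    have "\<bar>z\<bar> \<le> exp (3 * \<bar>z\<bar>)" by (rule order.trans[OF e]) simp
    then have "\<bar>z\<bar> \<le> 8 * exp (3 * \<bar>z\<bar>)" using exp_gt_zero[of "3 * \<bar>z\<bar>"] by linarith
    then show "\<bar>z\<bar> * \<bar>f z\<bar> * exp (- (\<delta> * z\<^sup>2)) \<le> C * exp (- \<bar>z\<bar>)" by (intro main) auto
  qed
qed

text \<open>
  Up to a factor depending on \<open>t\<close>, the flux at the origin of the heat flow of \<open>f\<close> is this transform at
  \<open>\<sigma> = 1 / (4 t)\<close>. In this form it extends to a complex half-plane.
\<close>

definition flux_transform :: "(real \<Rightarrow> real) \<Rightarrow> complex \<Rightarrow> complex" where
  "flux_transform f \<sigma> = (\<integral>z. of_real (z * f z) * exp (- \<sigma> * of_real (z\<^sup>2)) \<partial>lborel)"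

lemma flux_transform_holomorphic:
  assumes f: "continuous_on UNIV f" "exp_growth f"
  shows "flux_transform f holomorphic_on {\<sigma>. Re \<sigma> > 0}"
proof -
  have "flux_transform f field_differentiable at \<sigma>" if \<sigma>: "Re \<sigma> > 0" for \<sigma>
  proof -
    \<comment> \<open>Half the real part, so that the ball around \<open>\<sigma>\<close> stays in a half-plane where the Gaussian factor decays
      uniformly.\<close>
    define \<delta> where "\<delta> = Re \<sigma> / 2"
    have \<delta>: "\<delta> > 0" using \<sigma> by (simp add: \<delta>_def)
    obtain C where C: "\<And>z. \<bar>z\<bar> ^ 3 * \<bar>f z\<bar> * exp (- (\<delta> * z\<^sup>2)) \<le> C * exp (- \<bar>z\<bar>)"
      "\<And>z. \<bar>z\<bar> * \<bar>f z\<bar> * exp (- (\<delta> * z\<^sup>2)) \<le> C * exp (- \<bar>z\<bar>)"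
      using gauss_poly_bound[OF f(2) \<delta>] by blast
    have Re: "Re p \<ge> \<delta>" if "p \<in> ball \<sigma> \<delta>" for p
      using that abs_Re_le_cmod[of "\<sigma> - p"] by (auto simp: dist_complex_def \<delta>_def)
    have ne: "norm (exp (- p * of_real (z\<^sup>2))) \<le> exp (- (\<delta> * z\<^sup>2))" if "p \<in> ball \<sigma> \<delta>" for p and z :: real
      using Re[OF that] by (simp add: norm_exp_eq_Re mult_right_mono)
    have fm: "f \<in> borel_measurable borel" using f(1) by (rule borel_measurable_continuous_onI)
    let ?K = "\<lambda>p z. of_real (z * f z) * exp (- p * of_real (z\<^sup>2)) :: complex"
    let ?K' = "\<lambda>p z. of_real (z * f z) * (exp (- p * of_real (z\<^sup>2)) * (- of_real (z\<^sup>2))) :: complex"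
    have m: "?K p \<in> borel_measurable lborel" "?K' p \<in> borel_measurable lborel" for p
      using fm by measurable
    have int: "integrable lborel (\<lambda>z. C * exp (- \<bar>z\<bar>))" using integrable_exp_neg_abs by simp
    have "((\<lambda>p. \<integral>z. ?K p z \<partial>lborel) has_field_derivative (\<integral>z. ?K' \<sigma> z \<partial>lborel)) (at \<sigma>)"
    proof (rule has_field_derivative_lborel_integral[where S = "ball \<sigma> \<delta>" and h = "\<lambda>z. C * exp (- \<bar>z\<bar>)"])
      fix p z assume p: "p \<in> ball \<sigma> \<delta>"
      show "((\<lambda>p. ?K p z) has_field_derivative ?K' p z) (at p)"
        by (rule DERIV_cmult, rule DERIV_chain2[OF DERIV_exp]) (auto intro!: derivative_eq_intros)
      have "norm (?K' p z) = \<bar>z\<bar> ^ 3 * \<bar>f z\<bar> * norm (exp (- p * of_real (z\<^sup>2)))"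
        by (simp add: norm_mult power3_eq_cube power2_eq_square abs_mult)
      also have "\<dots> \<le> \<bar>z\<bar> ^ 3 * \<bar>f z\<bar> * exp (- (\<delta> * z\<^sup>2))" using ne[OF p] by (intro mult_left_mono) auto
      finally show "norm (?K' p z) \<le> C * exp (- \<bar>z\<bar>)" using C(1)[of z] by linarith
    next
      fix p assume p: "p \<in> ball \<sigma> \<delta>"
      show "integrable lborel (?K p)"
      proof (rule Bochner_Integration.integrable_bound[OF int m(1)], rule AE_I2)
        fix z
        have "norm (?K p z) = \<bar>z\<bar> * \<bar>f z\<bar> * norm (exp (- p * of_real (z\<^sup>2)))"
          by (simp add: norm_mult abs_mult)
        also have "\<dots> \<le> \<bar>z\<bar> * \<bar>f z\<bar> * exp (- (\<delta> * z\<^sup>2))" using ne[OF p] by (intro mult_left_mono) auto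
        also have "\<dots> \<le> C * exp (- \<bar>z\<bar>)" by (rule C)
        finally show "norm (?K p z) \<le> norm (C * exp (- \<bar>z\<bar>))" by simp
      qed
    qed (use \<delta> int m in auto)
    then show ?thesis unfolding flux_transform_def[abs_def] field_differentiable_def by blast
  qed
  then show ?thesis by (auto simp: holomorphic_on_def intro: field_differentiable_at_within)
qed

lemma heat_flow_y_flux_transform:
  assumes t: "t > 0"
  shows "flux_transform f (of_real (1 / (4 * t))) = of_real (2 * t * sqrt (4 * pi * t) * heat_flow_y f 0 t)"
proof -
  have "2 * t * sqrt (4 * pi * t) * heat_flow_y f 0 t =
    (\<integral>z. 2 * t * sqrt (4 * pi * t) * (heat_kernel t (0 - z) * (- (0 - z) / (2 * t)) * f z) \<partial>lborel)"
    unfolding heat_flow_kernel(2)[OF t] by (rule integral_mult_right_zero[symmetric])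
  also have "\<dots> = (\<integral>z. z * f z * exp (- (1 / (4 * t)) * z\<^sup>2) \<partial>lborel)"
    by (rule Bochner_Integration.integral_cong) (use t in \<open>auto simp: heat_kernel_def\<close>)
  also have "of_real \<dots> = (\<integral>z. complex_of_real (z * f z * exp (- (1 / (4 * t)) * z\<^sup>2)) \<partial>lborel)"
    by (rule integral_complex_of_real[symmetric])
  also have "\<dots> = flux_transform f (of_real (1 / (4 * t)))"
    unfolding flux_transform_def
    by (rule Bochner_Integration.integral_cong) (auto simp: exp_of_real[symmetric])
  finally show ?thesis by simp
qed

text \<open>
  The flux is, up to a nonvanishing factor, the restriction of a holomorphic function on a half-plane, so
  the identity theorem applies.
\<close>

lemma heat_flow_y_unique_continuation:
  assumes f: "continuous_on UNIV f" "exp_growth f" and ab: "0 < a" "a < b"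
    and zero: "\<And>t. t \<in> {a<..<b} \<Longrightarrow> heat_flow_y f 0 t = 0" and t: "t > 0"
  shows "heat_flow_y f 0 t = 0"
proof -
  let ?U = "(\<lambda>t. complex_of_real (1 / (4 * t))) ` {a<..<b}"
  define s where "s = (a + b) / 2"
  have s: "s \<in> {a<..<b}" "s > 0" using ab by (auto simp: s_def)
  have "flux_transform f (of_real (1 / (4 * t))) = 0"
  proof (rule analytic_continuation[OF flux_transform_holomorphic[OF f], of ?U "of_real (1 / (4 * s))"])
    show "open {\<sigma>. Re \<sigma> > 0}" by (rule open_halfspace_Re_gt)
    show "connected {\<sigma>. Re \<sigma> > 0}" by (intro convex_connected convex_halfspace_Re_gt)
    show "?U \<subseteq> {\<sigma>. Re \<sigma> > 0}" using ab by auto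
    show "complex_of_real (1 / (4 * s)) \<in> {\<sigma>. Re \<sigma> > 0}" using s by simp
    show "complex_of_real (1 / (4 * t)) \<in> {\<sigma>. Re \<sigma> > 0}" using t by simp
    show "flux_transform f z = 0" if z: "z \<in> ?U" for z
    proof -
      obtain r where r: "r \<in> {a<..<b}" "z = of_real (1 / (4 * r))" using z by blast
      then have "r > 0" using ab by simp
      then show ?thesis using heat_flow_y_flux_transform[of r f] zero[OF r(1)] r(2) by simp
    qed
    \<comment> \<open>A sequence of distinct times that decreases to \<open>s\<close> inside the interval.\<close>
    show "complex_of_real (1 / (4 * s)) islimpt ?U"
      unfolding islimpt_sequential
    proof (intro exI conjI allI)
      let ?x = "\<lambda>n::nat. s + (b - s) / (n + 2)"
      have x: "?x n \<in> {a<..<b}" "?x n > s" for n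
      proof -
        have "0 < (b - s) / (n + 2)" "(b - s) / (n + 2) < b - s" using s by (auto simp: divide_less_eq)
        then have "0 < (b - s) / (real n + 2)" "(b - s) / (real n + 2) < b - s" by (simp_all add: add.commute)
        then show "?x n \<in> {a<..<b}" "?x n > s" using s by auto
      qed
      show "complex_of_real (1 / (4 * ?x n)) \<in> ?U - {of_real (1 / (4 * s))}" for n
      proof -
        have "1 / (4 * ?x n) \<noteq> 1 / (4 * s)" using x[of n] s by auto
        then have "complex_of_real (1 / (4 * ?x n)) \<noteq> of_real (1 / (4 * s))" unfolding of_real_eq_iff .
        then show ?thesis using imageI[OF x(1)[of n], of "\<lambda>t. complex_of_real (1 / (4 * t))"] by blast
      qed
      have "(\<lambda>n. (b - s) / real (n + 2)) \<longlonglongrightarrow> 0"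
        using LIMSEQ_ignore_initial_segment[OF lim_const_over_n[of "b - s"], of 2] by simp
      then have "?x \<longlonglongrightarrow> s + 0" by (intro tendsto_intros) (simp add: add.commute)
      then show "(\<lambda>n. complex_of_real (1 / (4 * ?x n))) \<longlonglongrightarrow> of_real (1 / (4 * s))"
        using s by (intro tendsto_intros) auto
    qed
  qed
  then show ?thesis
    unfolding heat_flow_y_flux_transform[OF t] using t by simp
qed

section \<open>The quorum rule\<close>

lemma quantile_eq:
  assumes "s \<in> {0..Tmax}" "F s \<ge> \<theta>" "\<And>r. r \<in> {0..Tmax} \<Longrightarrow> F r \<ge> \<theta> \<Longrightarrow> s \<le> r"
  shows "quantile Tmax F \<theta> = ereal s"
  unfolding quantile_def using assms
  by (intro antisym Inf_lower Inf_greatest) auto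

lemma quorum_time_cong:
  assumes "\<And>s. s \<in> {0..Tmax} \<Longrightarrow> F s = G s"
  shows "quorum_time t0 Tmax \<theta> F = quorum_time t0 Tmax \<theta> G"
proof -
  have "{s \<in> {0..Tmax}. F s \<ge> \<theta>} = {s \<in> {0..Tmax}. G s \<ge> \<theta>}"
    by (intro Collect_cong conj_cong refl) (simp only: assms)
  then show ?thesis by (simp add: quorum_time_def quantile_def)
qed

text \<open>
  If \<open>F t0 t0 \<ge> \<theta>\<close> the quorum is reached no later than \<open>t0\<close>, and \<open>t0\<close> is a fixed point. If
  \<open>F Tmax Tmax < \<theta>\<close> it is never reached, and \<open>Tmax\<close> is one. Otherwise \<open>F \<tau> \<tau> = \<theta>\<close> for some \<open>\<tau>\<close>; strict
  monotonicity at the level \<open>\<theta> > 0\<close> excludes that the level was reached before \<open>\<tau>\<close>.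
\<close>

lemma quorum_fixed_point:
  fixes F :: "real \<Rightarrow> real \<Rightarrow> real"
  assumes t: "0 < t0" "t0 < Tmax" and \<theta>: "0 < \<theta>"
    and mono: "\<And>\<tau> r s. \<tau> \<in> {t0..Tmax} \<Longrightarrow> 0 \<le> r \<Longrightarrow> r \<le> s \<Longrightarrow> s \<le> Tmax \<Longrightarrow> F \<tau> r \<le> F \<tau> s"
    and alt: "\<And>\<tau> r s. \<tau> \<in> {t0..Tmax} \<Longrightarrow> 0 \<le> r \<Longrightarrow> r < s \<Longrightarrow> s \<le> Tmax \<Longrightarrow> F \<tau> r = F \<tau> s \<Longrightarrow> F \<tau> s = 0"
    and cont: "continuous_on {t0..Tmax} (\<lambda>\<tau>. F \<tau> \<tau>)"
  shows "\<exists>\<tau>\<in>{t0..Tmax}. quorum_time t0 Tmax \<theta> (F \<tau>) = \<tau>"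
proof -
  consider "F t0 t0 \<ge> \<theta>" | "F Tmax Tmax < \<theta>" | "F t0 t0 < \<theta>" "F Tmax Tmax \<ge> \<theta>" by linarith
  then show ?thesis
  proof cases
    case 1
    then have "quantile Tmax (F t0) \<theta> \<le> ereal t0"
      unfolding quantile_def using t by (intro Inf_lower) auto
    then show ?thesis using t by (intro bexI[of _ t0]) (auto simp: quorum_time_def)
  next
    case 2
    then have "{s \<in> {0..Tmax}. F Tmax s \<ge> \<theta>} = {}" using mono[of Tmax _ Tmax] t by force
    then have "quantile Tmax (F Tmax) \<theta> = \<infinity>" by (simp only: quantile_def) (simp add: top_ereal_def)
    then show ?thesis using t by (intro bexI[of _ Tmax]) (auto simp: quorum_time_def)
  next
    case 3
    then obtain \<tau> where \<tau>: "t0 \<le> \<tau>" "\<tau> \<le> Tmax" "F \<tau> \<tau> = \<theta>"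
      using IVT'[of "\<lambda>\<tau>. F \<tau> \<tau>" t0 \<theta> Tmax] cont t by auto
    have q: "quantile Tmax (F \<tau>) \<theta> = ereal \<tau>"
    proof (rule quantile_eq)
      fix r assume r: "r \<in> {0..Tmax}" "\<theta> \<le> F \<tau> r"
      show "\<tau> \<le> r"
      proof (rule ccontr)
        assume "\<not> \<tau> \<le> r"
        then have "F \<tau> r \<le> F \<tau> \<tau>" using mono[of \<tau> r \<tau>] r \<tau> by auto
        then have "F \<tau> r = F \<tau> \<tau>" using r \<tau> by simp
        then have "F \<tau> \<tau> = 0" using alt[of \<tau> r \<tau>] r \<tau> \<open>\<not> \<tau> \<le> r\<close> by auto
        then show False using \<theta> \<tau> by simp
      qed
    qed (use t \<tau> in auto)
    have "\<tau> \<noteq> t0" using 3 \<tau> by auto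
    then show ?thesis using \<tau> t by (intro bexI[of _ \<tau>]) (auto simp: quorum_time_def q)
  qed
qed

section \<open>Networks as metric graphs\<close>

text \<open>
  The network is viewed as a metric graph whose vertices are points of the ambient space.
\<close>

locale exit_network =
  fixes N :: "('i, 'j, 'n::finite) network" and i0 :: 'i and j0 :: 'j
  assumes net: "is_network N" and bd: "boundary_idx N = {i0}"
    and inc: "Inc N i0 = {j0}" and start: "edge_param N j0 0 = vertex N i0"
begin

abbreviation "J \<equiv> edge_idx N"
abbreviation "len \<equiv> edge_length N"
abbreviation "\<pi> \<equiv> edge_param N"

definition end_vx :: "'j \<times> bool \<Rightarrow> real ^ 'n" where
  "end_vx e = \<pi> (fst e) (if snd e then len (fst e) else 0)"

sublocale metric_graph J len end_vx "vertex N i0"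
  by unfold_locales (use net in \<open>auto simp: is_network_def\<close>)

lemma end_vx: "end_vx e = \<pi> (fst e) (end_pos e)"
  by (simp add: end_vx_def end_pos_def)

lemma netD:
  assumes "j \<in> J"
  shows "inj_on (\<pi> j) {0..len j}" "smooth_on {0..len j} (\<pi> j)" "open_edge N j \<inter> vertices N = {}"
    "\<pi> j 0 \<in> vertices N" "\<pi> j (len j) \<in> vertices N"
  using net assms by (auto simp: is_network_def)

lemma param_cont: "j \<in> J \<Longrightarrow> continuous_on {0..len j} (\<pi> j)"
proof -
  assume "j \<in> J"
  then have "\<forall>y\<in>{0..len j}. deriv_within {0..len j} 0 (\<pi> j) differentiable at y within {0..len j}"
    using netD(2) unfolding smooth_on_def by blast
  then show ?thesis
    unfolding deriv_within.simps differentiable_on_def[symmetric]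
    by (rule differentiable_imp_continuous_on)
qed

lemma param_eq_iff: "j \<in> J \<Longrightarrow> y \<in> {0..len j} \<Longrightarrow> z \<in> {0..len j} \<Longrightarrow> \<pi> j y = \<pi> j z \<longleftrightarrow> y = z"
  by (rule inj_on_eq_iff[OF netD(1)])

lemma vertex_at_end:
  assumes "j \<in> J" "y \<in> {0..len j}" "\<pi> j y \<in> vertices N"
  obtains e where "fst e = j" "end_pos e = y" "end_vx e = \<pi> j y"
proof -
  have "y = 0 \<or> y = len j"
  proof (rule ccontr)
    assume "\<not> (y = 0 \<or> y = len j)"
    then have "\<pi> j y \<in> open_edge N j" using assms(2) by (auto simp: open_edge_def)
    then show False using netD(3)[OF assms(1)] assms(3) by blast
  qed
  then show ?thesis
    using that[of "(j, False)"] that[of "(j, True)"] by (auto simp: end_pos_def end_vx)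
qed

lemma end_vx_vertex: "fst e \<in> J \<Longrightarrow> end_vx e \<in> vertices N"
  using netD(4,5) by (auto simp: end_vx_def)

text \<open>
  Two parametrizations of one point differ only at a vertex. This is what makes a family of functions on
  the edges that agree at the vertices a function on the network.
\<close>

lemma same_point:
  assumes j: "j \<in> J" "y \<in> {0..len j}" and k: "k \<in> J" "z \<in> {0..len k}" and eq: "\<pi> j y = \<pi> k z"
  shows "(j = k \<and> y = z) \<or> (\<exists>e e'. fst e = j \<and> end_pos e = y \<and> fst e' = k \<and> end_pos e' = z \<and> end_vx e = end_vx e')"
proof (cases "j = k")
  case True
  then show ?thesis using param_eq_iff[of j y z] assms by auto
next
  case False
  have "edge N j \<inter> edge N k \<subseteq> vertices N" using net j k False by (auto simp: is_network_def)
  moreover have "\<pi> j y \<in> edge N j" using j by (auto simp: edge_def)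
  moreover have "\<pi> j y \<in> edge N k" using k unfolding eq by (auto simp: edge_def)
  ultimately have v: "\<pi> j y \<in> vertices N" by blast
  obtain e where "fst e = j" "end_pos e = y" "end_vx e = \<pi> j y" using vertex_at_end[OF j v] .
  moreover obtain e' where "fst e' = k" "end_pos e' = z" "end_vx e' = \<pi> k z"
    using vertex_at_end[OF k] v eq by metis
  ultimately show ?thesis using eq by metis
qed

lemma ends_at_vertex_bij:
  assumes i: "i \<in> vertex_idx N"
  shows "bij_betw fst (ends_at (vertex N i)) (Inc N i)"
  unfolding bij_betw_def
proof
  show "inj_on fst (ends_at (vertex N i))"
  proof (rule inj_onI)
    fix e e' assume *: "e \<in> ends_at (vertex N i)" "e' \<in> ends_at (vertex N i)" "fst e = fst e'"
    have j: "fst e \<in> J" "fst e' \<in> J" using * by (auto dest: ends_atD)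
    have "\<pi> (fst e) (end_pos e) = \<pi> (fst e) (end_pos e')" using * by (auto dest!: ends_atD(2) simp: end_vx)
    then have "end_pos e = end_pos e'" using param_eq_iff end_pos_in j *(3) by metis
    then show "e = e'" using *(3) len_pos[OF j(1)] by (cases e, cases e') (auto simp: end_pos_def split: if_splits)
  qed
  show "fst ` ends_at (vertex N i) = Inc N i"
  proof
    show "fst ` ends_at (vertex N i) \<subseteq> Inc N i"
    proof
      fix j assume "j \<in> fst ` ends_at (vertex N i)"
      then obtain e where e: "e \<in> ends_at (vertex N i)" "j = fst e" by blast
      then have "j \<in> J" "vertex N i = \<pi> j (end_pos e)" "end_pos e \<in> {0..len j}"
        using ends_atD[OF e(1)] end_pos_in by (auto simp: end_vx)
      then show "j \<in> Inc N i" by (auto simp: Inc_def edge_def)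
    qed
    show "Inc N i \<subseteq> fst ` ends_at (vertex N i)"
    proof
      fix j assume "j \<in> Inc N i"
      then obtain y where y: "j \<in> J" "y \<in> {0..len j}" "vertex N i = \<pi> j y" by (auto simp: Inc_def edge_def)
      moreover have "\<pi> j y \<in> vertices N" using i y(3) by (metis imageI vertices_def)
      ultimately obtain e where "fst e = j" "end_vx e = \<pi> j y" using vertex_at_end by metis
      then show "j \<in> fst ` ends_at (vertex N i)" using ends_atI[of e] y by force
    qed
  qed
qed

lemma end_sign_inc_coeff:
  assumes e: "e \<in> ends_at (vertex N i)"
  shows "inc_coeff N i (fst e) = end_sign e"
proof -
  have j: "fst e \<in> J" and v: "end_vx e = vertex N i" using ends_atD[OF e] by auto
  have "\<pi> (fst e) 0 \<noteq> \<pi> (fst e) (len (fst e))" using param_eq_iff[OF j, of 0 "len (fst e)"] len_pos[OF j] by simp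
  then show ?thesis using v by (auto simp: inc_coeff_def end_sign_def end_vx_def split: if_splits)
qed

lemma vertex_sum:
  assumes i: "i \<in> vertex_idx N"
  shows "(\<Sum>j\<in>Inc N i. inc_coeff N i j * D j (vertex N i)) =
    (\<Sum>e\<in>ends_at (vertex N i). end_sign e * D (fst e) (\<pi> (fst e) (end_pos e)))"
proof -
  have "(\<Sum>j\<in>Inc N i. inc_coeff N i j * D j (vertex N i)) =
      (\<Sum>e\<in>ends_at (vertex N i). inc_coeff N i (fst e) * D (fst e) (vertex N i))"
    by (rule sum.reindex_bij_betw[OF ends_at_vertex_bij[OF i], symmetric])
  also have "\<dots> = (\<Sum>e\<in>ends_at (vertex N i). end_sign e * D (fst e) (\<pi> (fst e) (end_pos e)))"
  proof (rule sum.cong[OF refl])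
    fix e assume e: "e \<in> ends_at (vertex N i)"
    show "inc_coeff N i (fst e) * D (fst e) (vertex N i) = end_sign e * D (fst e) (\<pi> (fst e) (end_pos e))"
      using end_sign_inc_coeff[OF e] ends_atD(2)[OF e] by (simp add: end_vx)
  qed
  finally show ?thesis .
qed

lemma i0: "i0 \<in> vertex_idx N" using bd by (auto simp: boundary_idx_def)

lemma j0: "j0 \<in> J" using inc by (auto simp: Inc_def)

lemma ends_at_exit: "ends_at (vertex N i0) = {(j0, False)}"
proof -
  have "(j0, False) \<in> ends_at (vertex N i0)" using j0 start by (auto simp: ends_at_def end_vx_def)
  moreover have "e = (j0, False)" if "e \<in> ends_at (vertex N i0)" for e
    using ends_at_vertex_bij[OF i0] that calculation inc unfolding bij_betw_def inj_on_def
    by (metis fst_conv imageI singletonD)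
  ultimately show ?thesis by blast
qed

lemma vertex_cases:
  assumes "v \<noteq> vertex N i0"
  shows "ends_at v = {} \<or> (\<exists>i\<in>transition_idx N. v = vertex N i)"
proof (cases "ends_at v = {}")
  case False
  then obtain e where e: "e \<in> ends_at v" by blast
  then have "v \<in> vertices N" using end_vx_vertex[OF ends_atD(1)[OF e]] ends_atD(2)[OF e] by simp
  then obtain i where "i \<in> vertex_idx N" "v = vertex N i" by (auto simp: vertices_def)
  then show ?thesis using assms bd by (auto simp: transition_idx_def)
qed simp

lemma transitionD: "i \<in> transition_idx N \<Longrightarrow> i \<in> vertex_idx N"
  "i \<in> transition_idx N \<Longrightarrow> vertex N i \<noteq> vertex N i0"
proof -
  assume i: "i \<in> transition_idx N"
  show "i \<in> vertex_idx N" using i by (simp add: transition_idx_def)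
  then show "vertex N i \<noteq> vertex N i0"
    using i i0 bd net by (auto simp: transition_idx_def is_network_def inj_on_def)
qed

lemma edge_deriv_param:
  assumes "j \<in> J" "y \<in> {0..len j}"
  shows "edge_deriv N j k f (\<pi> j y) = deriv_within {0..len j} k (\<lambda>y. f (\<pi> j y)) y"
  unfolding edge_deriv_def on_edge_def using the_inv_into_f_f[OF netD(1)[OF assms(1)] assms(2)] by simp

text \<open>
  The transition conditions are sums over incident edges at the vertices of the network, the Kirchhoff
  conditions are sums over ends at arbitrary points; \<open>fst\<close> matches the ends at a vertex with the edges
  incident to it, since no edge is a loop.
\<close>

lemma kirchhoff_iff:
  assumes D: "\<And>j y. j \<in> J \<Longrightarrow> y \<in> {0..len j} \<Longrightarrow> D j (\<pi> j y) = w j y"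
  shows "(\<forall>i\<in>transition_idx N. (\<Sum>j\<in>Inc N i. inc_coeff N i j * D j (vertex N i)) = 0) \<longleftrightarrow>
    (\<forall>v. v \<noteq> vertex N i0 \<longrightarrow> (\<Sum>e\<in>ends_at v. end_sign e * w (fst e) (end_pos e)) = 0)"
proof -
  have eq: "(\<Sum>j\<in>Inc N i. inc_coeff N i j * D j (vertex N i)) =
      (\<Sum>e\<in>ends_at (vertex N i). end_sign e * w (fst e) (end_pos e))" if i: "i \<in> vertex_idx N" for i
    unfolding vertex_sum[OF i] using D end_pos_in ends_atD(1) by (intro sum.cong refl) metis
  show ?thesis
  proof (intro iffI ballI allI impI)
    fix v assume *: "\<forall>i\<in>transition_idx N. (\<Sum>j\<in>Inc N i. inc_coeff N i j * D j (vertex N i)) = 0" and v: "v \<noteq> vertex N i0"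
    from vertex_cases[OF v] show "(\<Sum>e\<in>ends_at v. end_sign e * w (fst e) (end_pos e)) = 0"
      using * eq transitionD(1) by auto
  next
    fix i assume "\<forall>v. v \<noteq> vertex N i0 \<longrightarrow> (\<Sum>e\<in>ends_at v. end_sign e * w (fst e) (end_pos e)) = 0" "i \<in> transition_idx N"
    then show "(\<Sum>j\<in>Inc N i. inc_coeff N i j * D j (vertex N i)) = 0"
      using eq transitionD by auto
  qed
qed

definition on_param :: "(real ^ 'n \<Rightarrow> real \<Rightarrow> real) \<Rightarrow> 'j \<Rightarrow> real \<Rightarrow> real \<Rightarrow> real" where
  "on_param u j y t = u (\<pi> j y) t"

definition param_deriv :: "nat \<Rightarrow> (real ^ 'n \<Rightarrow> real \<Rightarrow> real) \<Rightarrow> 'j \<Rightarrow> real \<Rightarrow> real \<Rightarrow> real" where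
  "param_deriv k u j y t = edge_deriv N j k (\<lambda>x. u x t) (\<pi> j y)"

definition time_deriv :: "(real ^ 'n \<Rightarrow> real \<Rightarrow> real) \<Rightarrow> 'j \<Rightarrow> real \<Rightarrow> real \<Rightarrow> real" where
  "time_deriv u j y t = deriv (u (\<pi> j y)) t"

lemma classical_C21:
  assumes u: "classical_regularity N T u" and j: "j \<in> J"
  shows "C21 (len j) T (on_param u j) (param_deriv 1 u j) (param_deriv 2 u j) (time_deriv u j)"
proof -
  let ?S = "{0..len j}"
  let ?d = "\<lambda>k y t. deriv_within ?S k (\<lambda>y. u (\<pi> j y) t) y"
  have L: "len j > 0" by (rule len_pos[OF j])
  have nt: "at y within ?S \<noteq> bot" if "y \<in> ?S" for y
    using that L by (simp add: trivial_limit_within islimpt_Icc)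
  from u j have c0: "continuous_on (net_points N \<times> {0..T}) (\<lambda>(x, s). u x s)"
    and Ck: "\<And>t. t \<in> {0<..<T} \<Longrightarrow> Ck_on ?S 2 (\<lambda>y. u (\<pi> j y) t)"
    and cd: "\<And>k. k \<le> 2 \<Longrightarrow> continuous_on (?S \<times> {0<..<T}) (\<lambda>(y, t). ?d k y t)"
    and dt: "\<And>x t. x \<in> edge N j \<Longrightarrow> t \<in> {0<..<T} \<Longrightarrow> u x differentiable (at t)"
    and ct: "continuous_on (?S \<times> {0<..<T}) (\<lambda>(y, s). deriv (u (\<pi> j y)) s)"
    by (auto simp: classical_regularity_def on_edge_def)
  have "C21 (len j) T (\<lambda>y t. u (\<pi> j y) t) (?d 1) (?d 2) (\<lambda>y t. deriv (u (\<pi> j y)) t)"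
    unfolding C21_def
  proof (intro conjI ballI)
    have "continuous_on (?S \<times> {0..T}) (\<lambda>q. (\<lambda>(x, s). u x s) (\<pi> j (fst q), snd q))"
    proof (rule continuous_on_compose2[OF c0])
      show "continuous_on (?S \<times> {0..T}) (\<lambda>q. (\<pi> j (fst q), snd q))"
        by (intro continuous_intros continuous_on_compose2[OF param_cont[OF j]]) auto
      show "(\<lambda>q. (\<pi> j (fst q), snd q)) ` (?S \<times> {0..T}) \<subseteq> net_points N \<times> {0..T}"
        using j by (auto simp: net_points_def edge_def)
    qed
    then show "continuous_on (?S \<times> {0..T}) (\<lambda>(y, t). u (\<pi> j y) t)" by (simp add: case_prod_beta)
    fix y t assume y: "y \<in> ?S" and t: "t \<in> {0<..<T}"
    have d: "deriv_within ?S k (\<lambda>y. u (\<pi> j y) t) differentiable (at y within ?S)" if "k < 2" for k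
      using Ck[OF t] that y by (auto simp: Ck_on_def)
    show "((\<lambda>y. u (\<pi> j y) t) has_real_derivative ?d 1 y t) (at y within ?S)"
      using has_real_derivative_deriv_within[OF d[of 0] nt[OF y]] by simp
    show "((\<lambda>y. ?d 1 y t) has_real_derivative ?d 2 y t) (at y within ?S)"
      using has_real_derivative_deriv_within[OF d[of 1] nt[OF y]] by (simp add: numeral_2_eq_2)
    show "((\<lambda>t. u (\<pi> j y) t) has_real_derivative deriv (u (\<pi> j y)) t) (at t)"
      using dt[of "\<pi> j y" t] y t by (auto simp: edge_def DERIV_deriv_iff_real_differentiable)
  qed (use cd[of 1] cd[of 2] ct in auto)
  then show ?thesis
    by (rule C21_cong) (use edge_deriv_param[OF j] in \<open>auto simp: on_param_def param_deriv_def time_deriv_def\<close>)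
qed

lemma on_param_vertex:
  assumes "e \<in> ends_at v" "e' \<in> ends_at v"
  shows "on_param u (fst e) (end_pos e) t = on_param u (fst e') (end_pos e') t"
  using ends_atD(2)[OF assms(1)] ends_atD(2)[OF assms(2)] by (simp add: on_param_def end_vx)

text \<open>
  The equation is required inside the edges only; it extends to the end points by continuity of the
  derivatives. The maximum principle uses it there.
\<close>

lemma HJB_on_closed_edge:
  assumes u: "HJB_solution N i0 T c u" and j: "j \<in> J" and y: "y \<in> {0..len j}" and t: "t \<in> {0<..<T}"
  shows "time_deriv u j y t + param_deriv 2 u j y t + 1/2 * (param_deriv 1 u j y t)\<^sup>2 = 0"
proof (rule zero_on_closed_interval[OF len_pos[OF j] _ _ y])
  have "classical_regularity N T u" using u by (simp add: HJB_solution_def)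
  note C = C21D[OF classical_C21[OF this j]]
  have c: "continuous_on {0..len j} (\<lambda>y. k y t)" if "continuous_on ({0..len j} \<times> {0<..<T}) (\<lambda>(y, t). k y t)" for k :: "real \<Rightarrow> real \<Rightarrow> real"
    by (rule continuous_on_compose2[OF that, of _ "\<lambda>y. (y, t)", simplified]) (use t in \<open>auto intro!: continuous_intros\<close>)
  show "continuous_on {0..len j} (\<lambda>y. time_deriv u j y t + param_deriv 2 u j y t + 1/2 * (param_deriv 1 u j y t)\<^sup>2)"
    by (intro continuous_intros c C(5-7))
  fix y assume y: "y \<in> {0<..<len j}"
  then have "\<pi> j y \<in> open_edge N j" by (auto simp: open_edge_def)
  then show "time_deriv u j y t + param_deriv 2 u j y t + 1/2 * (param_deriv 1 u j y t)\<^sup>2 = 0"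
    using u j t unfolding HJB_solution_def time_deriv_def param_deriv_def power2_abs by blast
qed

lemma drift_deriv:
  assumes u: "C21 (len j) T (on_param u j) (param_deriv 1 u j) uyy ut" and m: "C21 (len j) T (on_param m j) my myy mt"
    and j: "j \<in> J" and y: "y \<in> {0..len j}" and t: "t \<in> {0<..<T}"
  shows "edge_deriv N j 1 (\<lambda>x. edge_deriv N j 1 (\<lambda>x. u x t) x * m x t) (\<pi> j y) =
    uyy y t * on_param m j y t + param_deriv 1 u j y t * my y t"
proof -
  have "((\<lambda>y. edge_deriv N j 1 (\<lambda>x. u x t) (\<pi> j y) * m (\<pi> j y) t) has_real_derivative
      uyy y t * on_param m j y t + my y t * param_deriv 1 u j y t) (at y within {0..len j})"
    using DERIV_mult[OF C21D(3)[OF u y t] C21D(2)[OF m y t]] by (simp add: param_deriv_def on_param_def)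
  from vector_derivative_Icc[OF len_pos[OF j] y this] show ?thesis
    unfolding edge_deriv_param[OF j y] by (simp add: mult.commute)
qed

lemma FP_on_closed_edge:
  assumes u: "HJB_solution N i0 T c u" and m: "FP_solution N i0 T m0 u m"
    and j: "j \<in> J" and y: "y \<in> {0..len j}" and t: "t \<in> {0<..<T}"
  shows "time_deriv m j y t - param_deriv 2 m j y t
    + (param_deriv 2 u j y t * on_param m j y t + param_deriv 1 u j y t * param_deriv 1 m j y t) = 0"
proof (rule zero_on_closed_interval[OF len_pos[OF j] _ _ y])
  have cr: "classical_regularity N T u" "classical_regularity N T m" using u m by (simp_all add: HJB_solution_def FP_solution_def)
  note U = classical_C21[OF cr(1) j] and M = classical_C21[OF cr(2) j]
  have c: "continuous_on {0..len j} (\<lambda>y. k y t)" if "continuous_on ({0..len j} \<times> {0<..<T}) (\<lambda>(y, t). k y t)" for k :: "real \<Rightarrow> real \<Rightarrow> real"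
    by (rule continuous_on_compose2[OF that, of _ "\<lambda>y. (y, t)", simplified]) (use t in \<open>auto intro!: continuous_intros\<close>)
  have m0: "continuous_on ({0..len j} \<times> {0<..<T}) (\<lambda>(y, t). on_param m j y t)"
    by (rule continuous_on_subset[OF C21D(1)[OF M]]) auto
  show "continuous_on {0..len j} (\<lambda>y. time_deriv m j y t - param_deriv 2 m j y t
    + (param_deriv 2 u j y t * on_param m j y t + param_deriv 1 u j y t * param_deriv 1 m j y t))"
    by (intro continuous_intros c C21D(5-7)[OF U] C21D(5-7)[OF M] m0)
  fix y assume y: "y \<in> {0<..<len j}"
  then have y': "y \<in> {0..len j}" and "\<pi> j y \<in> open_edge N j" by (auto simp: open_edge_def)
  then have "deriv (m (\<pi> j y)) t - edge_deriv N j 2 (\<lambda>x. m x t) (\<pi> j y)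
          + edge_deriv N j 1 (\<lambda>x. edge_deriv N j 1 (\<lambda>x. u x t) x * m x t) (\<pi> j y) = 0"
    using m j t unfolding FP_solution_def by blast
  then show "time_deriv m j y t - param_deriv 2 m j y t
    + (param_deriv 2 u j y t * on_param m j y t + param_deriv 1 u j y t * param_deriv 1 m j y t) = 0"
    unfolding drift_deriv[OF U M j y' t] by (simp add: time_deriv_def param_deriv_def)
qed

lemma HJB_kirchhoff:
  assumes u: "HJB_solution N i0 T c u" and t: "t \<in> {0<..<T}" and v: "v \<noteq> vertex N i0"
  shows "(\<Sum>e\<in>ends_at v. end_sign e * param_deriv 1 u (fst e) (end_pos e) t) = 0"
proof -
  have "\<forall>i\<in>transition_idx N. (\<Sum>j\<in>Inc N i. inc_coeff N i j * edge_deriv N j 1 (\<lambda>x. u x t) (vertex N i)) = 0"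
    using u t unfolding HJB_solution_def by blast
  then show ?thesis
    using kirchhoff_iff[of "\<lambda>j. edge_deriv N j 1 (\<lambda>x. u x t)" "\<lambda>j y. param_deriv 1 u j y t"] v
    by (simp add: param_deriv_def)
qed

lemma FP_kirchhoff:
  assumes m: "FP_solution N i0 T m0 u m" and t: "t \<in> {0<..<T}" and v: "v \<noteq> vertex N i0"
  shows "(\<Sum>e\<in>ends_at v. end_sign e * (param_deriv 1 m (fst e) (end_pos e) t
    - on_param m (fst e) (end_pos e) t * param_deriv 1 u (fst e) (end_pos e) t)) = 0"
proof -
  have 1: "\<forall>i\<in>transition_idx N. (\<Sum>j\<in>Inc N i. inc_coeff N i j *
     (\<lambda>j x. edge_deriv N j 1 (\<lambda>x. m x t) x - m x t * edge_deriv N j 1 (\<lambda>x. u x t) x) j (vertex N i)) = 0"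
    using m t unfolding FP_solution_def by blast
  have "(\<forall>i\<in>transition_idx N. (\<Sum>j\<in>Inc N i. inc_coeff N i j *
     (\<lambda>j x. edge_deriv N j 1 (\<lambda>x. m x t) x - m x t * edge_deriv N j 1 (\<lambda>x. u x t) x) j (vertex N i)) = 0) \<longleftrightarrow>
    (\<forall>v. v \<noteq> vertex N i0 \<longrightarrow> (\<Sum>e\<in>ends_at v. end_sign e *
      (\<lambda>j y. param_deriv 1 m j y t - on_param m j y t * param_deriv 1 u j y t) (fst e) (end_pos e)) = 0)"
    by (rule kirchhoff_iff) (simp add: param_deriv_def on_param_def)
  then show ?thesis using 1 v by blast
qed

text \<open>
  Hopf's substitution removes the quadratic term. Time is reversed, so that the final condition becomes
  an initial one.
\<close>

lemma HJB_heat_sol: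
  assumes u: "HJB_solution N i0 T c u"
  shows "heat_sol T (\<lambda>j y t. exp (1/2 * on_param u j y (T - t)))
    (\<lambda>j y t. 1/2 * exp (1/2 * on_param u j y (T - t)) * param_deriv 1 u j y (T - t))
    (\<lambda>j y t. - (1/2 * exp (1/2 * on_param u j y (T - t)) * time_deriv u j y (T - t)))"
  unfolding heat_sol_def
proof (intro conjI ballI allI impI)
  fix j assume j: "j \<in> J"
  have "classical_regularity N T u" using u by (simp add: HJB_solution_def)
  from C21_reverse[OF C21_exp[OF classical_C21[OF this j], of "1/2"]]
  show "C21 (len j) T (\<lambda>y t. exp (1/2 * on_param u j y (T - t)))
    (\<lambda>y t. 1/2 * exp (1/2 * on_param u j y (T - t)) * param_deriv 1 u j y (T - t))
    (\<lambda>y t. - (1/2 * exp (1/2 * on_param u j y (T - t)) * time_deriv u j y (T - t)))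
    (\<lambda>y t. - (1/2 * exp (1/2 * on_param u j y (T - t)) * time_deriv u j y (T - t)))"
  proof (rule C21_cong)
    fix y t assume y: "y \<in> {0..len j}" and "t \<in> {0<..<T}"
    then have "T - t \<in> {0<..<T}" by auto
    from HJB_on_closed_edge[OF u j y this]
    have 1: "time_deriv u j y (T - t) = - param_deriv 2 u j y (T - t) - 1/2 * (param_deriv 1 u j y (T - t))\<^sup>2" by linarith
    show "(1/2)\<^sup>2 * exp (1/2 * on_param u j y (T - t)) * (param_deriv 1 u j y (T - t))\<^sup>2
       + 1/2 * exp (1/2 * on_param u j y (T - t)) * param_deriv 2 u j y (T - t) =
       - (1/2 * exp (1/2 * on_param u j y (T - t)) * time_deriv u j y (T - t))"
      unfolding 1 by (simp add: power2_eq_square algebra_simps)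
  qed auto
next
  fix v e e' t assume "e \<in> ends_at v" "e' \<in> ends_at v"
  then show "exp (1/2 * on_param u (fst e) (end_pos e) (T - t)) = exp (1/2 * on_param u (fst e') (end_pos e') (T - t))"
    using on_param_vertex by metis
next
  fix v t assume v: "v \<noteq> vertex N i0" and "t \<in> {0<..<T}"
  then have t: "T - t \<in> {0<..<T}" by auto
  show "(\<Sum>e\<in>ends_at v. end_sign e * (1/2 * exp (1/2 * on_param u (fst e) (end_pos e) (T - t)) * param_deriv 1 u (fst e) (end_pos e) (T - t))) = 0"
  proof (cases "ends_at v = {}")
    case False
    then obtain e0 where e0: "e0 \<in> ends_at v" by blast
    let ?E = "1/2 * exp (1/2 * on_param u (fst e0) (end_pos e0) (T - t))"
    have "(\<Sum>e\<in>ends_at v. end_sign e * (1/2 * exp (1/2 * on_param u (fst e) (end_pos e) (T - t)) * param_deriv 1 u (fst e) (end_pos e) (T - t))) =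
      (\<Sum>e\<in>ends_at v. ?E * (end_sign e * param_deriv 1 u (fst e) (end_pos e) (T - t)))"
      using on_param_vertex[OF _ e0] by (intro sum.cong refl) simp
    then show ?thesis using HJB_kirchhoff[OF u t v] by (simp only: sum_distrib_left[symmetric] mult_zero_right)
  qed simp
qed

text \<open>
  Dividing the density by \<open>exp (u / 2)\<close> turns drift plus diffusion into pure diffusion. In the transition
  condition the leftover term is a multiple of the Kirchhoff sum of \<open>u\<close>.
\<close>

lemma FP_heat_sol:
  assumes u: "HJB_solution N i0 T c u" and m: "FP_solution N i0 T m0 u m"
  obtains py pt where "heat_sol T (\<lambda>j y t. on_param m j y t * exp (-1/2 * on_param u j y t)) py pt"
proof -
  let ?E = "\<lambda>j y t. exp (-1/2 * on_param u j y t)"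
  let ?py = "\<lambda>j y t. param_deriv 1 m j y t * ?E j y t + on_param m j y t * (-1/2 * ?E j y t * param_deriv 1 u j y t)"
  let ?pt = "\<lambda>j y t. time_deriv m j y t * ?E j y t + on_param m j y t * (-1/2 * ?E j y t * time_deriv u j y t)"
  have "heat_sol T (\<lambda>j y t. on_param m j y t * ?E j y t) ?py ?pt"
    unfolding heat_sol_def
  proof (intro conjI ballI allI impI)
    fix j assume j: "j \<in> J"
    have cr: "classical_regularity N T u" "classical_regularity N T m" using u m by (simp_all add: HJB_solution_def FP_solution_def)
    from C21_mult[OF classical_C21[OF cr(2) j] C21_exp[OF classical_C21[OF cr(1) j], of "-1/2"]]
    show "C21 (len j) T (\<lambda>y t. on_param m j y t * ?E j y t) (?py j) (?pt j) (?pt j)"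
    proof (rule C21_cong)
      fix y t assume y: "y \<in> {0..len j}" and t: "t \<in> {0<..<T}"
      have 1: "time_deriv u j y t = - param_deriv 2 u j y t - 1/2 * (param_deriv 1 u j y t)\<^sup>2"
        using HJB_on_closed_edge[OF u j y t] by linarith
      have 2: "time_deriv m j y t = param_deriv 2 m j y t
          - (param_deriv 2 u j y t * on_param m j y t + param_deriv 1 u j y t * param_deriv 1 m j y t)"
        using FP_on_closed_edge[OF u m j y t] by linarith
      show "param_deriv 2 m j y t * ?E j y t + 2 * param_deriv 1 m j y t * (-1/2 * ?E j y t * param_deriv 1 u j y t)
         + on_param m j y t * ((-1/2)\<^sup>2 * ?E j y t * (param_deriv 1 u j y t)\<^sup>2 + -1/2 * ?E j y t * param_deriv 2 u j y t) = ?pt j y t"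
        unfolding 1 2 by (simp add: power2_eq_square algebra_simps)
    qed auto
  next
    fix v e e' t assume "e \<in> ends_at v" "e' \<in> ends_at v"
    then show "on_param m (fst e) (end_pos e) t * ?E (fst e) (end_pos e) t = on_param m (fst e') (end_pos e') t * ?E (fst e') (end_pos e') t"
      using on_param_vertex by metis
  next
    fix v t assume v: "v \<noteq> vertex N i0" and t: "t \<in> {0<..<T}"
    show "(\<Sum>e\<in>ends_at v. end_sign e * ?py (fst e) (end_pos e) t) = 0"
    proof (cases "ends_at v = {}")
      case False
      then obtain e0 where e0: "e0 \<in> ends_at v" by blast
      let ?E0 = "?E (fst e0) (end_pos e0) t" and ?m0 = "on_param m (fst e0) (end_pos e0) t"
      let ?a = "\<lambda>e. end_sign e * (param_deriv 1 m (fst e) (end_pos e) t - on_param m (fst e) (end_pos e) t * param_deriv 1 u (fst e) (end_pos e) t)"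
      let ?b = "\<lambda>e. end_sign e * param_deriv 1 u (fst e) (end_pos e) t"
      have "(\<Sum>e\<in>ends_at v. end_sign e * ?py (fst e) (end_pos e) t) = (\<Sum>e\<in>ends_at v. ?E0 * ?a e + (?E0 * ?m0 / 2) * ?b e)"
      proof (rule sum.cong[OF refl])
        fix e assume e: "e \<in> ends_at v"
        show "end_sign e * ?py (fst e) (end_pos e) t = ?E0 * ?a e + (?E0 * ?m0 / 2) * ?b e"
          unfolding on_param_vertex[OF e e0] by (simp add: algebra_simps)
      qed
      also have "\<dots> = ?E0 * (\<Sum>e\<in>ends_at v. ?a e) + (?E0 * ?m0 / 2) * (\<Sum>e\<in>ends_at v. ?b e)"
        by (simp only: sum.distrib sum_distrib_left)
      finally show ?thesis using HJB_kirchhoff[OF u t v] FP_kirchhoff[OF m t v] by simp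
    qed simp
  qed
  then show ?thesis by (rule that)
qed

text \<open>
  A function on the network with prescribed restrictions to the edges. The default \<open>d\<close> concerns the
  vertices to which no edge is incident.
\<close>

definition glue :: "('j \<Rightarrow> real \<Rightarrow> real \<Rightarrow> real) \<Rightarrow> (real ^ 'n \<Rightarrow> real) \<Rightarrow> real ^ 'n \<Rightarrow> real \<Rightarrow> real" where
  "glue G d x t = (if \<exists>p. fst p \<in> J \<and> snd p \<in> {0..len (fst p)} \<and> \<pi> (fst p) (snd p) = x
     then (let p = SOME p. fst p \<in> J \<and> snd p \<in> {0..len (fst p)} \<and> \<pi> (fst p) (snd p) = x in G (fst p) (snd p) t)
     else d x)"

lemma on_param_glue:
  assumes compat: "\<And>v e e'. e \<in> ends_at v \<Longrightarrow> e' \<in> ends_at v \<Longrightarrow> G (fst e) (end_pos e) t = G (fst e') (end_pos e') t"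
    and j: "j \<in> J" "y \<in> {0..len j}"
  shows "on_param (glue G d) j y t = G j y t"
proof -
  let ?P = "\<lambda>p. fst p \<in> J \<and> snd p \<in> {0..len (fst p)} \<and> \<pi> (fst p) (snd p) = \<pi> j y"
  define p where "p = (SOME p. ?P p)"
  have "?P (j, y)" using j by simp
  then have p: "?P p" unfolding p_def by (rule someI)
  have "on_param (glue G d) j y t = G (fst p) (snd p) t"
    using \<open>?P (j, y)\<close> unfolding on_param_def glue_def p_def Let_def by (subst if_P) blast+
  also have "\<dots> = G j y t"
  proof -
    have "(fst p = j \<and> snd p = y) \<or> (\<exists>e e'. fst e = fst p \<and> end_pos e = snd p \<and> fst e' = j \<and> end_pos e' = y \<and> end_vx e = end_vx e')"
      using p j by (intro same_point) auto
    then show ?thesis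
    proof
      assume "\<exists>e e'. fst e = fst p \<and> end_pos e = snd p \<and> fst e' = j \<and> end_pos e' = y \<and> end_vx e = end_vx e'"
      then obtain e e' where e: "fst e = fst p" "end_pos e = snd p" "fst e' = j" "end_pos e' = y" "end_vx e = end_vx e'" by blast
      have "e \<in> ends_at (end_vx e)" "e' \<in> ends_at (end_vx e)"
        using ends_atI[of e] ends_atI[of e'] e p j by auto
      from compat[OF this] show ?thesis using e by simp
    qed auto
  qed
  finally show ?thesis .
qed

lemma glue_off_edges: "x \<notin> (\<Union>j\<in>J. edge N j) \<Longrightarrow> glue G d x t = d x"
  by (auto simp: glue_def edge_def)

text \<open>
  Regularity in the sense of the system is a statement about the restrictions to the edges, except for
  continuity on the whole network; the latter holds because the network is a finite union of compact
  arcs and isolated vertices.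
\<close>

lemma classical_from_C21:
  assumes w: "\<And>j. j \<in> J \<Longrightarrow> C21 (len j) T (on_param u j) (wy j) (wyy j) (wt j)"
    and off: "\<And>x s. x \<notin> (\<Union>j\<in>J. edge N j) \<Longrightarrow> u x s = d x"
  shows "classical_regularity N T u"
    and "\<And>j y t. j \<in> J \<Longrightarrow> y \<in> {0..len j} \<Longrightarrow> t \<in> {0<..<T} \<Longrightarrow> param_deriv 1 u j y t = wy j y t"
    and "\<And>j y t. j \<in> J \<Longrightarrow> y \<in> {0..len j} \<Longrightarrow> t \<in> {0<..<T} \<Longrightarrow> param_deriv 2 u j y t = wyy j y t"
    and "\<And>j y t. j \<in> J \<Longrightarrow> y \<in> {0..len j} \<Longrightarrow> t \<in> {0<..<T} \<Longrightarrow> time_deriv u j y t = wt j y t"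
proof -
  have on: "on_edge N j (\<lambda>x. u x t) = (\<lambda>y. on_param u j y t)" for j t
    by (simp add: on_edge_def on_param_def)
  have dw: "deriv_within {0..len j} 1 (\<lambda>y. on_param u j y t) y = wy j y t"
    "deriv_within {0..len j} 2 (\<lambda>y. on_param u j y t) y = wyy j y t"
    if "j \<in> J" "y \<in> {0..len j}" "t \<in> {0<..<T}" for j y t
    using deriv_within_C21[OF len_pos w] that by auto
  show "param_deriv 1 u j y t = wy j y t" "param_deriv 2 u j y t = wyy j y t"
    if "j \<in> J" "y \<in> {0..len j}" "t \<in> {0<..<T}" for j y t
    using dw[OF that] edge_deriv_param[OF that(1,2)] by (simp_all add: param_deriv_def on_param_def)
  have dt: "((\<lambda>t. u (\<pi> j y) t) has_real_derivative wt j y t) (at t)" if "j \<in> J" "y \<in> {0..len j}" "t \<in> {0<..<T}" for j y t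
    using C21D(4)[OF w that(2,3)] that(1) by (simp add: on_param_def)
  show td: "time_deriv u j y t = wt j y t" if "j \<in> J" "y \<in> {0..len j}" "t \<in> {0<..<T}" for j y t
    using DERIV_imp_deriv[OF dt[OF that]] by (simp add: time_deriv_def)
  show "classical_regularity N T u"
    unfolding classical_regularity_def
  proof (intro conjI ballI allI impI)
    let ?U = "\<lambda>p. u (fst p) (snd p)"
    have edge_compact: "compact (edge N j)" if "j \<in> J" for j
      unfolding edge_def by (intro compact_continuous_image param_cont that) simp
    have "continuous_on (edge N j \<times> {0..T}) ?U" if j: "j \<in> J" for j
    proof -
      let ?k = "the_inv_into {0..len j} (\<pi> j)"
      have k: "?k (\<pi> j y) = y" if "y \<in> {0..len j}" for y using the_inv_into_f_f[OF netD(1)[OF j] that] .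
      have "continuous_on (edge N j) ?k"
        unfolding edge_def by (rule continuous_on_inv[OF param_cont[OF j]]) (use k in auto)
      then have "continuous_on (edge N j \<times> {0..T}) (\<lambda>p. ?k (fst p))"
        by (rule continuous_on_compose2) (auto intro!: continuous_intros)
      then have "continuous_on (edge N j \<times> {0..T}) (\<lambda>p. (\<lambda>(y, t). on_param u j y t) (?k (fst p), snd p))"
        by (intro continuous_on_compose2[OF C21D(1)[OF w[OF j]]] continuous_on_Pair continuous_intros)
          (use k in \<open>auto simp: edge_def\<close>)
      then show ?thesis
        by (rule continuous_on_eq) (use k in \<open>auto simp: edge_def on_param_def\<close>)
    qed
    then have 1: "continuous_on (\<Union>j\<in>J. edge N j \<times> {0..T}) ?U"
      by (intro continuous_on_closed_Union finJ closed_Times compact_imp_closed[OF edge_compact]) auto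
    define I where "I = {i \<in> vertex_idx N. vertex N i \<notin> (\<Union>j\<in>J. edge N j)}"
    have "continuous_on ({vertex N i} \<times> {0..T}) ?U" if "i \<in> I" for i
      by (rule continuous_on_eq[OF continuous_on_const[of _ "d (vertex N i)"]]) (use off that in \<open>auto simp: I_def\<close>)
    moreover have "finite I" using net by (auto simp: I_def is_network_def)
    ultimately have 2: "continuous_on (\<Union>i\<in>I. {vertex N i} \<times> {0..T}) ?U"
      by (intro continuous_on_closed_Union closed_Times) auto
    have "closed (\<Union>j\<in>J. edge N j \<times> {0..T})" "closed (\<Union>i\<in>I. {vertex N i} \<times> {0..T})"
      using \<open>finite I\<close> by (intro closed_UN finJ closed_Times compact_imp_closed[OF edge_compact] ballI; simp)+
    then have "continuous_on ((\<Union>j\<in>J. edge N j \<times> {0..T}) \<union> (\<Union>i\<in>I. {vertex N i} \<times> {0..T})) ?U"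
      by (intro continuous_on_closed_Un 1 2)
    moreover have "net_points N \<times> {0..T} \<subseteq> (\<Union>j\<in>J. edge N j \<times> {0..T}) \<union> (\<Union>i\<in>I. {vertex N i} \<times> {0..T})"
      unfolding net_points_def vertices_def I_def by blast
    ultimately show "continuous_on (net_points N \<times> {0..T}) (\<lambda>(x, s). u x s)"
      unfolding case_prod_beta by (rule continuous_on_subset)
  next
    fix j assume j: "j \<in> J"
    note C = C21D[OF w[OF j]]
    have sub: "{0..len j} \<times> {0<..<T} \<subseteq> {0..len j} \<times> {0..T}" by auto
    show "Ck_on {0..len j} 2 (on_edge N j (\<lambda>x. u x s))" if "s \<in> {0<..<T}" for s
      unfolding on by (rule Ck_on_C21[OF len_pos[OF j] w[OF j] that])
    show "u x differentiable at s" if x: "x \<in> edge N j" and s: "s \<in> {0<..<T}" for x s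
    proof -
      obtain y where "y \<in> {0..len j}" "x = \<pi> j y" using x unfolding edge_def by blast
      then show ?thesis using has_real_derivative_imp_differentiable[OF dt[OF j _ s]] by simp
    qed
    have "continuous_on ({0..len j} \<times> {0<..<T}) (\<lambda>(y, s). time_deriv u j y s)"
      by (rule continuous_on_eq[OF C(7)]) (use td[OF j] in auto)
    then show "continuous_on ({0..len j} \<times> {0<..<T}) (\<lambda>(y, s). deriv (u (\<pi> j y)) s)"
      by (simp add: time_deriv_def)
    fix k :: nat assume "k \<le> 2"
    then consider "k = 0" | "k = 1" | "k = 2" by linarith
    then show "continuous_on ({0..len j} \<times> {0<..<T}) (\<lambda>(y, s). deriv_within {0..len j} k (on_edge N j (\<lambda>x. u x s)) y)"
      unfolding on
    proof cases
      case 1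
      show "continuous_on ({0..len j} \<times> {0<..<T}) (\<lambda>(y, s). deriv_within {0..len j} k (\<lambda>y. on_param u j y s) y)"
        using continuous_on_subset[OF C(1) sub] by (simp add: 1)
    next
      case 2
      show "continuous_on ({0..len j} \<times> {0<..<T}) (\<lambda>(y, s). deriv_within {0..len j} k (\<lambda>y. on_param u j y s) y)"
        unfolding 2 by (rule continuous_on_eq[OF C(5)]) (use dw(1)[OF j] in auto)
    next
      case 3
      show "continuous_on ({0..len j} \<times> {0<..<T}) (\<lambda>(y, s). deriv_within {0..len j} k (\<lambda>y. on_param u j y s) y)"
        unfolding 3 by (rule continuous_on_eq[OF C(6)]) (use dw(2)[OF j] in auto)
    qed
  qed
qed

text \<open>
  The two heat solutions that encode a solution of the system with cost \<open>c\<close>: \<open>w\<close> is \<open>exp (u / 2)\<close> with time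
  reversed, \<open>p\<close> is \<open>m / exp (u / 2)\<close>.
\<close>

definition hopf_cole :: "real \<Rightarrow> (real \<Rightarrow> real) \<Rightarrow> (real ^ 'n \<Rightarrow> real) \<Rightarrow>
    ('j \<Rightarrow> real \<Rightarrow> real \<Rightarrow> real) \<Rightarrow> ('j \<Rightarrow> real \<Rightarrow> real \<Rightarrow> real) \<Rightarrow> bool" where
  "hopf_cole T c m0 w p \<longleftrightarrow>
     (\<exists>wy wt. heat_sol T w wy wt) \<and> (\<exists>py pt. heat_sol T p py pt) \<and>
     (\<forall>j\<in>J. \<forall>y\<in>{0..len j}. \<forall>t\<in>{0..T}. w j y t \<ge> 1) \<and>
     (\<forall>j\<in>J. \<forall>y\<in>{0..len j}. w j y 0 = exp (1/2 * c T)) \<and>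
     (\<forall>t\<in>{0..T}. w j0 0 t = exp (1/2 * c (T - t))) \<and>
     (\<forall>j\<in>J. \<forall>y\<in>{0..len j}. p j y 0 = m0 (\<pi> j y) / w j y T) \<and>
     (\<forall>t\<in>{0..T}. p j0 0 t = 0)"

lemma hopf_coleD:
  assumes "hopf_cole T c m0 w p"
  shows "\<lbrakk>j \<in> J; y \<in> {0..len j}; t \<in> {0..T}\<rbrakk> \<Longrightarrow> w j y t \<ge> 1"
    and "\<lbrakk>j \<in> J; y \<in> {0..len j}\<rbrakk> \<Longrightarrow> w j y 0 = exp (1/2 * c T)"
    and "t \<in> {0..T} \<Longrightarrow> w j0 0 t = exp (1/2 * c (T - t))"
    and "\<lbrakk>j \<in> J; y \<in> {0..len j}\<rbrakk> \<Longrightarrow> p j y 0 = m0 (\<pi> j y) / w j y T"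
    and "t \<in> {0..T} \<Longrightarrow> p j0 0 t = 0"
  using assms unfolding hopf_cole_def by blast+

lemma net_pointI: "j \<in> J \<Longrightarrow> y \<in> {0..len j} \<Longrightarrow> \<pi> j y \<in> net_points N"
  unfolding net_points_def edge_def by blast

text \<open>
  The substitution is inverted: \<open>u = 2 ln w\<close> with time reversed and \<open>m = p * exp (u / 2)\<close>. On every edge
  the equations and the transition conditions then reduce to those of \<open>w\<close> and \<open>p\<close>.
\<close>

lemma MFG_exists:
  assumes T: "T > 0" and hc: "hopf_cole T c m0 w p"
  shows "\<exists>u m. MFG_solution N i0 T c m0 u m"
proof -
  obtain wy wt py pt where w: "heat_sol T w wy wt" and p: "heat_sol T p py pt" using hc unfolding hopf_cole_def by blast
  note w1 = hopf_coleD(1)[OF hc] and w0 = hopf_coleD(2)[OF hc] and wb = hopf_coleD(3)[OF hc]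
    and p0 = hopf_coleD(4)[OF hc] and pb = hopf_coleD(5)[OF hc]
  define U where "U j y t = 2 * ln (w j y (T - t))" for j y t
  define M where "M j y t = p j y t * w j y (T - t)" for j y t
  define u where "u = glue U (\<lambda>x. c T)"
  define m where "m = glue M m0"
  have rT: "T - t \<in> {0..T}" if "t \<in> {0..T}" for t using that by auto
  have rT': "T - t \<in> {0<..<T}" if "t \<in> {0<..<T}" for t using that by auto
  have u: "on_param u j y t = U j y t" if "j \<in> J" "y \<in> {0..len j}" "t \<in> {0..T}" for j y t
    unfolding u_def
  proof (rule on_param_glue[OF _ that(1,2)])
    fix v e e' assume "e \<in> ends_at v" "e' \<in> ends_at v"
    from heat_solD(2)[OF w this rT[OF that(3)]]
    show "U (fst e) (end_pos e) t = U (fst e') (end_pos e') t" by (simp add: U_def)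
  qed
  have m: "on_param m j y t = M j y t" if "j \<in> J" "y \<in> {0..len j}" "t \<in> {0..T}" for j y t
    unfolding m_def
  proof (rule on_param_glue[OF _ that(1,2)])
    fix v e e' assume e: "e \<in> ends_at v" "e' \<in> ends_at v"
    from heat_solD(2)[OF w e rT[OF that(3)]] heat_solD(2)[OF p e that(3)]
    show "M (fst e) (end_pos e) t = M (fst e') (end_pos e') t" by (simp add: M_def)
  qed
  define Uy Uyy Ut where "Uy j y t = 2 / w j y (T - t) * wy j y (T - t)"
    and "Uyy j y t = - 2 / (w j y (T - t))\<^sup>2 * (wy j y (T - t))\<^sup>2 + 2 / w j y (T - t) * wt j y (T - t)"
    and "Ut j y t = 2 / w j y (T - t) * - wt j y (T - t)" for j y t
  define My Myy Mt where "My j y t = py j y t * w j y (T - t) + p j y t * wy j y (T - t)"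
    and "Myy j y t = pt j y t * w j y (T - t) + 2 * py j y t * wy j y (T - t) + p j y t * wt j y (T - t)"
    and "Mt j y t = pt j y t * w j y (T - t) + p j y t * - wt j y (T - t)" for j y t
  have Uc: "C21 (len j) T (on_param u j) (Uy j) (Uyy j) (Ut j)" if j: "j \<in> J" for j
  proof (rule C21_cong[OF C21_ln[OF C21_reverse[OF heat_solD(1)[OF w j]], of 2]])
    show "w j y (T - t) > 0" if "y \<in> {0..len j}" "t \<in> {0..T}" for y t
      using w1[OF j that(1) rT[OF that(2)]] by linarith
  qed (use u[OF j] in \<open>auto simp: U_def Uy_def Uyy_def Ut_def\<close>)
  have Mc: "C21 (len j) T (on_param m j) (My j) (Myy j) (Mt j)" if j: "j \<in> J" for j
    by (rule C21_cong[OF C21_mult[OF heat_solD(1)[OF p j] C21_reverse[OF heat_solD(1)[OF w j]]]])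
      (use m[OF j] in \<open>auto simp: M_def My_def Myy_def Mt_def\<close>)
  have offu: "u x s = c T" if "x \<notin> (\<Union>j\<in>J. edge N j)" for x s
    unfolding u_def by (rule glue_off_edges[OF that])
  have offm: "m x s = m0 x" if "x \<notin> (\<Union>j\<in>J. edge N j)" for x s
    unfolding m_def by (rule glue_off_edges[OF that])
  have cu: "classical_regularity N T u"
    "\<And>j y t. j \<in> J \<Longrightarrow> y \<in> {0..len j} \<Longrightarrow> t \<in> {0<..<T} \<Longrightarrow> param_deriv 1 u j y t = Uy j y t"
    "\<And>j y t. j \<in> J \<Longrightarrow> y \<in> {0..len j} \<Longrightarrow> t \<in> {0<..<T} \<Longrightarrow> param_deriv 2 u j y t = Uyy j y t"
    "\<And>j y t. j \<in> J \<Longrightarrow> y \<in> {0..len j} \<Longrightarrow> t \<in> {0<..<T} \<Longrightarrow> time_deriv u j y t = Ut j y t"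
    by (rule classical_from_C21[of T u Uy Uyy Ut "\<lambda>x. c T"]; (erule Uc offu | assumption))+
  have cm: "classical_regularity N T m"
    "\<And>j y t. j \<in> J \<Longrightarrow> y \<in> {0..len j} \<Longrightarrow> t \<in> {0<..<T} \<Longrightarrow> param_deriv 1 m j y t = My j y t"
    "\<And>j y t. j \<in> J \<Longrightarrow> y \<in> {0..len j} \<Longrightarrow> t \<in> {0<..<T} \<Longrightarrow> param_deriv 2 m j y t = Myy j y t"
    "\<And>j y t. j \<in> J \<Longrightarrow> y \<in> {0..len j} \<Longrightarrow> t \<in> {0<..<T} \<Longrightarrow> time_deriv m j y t = Mt j y t"
    by (rule classical_from_C21[of T m My Myy Mt "m0"]; (erule Mc offm | assumption))+
  have exit: "vertex N i0 = \<pi> j0 0" "0 \<in> {0..len j0}" using start len_pos[OF j0] by auto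
  have points: "(\<exists>j y. j \<in> J \<and> y \<in> {0..len j} \<and> x = \<pi> j y) \<or> x \<notin> (\<Union>j\<in>J. edge N j)" for x
    unfolding edge_def by blast
  have "HJB_solution N i0 T c u"
    unfolding HJB_solution_def
  proof (intro conjI ballI)
    show "classical_regularity N T u" by (rule cu(1))
    fix j x s assume j: "j \<in> J" and "x \<in> open_edge N j" and s: "s \<in> {0<..<T}"
    then obtain y where "y \<in> {0<..<len j}" "x = \<pi> j y" unfolding open_edge_def by blast
    then have y: "y \<in> {0..len j}" "x = \<pi> j y" by auto
    have wp: "w j y (T - s) \<noteq> 0" using w1[OF j y(1), of "T - s"] s by auto
    have "time_deriv u j y s + param_deriv 2 u j y s + 1/2 * \<bar>param_deriv 1 u j y s\<bar>\<^sup>2 = 0"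
      unfolding cu(2-4)[OF j y(1) s] power2_abs Uy_def Uyy_def Ut_def using wp
      by (simp add: power2_eq_square)
    then show "deriv (u x) s + edge_deriv N j 2 (\<lambda>x. u x s) x + 1/2 * \<bar>edge_deriv N j 1 (\<lambda>x. u x s) x\<bar>\<^sup>2 = 0"
      by (simp only: y time_deriv_def param_deriv_def)
  next
    fix i s assume i: "i \<in> transition_idx N" and s: "s \<in> {0<..<T}"
    have "(\<Sum>e\<in>ends_at v. end_sign e * Uy (fst e) (end_pos e) s) = 0" if v: "v \<noteq> vertex N i0" for v
    proof (cases "ends_at v = {}")
      case False
      then obtain e0 where e0: "e0 \<in> ends_at v" by blast
      have "(\<Sum>e\<in>ends_at v. end_sign e * Uy (fst e) (end_pos e) s) =
         (\<Sum>e\<in>ends_at v. 2 / w (fst e0) (end_pos e0) (T - s) * (end_sign e * wy (fst e) (end_pos e) (T - s)))"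
        using heat_solD(2)[OF w _ e0, of _ "T - s"] s by (intro sum.cong refl) (simp add: Uy_def)
      then show ?thesis using heat_solD(3)[OF w v rT'[OF s]] by (simp only: sum_distrib_left[symmetric] mult_zero_right)
    qed simp
    then show "(\<Sum>j\<in>Inc N i. inc_coeff N i j * edge_deriv N j 1 (\<lambda>x. u x s) (vertex N i)) = 0"
      using kirchhoff_iff[of "\<lambda>j. edge_deriv N j 1 (\<lambda>x. u x s)" "\<lambda>j y. Uy j y s"] cu(2)[OF _ _ s] i
      by (simp add: param_deriv_def)
  next
    fix x assume "x \<in> net_points N"
    show "u x T = c T"
      using points[of x]
    proof
      assume "\<exists>j y. j \<in> J \<and> y \<in> {0..len j} \<and> x = \<pi> j y"
      then obtain j y where j: "j \<in> J" "y \<in> {0..len j}" "x = \<pi> j y" by blast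
      have "u x T = U j y T" using u[OF j(1,2), of T] T j(3) by (simp add: on_param_def)
      also have "\<dots> = c T" using w0[OF j(1,2)] by (simp add: U_def)
      finally show ?thesis .
    qed (rule offu)
  next
    fix s assume s: "s \<in> {0..T}"
    have "u (vertex N i0) s = U j0 0 s" using u[OF j0 exit(2) s] exit(1) by (simp add: on_param_def)
    also have "\<dots> = c s" using wb[OF rT[OF s]] by (simp add: U_def)
    finally show "u (vertex N i0) s = c s" .
  qed
  moreover have "FP_solution N i0 T m0 u m"
    unfolding FP_solution_def
  proof (intro conjI ballI)
    show "classical_regularity N T m" by (rule cm(1))
    fix j x s assume j: "j \<in> J" and "x \<in> open_edge N j" and s: "s \<in> {0<..<T}"
    then obtain y where "y \<in> {0<..<len j}" "x = \<pi> j y" unfolding open_edge_def by blast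
    then have y: "y \<in> {0..len j}" "x = \<pi> j y" by auto
    have wp: "w j y (T - s) \<noteq> 0" using w1[OF j y(1), of "T - s"] s by auto
    have Uc': "C21 (len j) T (on_param u j) (param_deriv 1 u j) (Uyy j) (Ut j)"
      by (rule C21_cong[OF Uc[OF j]]) (use cu(2)[OF j] in auto)
    have mM: "on_param m j y s = M j y s" using m[OF j y(1)] s by simp
    have "time_deriv m j y s - param_deriv 2 m j y s + (Uyy j y s * on_param m j y s + param_deriv 1 u j y s * My j y s) = 0"
      unfolding cu(2)[OF j y(1) s] cm(3,4)[OF j y(1) s] mM Uy_def Uyy_def My_def Myy_def Mt_def M_def using wp
      by (simp add: field_simps power2_eq_square)
    then show "deriv (m x) s - edge_deriv N j 2 (\<lambda>x. m x s) x + edge_deriv N j 1 (\<lambda>x. edge_deriv N j 1 (\<lambda>x. u x s) x * m x s) x = 0"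
      unfolding y(2) drift_deriv[OF Uc' Mc[OF j] j y(1) s] by (simp only: time_deriv_def param_deriv_def)
  next
    fix i s assume i: "i \<in> transition_idx N" and s: "s \<in> {0<..<T}"
    have "(\<Sum>e\<in>ends_at v. end_sign e * (My (fst e) (end_pos e) s - M (fst e) (end_pos e) s * Uy (fst e) (end_pos e) s)) = 0"
      if v: "v \<noteq> vertex N i0" for v
    proof (cases "ends_at v = {}")
      case False
      then obtain e0 where e0: "e0 \<in> ends_at v" by blast
      let ?W = "w (fst e0) (end_pos e0) (T - s)" and ?P = "p (fst e0) (end_pos e0) s"
      have "(\<Sum>e\<in>ends_at v. end_sign e * (My (fst e) (end_pos e) s - M (fst e) (end_pos e) s * Uy (fst e) (end_pos e) s)) =
         (\<Sum>e\<in>ends_at v. ?W * (end_sign e * py (fst e) (end_pos e) s) + (- ?P) * (end_sign e * wy (fst e) (end_pos e) (T - s)))"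
      proof (rule sum.cong[OF refl])
        fix e assume e: "e \<in> ends_at v"
        have eq: "w (fst e) (end_pos e) (T - s) = ?W" "p (fst e) (end_pos e) s = ?P"
          using heat_solD(2)[OF w e e0, of "T - s"] heat_solD(2)[OF p e e0, of s] s by auto
        have "?W \<noteq> 0" using w1[OF ends_atD(1)[OF e0] end_pos_in[OF ends_atD(1)[OF e0]], of "T - s"] s by auto
        then show "end_sign e * (My (fst e) (end_pos e) s - M (fst e) (end_pos e) s * Uy (fst e) (end_pos e) s) =
          ?W * (end_sign e * py (fst e) (end_pos e) s) + (- ?P) * (end_sign e * wy (fst e) (end_pos e) (T - s))"
          unfolding My_def M_def Uy_def eq by (simp add: algebra_simps)
      qed
      also have "\<dots> = 0"
        using heat_solD(3)[OF w v rT'[OF s]] heat_solD(3)[OF p v s]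
        by (simp only: sum.distrib sum_distrib_left[symmetric] mult_zero_right add_0)
      finally show ?thesis .
    qed simp
    moreover have "edge_deriv N j 1 (\<lambda>x. m x s) (\<pi> j y) - m (\<pi> j y) s * edge_deriv N j 1 (\<lambda>x. u x s) (\<pi> j y) = My j y s - M j y s * Uy j y s"
      if "j \<in> J" "y \<in> {0..len j}" for j y
      using cu(2)[OF that s] cm(2)[OF that s] m[OF that, of s] s by (simp add: param_deriv_def on_param_def)
    ultimately show "(\<Sum>j\<in>Inc N i. inc_coeff N i j * (edge_deriv N j 1 (\<lambda>x. m x s) (vertex N i) - m (vertex N i) s * edge_deriv N j 1 (\<lambda>x. u x s) (vertex N i))) = 0"
      using kirchhoff_iff[of "\<lambda>j x. edge_deriv N j 1 (\<lambda>x. m x s) x - m x s * edge_deriv N j 1 (\<lambda>x. u x s) x" "\<lambda>j y. My j y s - M j y s * Uy j y s"] i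
      by blast
  next
    fix x assume "x \<in> net_points N"
    show "m x 0 = m0 x"
      using points[of x]
    proof
      assume "\<exists>j y. j \<in> J \<and> y \<in> {0..len j} \<and> x = \<pi> j y"
      then obtain j y where j: "j \<in> J" "y \<in> {0..len j}" "x = \<pi> j y" by blast
      have "m x 0 = M j y 0" using m[OF j(1,2), of 0] T j(3) by (simp add: on_param_def)
      also have "\<dots> = m0 x" using p0[OF j(1,2)] w1[OF j(1,2), of T] T j(3) by (simp add: M_def)
      finally show ?thesis .
    qed (rule offm)
  next
    fix s assume s: "s \<in> {0..T}"
    have "m (vertex N i0) s = M j0 0 s" using m[OF j0 exit(2) s] exit(1) by (simp add: on_param_def)
    also have "\<dots> = 0" using pb[OF s] by (simp add: M_def)
    finally show "m (vertex N i0) s = 0" .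
  qed
  ultimately show ?thesis unfolding MFG_solution_def by blast
qed

text \<open>
  The substitution maps any solution to heat solutions with the data of \<open>w\<close> and \<open>p\<close>, and these are
  unique.
\<close>

lemma MFG_unique:
  assumes T: "T > 0" and hc: "hopf_cole T c m0 w p" and um: "MFG_solution N i0 T c m0 u m"
    and j: "j \<in> J" and y: "y \<in> {0..len j}" and t: "t \<in> {0..T}"
  shows "on_param m j y t = p j y t * w j y (T - t)"
proof -
  obtain wy wt py pt where w: "heat_sol T w wy wt" and p: "heat_sol T p py pt" using hc unfolding hopf_cole_def by blast
  note w0 = hopf_coleD(2)[OF hc] and wb = hopf_coleD(3)[OF hc]
    and p0 = hopf_coleD(4)[OF hc] and pb = hopf_coleD(5)[OF hc]
  have u: "HJB_solution N i0 T c u" and m: "FP_solution N i0 T m0 u m" using um unfolding MFG_solution_def by auto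
  have exit: "vertex N i0 = \<pi> j0 0" "0 \<in> {0..len j0}" using start len_pos[OF j0] by auto
  have uT: "on_param u j y T = c T" if "j \<in> J" "y \<in> {0..len j}" for j y
    using u net_pointI[OF that] by (simp add: HJB_solution_def on_param_def)
  have ub: "on_param u j0 0 t = c t" if "t \<in> {0..T}" for t
    using u that exit by (simp add: HJB_solution_def on_param_def)
  have mT: "on_param m j y 0 = m0 (\<pi> j y)" if "j \<in> J" "y \<in> {0..len j}" for j y
    using m net_pointI[OF that] by (simp add: FP_solution_def on_param_def)
  have mb: "on_param m j0 0 t = 0" if "t \<in> {0..T}" for t
    using m that exit by (simp add: FP_solution_def on_param_def)
  have v0: "fst e = j0" "end_pos e = 0" if "e \<in> ends_at (vertex N i0)" for e
    using that by (auto simp: ends_at_exit end_pos_def)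
  have eq_w: "exp (1/2 * on_param u j y (T - t)) = w j y t" if "j \<in> J" "y \<in> {0..len j}" "t \<in> {0..T}" for j y t
  proof -
    have "\<bar>exp (1/2 * on_param u j y (T - t)) - w j y t\<bar> \<le> 0"
    proof (rule heat_sol_compare[OF HJB_heat_sol[OF u] w T _ _ that])
      show "\<bar>exp (1/2 * on_param u j y (T - 0)) - w j y 0\<bar> \<le> 0" if "j \<in> J" "y \<in> {0..len j}" for j y
        using uT[OF that] w0[OF that] by simp
      show "\<bar>exp (1/2 * on_param u (fst e) (end_pos e) (T - t)) - w (fst e) (end_pos e) t\<bar> \<le> 0"
        if "e \<in> ends_at (vertex N i0)" "t \<in> {0..T}" for e t
        using ub[of "T - t"] wb[OF that(2)] that(2) unfolding v0[OF that(1)] by simp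
    qed
    then show ?thesis by simp
  qed
  obtain qy qt where q: "heat_sol T (\<lambda>j y t. on_param m j y t * exp (-1/2 * on_param u j y t)) qy qt"
    using FP_heat_sol[OF u m] .
  have "\<bar>on_param m j y t * exp (-1/2 * on_param u j y t) - p j y t\<bar> \<le> 0"
  proof (rule heat_sol_compare[OF q p T _ _ j y t])
    show "\<bar>on_param m j y 0 * exp (-1/2 * on_param u j y 0) - p j y 0\<bar> \<le> 0" if "j \<in> J" "y \<in> {0..len j}" for j y
    proof -
      have W: "w j y T = exp (1/2 * on_param u j y 0)" using eq_w[OF that, of T] T by simp
      have e: "exp (-1/2 * on_param u j y 0) = inverse (exp (1/2 * on_param u j y 0))"
      proof -
        have "-1/2 * X = - (1/2 * X)" for X :: real by simp
        from this[of "on_param u j y 0"] show ?thesis using exp_minus[of "1/2 * on_param u j y 0"] by argo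
      qed
      have "\<bar>a * inverse E - a / E\<bar> \<le> 0" for a E :: real by (simp add: divide_inverse)
      then show ?thesis unfolding mT[OF that] p0[OF that] W e .
    qed
    show "\<bar>on_param m (fst e) (end_pos e) t * exp (-1/2 * on_param u (fst e) (end_pos e) t) - p (fst e) (end_pos e) t\<bar> \<le> 0"
      if "e \<in> ends_at (vertex N i0)" "t \<in> {0..T}" for e t
      using mb[OF that(2)] pb[OF that(2)] unfolding v0[OF that(1)] by simp
  qed
  then have "on_param m j y t * exp (-1/2 * on_param u j y t) = p j y t" by simp
  then have "p j y t * exp (1/2 * on_param u j y t) = on_param m j y t * (exp (-1/2 * on_param u j y t) * exp (1/2 * on_param u j y t))"
    by simp
  also have "exp (-1/2 * on_param u j y t) * exp (1/2 * on_param u j y t) = 1" unfolding exp_add[symmetric] by simp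
  finally show ?thesis using eq_w[OF j y, of "T - t"] t by simp
qed

end

section \<open>Smooth costs\<close>

text \<open>
  Three continuous derivatives are what the construction of solutions with given boundary values asks
  of the cost.
\<close>

definition smooth3 :: "(real \<Rightarrow> real) \<Rightarrow> bool" where
  "smooth3 f \<longleftrightarrow> (\<exists>f1 f2 f3. (\<forall>x. (f has_real_derivative f1 x) (at x)) \<and>
     (\<forall>x. (f1 has_real_derivative f2 x) (at x)) \<and> (\<forall>x. (f2 has_real_derivative f3 x) (at x)) \<and>
     continuous_on UNIV f3)"

lemma smooth3I:
  assumes "\<And>x. (f has_real_derivative f1 x) (at x)" "\<And>x. (f1 has_real_derivative f2 x) (at x)"
    "\<And>x. (f2 has_real_derivative f3 x) (at x)" "continuous_on UNIV f3"
  shows "smooth3 f"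
  using assms unfolding smooth3_def by blast

lemma smooth3E:
  assumes "smooth3 f"
  obtains f1 f2 f3 where "\<And>x. (f has_real_derivative f1 x) (at x)" "\<And>x. (f1 has_real_derivative f2 x) (at x)"
    "\<And>x. (f2 has_real_derivative f3 x) (at x)" "continuous_on UNIV f3"
  using assms unfolding smooth3_def by blast

lemma smooth_on_imp_smooth3:
  assumes "smooth_on UNIV f" shows "smooth3 f"
proof -
  have d: "(deriv_within UNIV k f has_real_derivative deriv_within UNIV (Suc k) f x) (at x)" for k x
    using has_real_derivative_deriv_within[of UNIV k f x] assms by (auto simp: smooth_on_def)
  have "continuous_on UNIV (deriv_within UNIV 3 f)"
    by (rule DERIV_continuous_on[OF d])
  then show ?thesis
    using d[of 0] d[of 1] d[of 2] by (intro smooth3I[of f "deriv_within UNIV 1 f" "deriv_within UNIV 2 f" "deriv_within UNIV 3 f"])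
      (simp_all add: numeral_2_eq_2 numeral_3_eq_3)
qed

lemma smooth3_affine:
  assumes "smooth3 f" shows "smooth3 (\<lambda>x. f (a * x + b))"
proof -
  obtain f1 f2 f3 where f: "\<And>x. (f has_real_derivative f1 x) (at x)" "\<And>x. (f1 has_real_derivative f2 x) (at x)"
    "\<And>x. (f2 has_real_derivative f3 x) (at x)" "continuous_on UNIV f3" using smooth3E[OF assms] by blast
  have c: "((\<lambda>x. g (a * x + b)) has_real_derivative g' (a * x + b) * a) (at x)"
    if "\<And>x. (g has_real_derivative g' x) (at x)" for g g' x
    by (rule DERIV_chain2[of g], rule that) (auto intro!: derivative_eq_intros)
  show ?thesis
  proof (rule smooth3I)
    show "((\<lambda>x. f (a * x + b)) has_real_derivative f1 (a * x + b) * a) (at x)" for x by (rule c[OF f(1)])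
    show "((\<lambda>x. f1 (a * x + b) * a) has_real_derivative (f2 (a * x + b) * a) * a) (at x)" for x
      by (rule DERIV_cmult_right[OF c[OF f(2)]])
    show "((\<lambda>x. (f2 (a * x + b) * a) * a) has_real_derivative ((f3 (a * x + b) * a) * a) * a) (at x)" for x
      by (intro DERIV_cmult_right c[OF f(3)])
    show "continuous_on UNIV (\<lambda>x. ((f3 (a * x + b) * a) * a) * a)"
      by (intro continuous_intros continuous_on_compose2[OF f(4)]) auto
  qed
qed

lemma smooth3_add:
  assumes "smooth3 f" "smooth3 g" shows "smooth3 (\<lambda>x. f x + g x)"
proof -
  obtain f1 f2 f3 where f: "\<And>x. (f has_real_derivative f1 x) (at x)" "\<And>x. (f1 has_real_derivative f2 x) (at x)"
    "\<And>x. (f2 has_real_derivative f3 x) (at x)" "continuous_on UNIV f3" using smooth3E[OF assms(1)] by blast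
  obtain g1 g2 g3 where g: "\<And>x. (g has_real_derivative g1 x) (at x)" "\<And>x. (g1 has_real_derivative g2 x) (at x)"
    "\<And>x. (g2 has_real_derivative g3 x) (at x)" "continuous_on UNIV g3" using smooth3E[OF assms(2)] by blast
  show ?thesis
    by (rule smooth3I[OF DERIV_add[OF f(1) g(1)] DERIV_add[OF f(2) g(2)] DERIV_add[OF f(3) g(3)] continuous_on_add[OF f(4) g(4)]])
qed

lemma smooth3_exp:
  assumes "smooth3 f" shows "smooth3 (\<lambda>x. exp (c * f x))"
proof -
  obtain f1 f2 f3 where f: "\<And>x. (f has_real_derivative f1 x) (at x)" "\<And>x. (f1 has_real_derivative f2 x) (at x)"
    "\<And>x. (f2 has_real_derivative f3 x) (at x)" "continuous_on UNIV f3" using smooth3E[OF assms] by blast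
  have e: "((\<lambda>x. exp (c * f x)) has_real_derivative exp (c * f x) * (c * f1 x)) (at x)" for x
    by (rule DERIV_chain2[OF DERIV_exp DERIV_cmult[OF f(1)]])
  have cf: "continuous_on UNIV f" "continuous_on UNIV f1" "continuous_on UNIV f2"
    using f(1-3) by (blast intro: DERIV_continuous_on)+
  show ?thesis
  proof (rule smooth3I[OF e])
    show "((\<lambda>x. exp (c * f x) * (c * f1 x)) has_real_derivative exp (c * f x) * (c * f1 x) * (c * f1 x) + c * f2 x * exp (c * f x)) (at x)" for x
      by (rule DERIV_mult[OF e DERIV_cmult[OF f(2)]])
    show "((\<lambda>x. exp (c * f x) * (c * f1 x) * (c * f1 x) + c * f2 x * exp (c * f x)) has_real_derivative
        ((exp (c * f x) * (c * f1 x) * (c * f1 x) + c * f2 x * exp (c * f x)) * (c * f1 x) + c * f2 x * (exp (c * f x) * (c * f1 x)))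
        + (c * f3 x * exp (c * f x) + exp (c * f x) * (c * f1 x) * (c * f2 x))) (at x)" for x
      by (intro DERIV_add DERIV_mult e DERIV_cmult f)
    show "continuous_on UNIV (\<lambda>x. ((exp (c * f x) * (c * f1 x) * (c * f1 x) + c * f2 x * exp (c * f x)) * (c * f1 x) + c * f2 x * (exp (c * f x) * (c * f1 x)))
        + (c * f3 x * exp (c * f x) + exp (c * f x) * (c * f1 x) * (c * f2 x)))"
      by (intro continuous_intros cf f(4))
  qed
qed

section \<open>Coherent meeting times\<close>

context exit_network
begin

text \<open>
  The integrand is defined by a derivative that is controlled at positive times only. Since the mass is
  continuous on the closed interval and differentiable inside, the fundamental theorem of calculus
  still applies, and it yields integrability as well.
\<close>

lemma arrival_cdf_eq_mass_loss:
  assumes T: "T > 0" and hc: "hopf_cole T c m0 w p" and um: "MFG_solution N i0 T c m0 u m" and s: "s \<in> {0..T}"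
  shows "arrival_cdf N i0 j0 m s = mass T p w 0 - mass T p w s"
proof -
  obtain wy wt py pt where w: "heat_sol T w wy wt" and p: "heat_sol T p py pt" using hc unfolding hopf_cole_def by blast
  note pb = hopf_coleD(5)[OF hc]
  have exit: "vertex N i0 = \<pi> j0 0" "0 \<in> {0..len j0}" using start len_pos[OF j0] by auto
  have "C21 (len j0) T (on_param m j0) (\<lambda>y t. py j0 y t * w j0 y (T - t) + p j0 y t * wy j0 y (T - t))
      (\<lambda>y t. pt j0 y t * w j0 y (T - t) + 2 * py j0 y t * wy j0 y (T - t) + p j0 y t * wt j0 y (T - t))
      (\<lambda>y t. pt j0 y t * w j0 y (T - t) + p j0 y t * - wt j0 y (T - t))"
    by (rule C21_cong[OF C21_mult[OF heat_solD(1)[OF p j0] C21_reverse[OF heat_solD(1)[OF w j0]]]])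
      (use MFG_unique[OF T hc um j0] in auto)
  note d = deriv_within_C21(1)[OF len_pos[OF j0] this exit(2)]
  have flux: "edge_deriv N j0 1 (\<lambda>x. m x r) (vertex N i0) = py j0 0 r * w j0 0 (T - r)" if r: "r \<in> {0<..<T}" for r
    unfolding exit(1) edge_deriv_param[OF j0 exit(2)] using d[OF r] pb[of r] r by (simp add: on_param_def)
  have "((\<lambda>r. edge_deriv N j0 1 (\<lambda>x. m x r) (vertex N i0)) has_integral (- mass T p w s - - mass T p w 0)) {0..s}"
  proof (rule fundamental_theorem_of_calculus_interior)
    show "continuous_on {0..s} (\<lambda>s. - mass T p w s)"
      by (intro continuous_on_minus continuous_on_subset[OF mass_cont[OF T p w]]) (use s in auto)
    fix r assume "r \<in> {0<..<s}"
    then have r: "r \<in> {0<..<T}" using s by auto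
    have "(mass T p w has_real_derivative - (py j0 0 r * w j0 0 (T - r))) (at r)"
      using mass_deriv[OF p w r] pb[of r] r by (simp add: ends_at_exit end_pos_def end_sign_def)
    from DERIV_minus[OF this]
    show "((\<lambda>s. - mass T p w s) has_vector_derivative edge_deriv N j0 1 (\<lambda>x. m x r) (vertex N i0)) (at r)"
      unfolding flux[OF r] by (simp add: has_real_derivative_iff_has_vector_derivative)
  qed (use s in auto)
  then show ?thesis unfolding arrival_cdf_def by (simp add: integral_unique)
qed

text \<open>
  The representation of \<open>p\<close> on the exit edge as a heat flow on the line is what gives access to the
  analyticity of the flux.
\<close>

definition exit_pair :: "real \<Rightarrow> (real \<Rightarrow> real) \<Rightarrow> (real ^ 'n \<Rightarrow> real) \<Rightarrow>
    ('j \<Rightarrow> real \<Rightarrow> real \<Rightarrow> real) \<Rightarrow> ('j \<Rightarrow> real \<Rightarrow> real \<Rightarrow> real) \<Rightarrow> bool" where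
  "exit_pair T c m0 w p \<longleftrightarrow> hopf_cole T c m0 w p \<and>
     (\<forall>j\<in>J. \<forall>y\<in>{0..len j}. \<forall>t\<in>{0..T}. p j y t \<ge> 0) \<and>
     (\<exists>X. continuous_on UNIV X \<and> exp_growth X \<and> (\<forall>y t. p j0 y t = heat_flow X y t))"

lemma exit_pair_exists:
  assumes T: "T > 0" and c: "smooth3 c" and c0: "\<And>s. s \<in> {0..T} \<Longrightarrow> c s \<ge> 0"
    and m0: "continuous_on (net_points N) m0" "m0 (vertex N i0) = 0" "\<And>x. x \<in> net_points N \<Longrightarrow> m0 x \<ge> 0"
  shows "\<exists>w p. exit_pair T c m0 w p"
proof -
  define g where "g t = exp (1/2 * c (-1 * t + T))" for t
  have "smooth3 g" unfolding g_def by (intro smooth3_exp smooth3_affine c)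
  then obtain g1 g2 g3 where g: "\<And>x. (g has_real_derivative g1 x) (at x)" "\<And>x. (g1 has_real_derivative g2 x) (at x)"
    "\<And>x. (g2 has_real_derivative g3 x) (at x)" "continuous_on UNIV g3" using smooth3E by blast
  obtain w wy wt where w: "heat_sol T w wy wt"
    and w0: "\<And>j y. j \<in> J \<Longrightarrow> y \<in> {0..len j} \<Longrightarrow> w j y 0 = g 0"
    and wb: "\<And>e t. e \<in> ends_at (vertex N i0) \<Longrightarrow> t \<in> {0..T} \<Longrightarrow> w (fst e) (end_pos e) t = g t"
    using heat_sol_with_boundary_data[OF T g] by blast
  have g1: "g t \<ge> 1" if "t \<in> {0..T}" for t using c0[of "T - t"] that by (simp add: g_def)
  have w1: "w j y t \<ge> 1" if "j \<in> J" "y \<in> {0..len j}" "t \<in> {0..T}" for j y t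
  proof -
    have "- w j y t \<le> -1"
      by (rule max_principle[OF heat_sol_uminus[OF w] T _ _ that]) (use w0 wb g1 T in auto)
    then show ?thesis by simp
  qed
  define f0 where "f0 j y = m0 (\<pi> j y) / w j y T" for j y
  have TT: "T \<in> {0..T}" using T by simp
  have "compatible (\<lambda>z. 0) f0"
    unfolding compatible_def
  proof (intro conjI ballI allI)
    fix j assume j: "j \<in> J"
    have "continuous_on {0..len j} (\<lambda>y. m0 (\<pi> j y))"
      by (rule continuous_on_compose2[OF m0(1) param_cont[OF j]]) (use net_pointI[OF j] in auto)
    moreover have "continuous_on {0..len j} (\<lambda>y. w j y T)"
      by (rule continuous_on_compose2[OF C21D(1)[OF heat_solD(1)[OF w j]], of _ "\<lambda>y. (y, T)", simplified])
        (use T in \<open>auto intro!: continuous_intros\<close>)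
    moreover have "w j y T \<noteq> 0" if "y \<in> {0..len j}" for y using w1[OF j that TT] by auto
    ultimately show "continuous_on {0..len j} (f0 j)"
      unfolding f0_def by (intro continuous_on_divide) auto
  next
    fix v e e' assume e: "e \<in> ends_at v" "e' \<in> ends_at v"
    have "\<pi> (fst e) (end_pos e) = \<pi> (fst e') (end_pos e')"
      using ends_atD(2)[OF e(1)] ends_atD(2)[OF e(2)] by (simp add: end_vx)
    then show "f0 (fst e) (end_pos e) = f0 (fst e') (end_pos e')"
      using heat_solD(2)[OF w e TT] by (simp add: f0_def)
  next
    fix e assume "e \<in> ends_at (vertex N i0)"
    then show "f0 (fst e) (end_pos e) = 0"
      using start m0(2) by (simp add: ends_at_exit end_pos_def f0_def)
  qed
  then obtain X where X: "\<And>j. j \<in> J \<Longrightarrow> continuous_on UNIV (X j)" "\<And>j. j \<in> J \<Longrightarrow> exp_growth (X j)"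
    and p: "\<And>T. heat_sol T (\<lambda>j. heat_flow (X j)) (\<lambda>j. heat_flow_y (X j)) (\<lambda>j. heat_flow_yy (X j))"
    and p0: "\<And>j y. j \<in> J \<Longrightarrow> y \<in> {0..len j} \<Longrightarrow> heat_flow (X j) y 0 = f0 j y"
    and pb: "\<And>e t. e \<in> ends_at (vertex N i0) \<Longrightarrow> heat_flow (X (fst e)) (end_pos e) t = heat_flow (\<lambda>z. 0) 0 t"
    by (rule heat_sol_exists) (auto simp: exp_growth_def intro!: continuous_intros exI[of _ 0])
  have zero: "heat_flow (\<lambda>z. 0) 0 t = 0" for t by (rule heat_flow_odd) simp
  have exit: "(j0, False) \<in> ends_at (vertex N i0)" "end_pos (j0, False) = 0" by (auto simp: ends_at_exit end_pos_def)
  have pb0: "heat_flow (X j0) 0 t = 0" for t using pb[OF exit(1), of t] zero exit(2) by simp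
  have f0pos: "f0 j y \<ge> 0" if "j \<in> J" "y \<in> {0..len j}" for j y
    using m0(3)[OF net_pointI[OF that]] w1[OF that TT] by (simp add: f0_def)
  have ppos: "heat_flow (X j) y t \<ge> 0" if "j \<in> J" "y \<in> {0..len j}" "t \<in> {0..T}" for j y t
  proof -
    have "- heat_flow (X j) y t \<le> 0"
      by (rule max_principle[OF heat_sol_uminus[OF p] T _ _ that]) (use p0 f0pos pb zero in auto)
    then show ?thesis by simp
  qed
  have "hopf_cole T c m0 w (\<lambda>j. heat_flow (X j))"
    unfolding hopf_cole_def
  proof (intro conjI ballI)
    show "w j y 0 = exp (1/2 * c T)" if "j \<in> J" "y \<in> {0..len j}" for j y using w0[OF that] by (simp add: g_def)
    show "w j0 0 t = exp (1/2 * c (T - t))" if "t \<in> {0..T}" for t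
      using wb[OF exit(1) that] exit(2) by (simp add: g_def)
  qed (use w p w1 p0 pb0 in \<open>auto simp: f0_def\<close>)
  then show ?thesis
    unfolding exit_pair_def using X[OF j0] ppos by blast
qed

definition arrivals :: "real \<Rightarrow> ('j \<Rightarrow> real \<Rightarrow> real \<Rightarrow> real) \<Rightarrow> ('j \<Rightarrow> real \<Rightarrow> real \<Rightarrow> real) \<Rightarrow> real \<Rightarrow> real" where
  "arrivals T w p s = mass T p w 0 - mass T p w s"

lemma arrivals_deriv:
  assumes T: "T > 0" and cd: "exit_pair T c m0 w p"
  obtains X where "continuous_on UNIV X" "exp_growth X" "continuous_on {0..T} (arrivals T w p)"
    "\<And>s. s \<in> {0<..<T} \<Longrightarrow> (arrivals T w p has_real_derivative heat_flow_y X 0 s * w j0 0 (T - s)) (at s)"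
    "\<And>s. s \<in> {0<..<T} \<Longrightarrow> heat_flow_y X 0 s \<ge> 0" "\<And>s. s \<in> {0<..<T} \<Longrightarrow> w j0 0 (T - s) > 0"
proof -
  from cd obtain wy wt py pt X where w: "heat_sol T w wy wt" and p: "heat_sol T p py pt"
    and X: "continuous_on UNIV X" "exp_growth X" and pX: "\<And>y t. p j0 y t = heat_flow X y t"
    unfolding exit_pair_def hopf_cole_def by blast
  have pb: "p j0 0 t = 0" if "t \<in> {0..T}" for t using cd that unfolding exit_pair_def hopf_cole_def by blast
  have ppos: "p j0 y t \<ge> 0" if "y \<in> {0..len j0}" "t \<in> {0..T}" for y t
    using cd that j0 unfolding exit_pair_def by blast
  have exit: "0 \<in> {0..len j0}" using len_pos[OF j0] by auto
  have w1: "w j0 0 t \<ge> 1" if "t \<in> {0..T}" for t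
    using cd that j0 exit unfolding exit_pair_def hopf_cole_def by blast
  have py: "py j0 0 s = heat_flow_y X 0 s" if s: "s \<in> {0<..<T}" for s
  proof -
    have "((\<lambda>y. heat_flow X y s) has_real_derivative py j0 0 s) (at 0 within {0..len j0})"
      using C21D(2)[OF heat_solD(1)[OF p j0] exit s] by (simp add: pX)
    from vector_derivative_Icc[OF len_pos[OF j0] exit this]
      vector_derivative_Icc[OF len_pos[OF j0] exit has_field_derivative_at_within[OF heat_flow_derivs(1)[OF X]], of s] s
    show ?thesis by simp
  qed
  show ?thesis
  proof (rule that[OF X])
    show "continuous_on {0..T} (arrivals T w p)"
      unfolding arrivals_def by (intro continuous_intros mass_cont[OF T p w])
    fix s assume s: "s \<in> {0<..<T}"
    then have s': "s \<in> {0..T}" "T - s \<in> {0..T}" by auto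
    show "w j0 0 (T - s) > 0" using w1[OF s'(2)] by simp
    have "(mass T p w has_real_derivative - (py j0 0 s * w j0 0 (T - s))) (at s)"
      using mass_deriv[OF p w s] pb[OF s'(1)] by (simp add: ends_at_exit end_pos_def end_sign_def)
    from DERIV_diff[OF DERIV_const this]
    show "(arrivals T w p has_real_derivative heat_flow_y X 0 s * w j0 0 (T - s)) (at s)"
      unfolding arrivals_def[abs_def] py[OF s] by simp
    have "end_sign (j0, False) * - heat_flow_y X 0 s \<le> 0"
    proof (rule end_deriv_nonpos_at_max[where f = "\<lambda>y. - heat_flow X y s"])
      show "((\<lambda>y. - heat_flow X y s) has_real_derivative - heat_flow_y X 0 s) (at (end_pos (j0, False)) within {0..len (fst (j0, False))})"
        unfolding end_pos_def snd_conv if_False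
        by (rule DERIV_minus, rule has_field_derivative_at_within, rule heat_flow_derivs(1)[OF X]) (use s in simp)
      show "- heat_flow X z s \<le> - heat_flow X (end_pos (j0, False)) s" if "z \<in> {0..len (fst (j0, False))}" for z
        using ppos[of z s] pb[OF s'(1)] that s' by (simp add: pX end_pos_def)
    qed (simp add: j0)
    then show "heat_flow_y X 0 s \<ge> 0" by (simp add: end_sign_def)
  qed
qed

lemma arrivals_0: "arrivals T w p 0 = 0"
  by (simp add: arrivals_def)

lemma arrivals_mono:
  assumes T: "T > 0" and cd: "exit_pair T c m0 w p" and rs: "0 \<le> r" "r \<le> s" "s \<le> T"
  shows "arrivals T w p r \<le> arrivals T w p s"
proof (cases "r = s")
  case False
  obtain X where X: "continuous_on UNIV X" "exp_growth X" and c: "continuous_on {0..T} (arrivals T w p)"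
    and d: "\<And>s. s \<in> {0<..<T} \<Longrightarrow> (arrivals T w p has_real_derivative heat_flow_y X 0 s * w j0 0 (T - s)) (at s)"
    and n: "\<And>s. s \<in> {0<..<T} \<Longrightarrow> heat_flow_y X 0 s \<ge> 0" "\<And>s. s \<in> {0<..<T} \<Longrightarrow> w j0 0 (T - s) > 0"
    by (rule arrivals_deriv[OF T cd]) (rule that; assumption)
  have "\<exists>l z. r < z \<and> z < s \<and> (arrivals T w p has_real_derivative l) (at z) \<and> arrivals T w p s - arrivals T w p r = (s - r) * l"
  proof (rule MVT)
    show "continuous_on {r..s} (arrivals T w p)" using rs by (intro continuous_on_subset[OF c]) auto
    show "arrivals T w p differentiable at x" if "r < x" "x < s" for x
      using that rs by (intro has_real_derivative_imp_differentiable[OF d]) auto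
  qed (use False rs in auto)
  then obtain l z where z: "r < z" "z < s" "(arrivals T w p has_real_derivative l) (at z)"
    "arrivals T w p s - arrivals T w p r = (s - r) * l" by blast
  have zT: "z \<in> {0<..<T}" using z rs by auto
  have "l \<ge> 0" using DERIV_unique[OF z(3) d[OF zT]] n(1)[OF zT] n(2)[OF zT] by simp
  then have "(s - r) * l \<ge> 0" using rs by simp
  then show ?thesis using z(4) by linarith
qed simp

text \<open>
  Where the distribution is constant the flux is zero; by analyticity it is then zero at all times, and
  nobody ever arrives.
\<close>

lemma arrivals_flat:
  assumes T: "T > 0" and cd: "exit_pair T c m0 w p" and rs: "0 \<le> r" "r < s" "s \<le> T"
    and eq: "arrivals T w p r = arrivals T w p s"
  shows "arrivals T w p s = 0"
proof -
  obtain X where X: "continuous_on UNIV X" "exp_growth X" and c: "continuous_on {0..T} (arrivals T w p)"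
    and d: "\<And>s. s \<in> {0<..<T} \<Longrightarrow> (arrivals T w p has_real_derivative heat_flow_y X 0 s * w j0 0 (T - s)) (at s)"
    and n: "\<And>s. s \<in> {0<..<T} \<Longrightarrow> heat_flow_y X 0 s \<ge> 0" "\<And>s. s \<in> {0<..<T} \<Longrightarrow> w j0 0 (T - s) > 0"
    by (rule arrivals_deriv[OF T cd]) (rule that; assumption)
  define a where "a = (r + s) / 2"
  have a: "0 < a" "r < a" "a < s" using rs by (auto simp: a_def)
  have const: "arrivals T w p z = arrivals T w p s" if "z \<in> {r<..<s}" for z
    using arrivals_mono[OF T cd, of r z] arrivals_mono[OF T cd, of z s] that rs eq by auto
  have flux0: "heat_flow_y X 0 z = 0" if z: "z \<in> {a<..<s}" for z
  proof -
    have zT: "z \<in> {0<..<T}" using z a rs by auto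
    have "((\<lambda>_. arrivals T w p s) has_real_derivative heat_flow_y X 0 z * w j0 0 (T - z)) (at z)"
      by (rule has_field_derivative_transform_within_open[OF d[OF zT], of "{r<..<s}"]) (use const z a in auto)
    then have "heat_flow_y X 0 z * w j0 0 (T - z) = 0" by (rule DERIV_unique[OF _ DERIV_const])
    then show ?thesis using n(2)[OF zT] by simp
  qed
  have "heat_flow_y X 0 z = 0" if "z > 0" for z
    using heat_flow_y_unique_continuation[OF X a(1,3) flux0 that] by simp
  then have "(arrivals T w p has_real_derivative 0) (at z)" if "0 < z" "z < T" for z
    using d[of z] that by simp
  then have "arrivals T w p s = arrivals T w p 0"
    using DERIV_isconst2[of 0 T "arrivals T w p" s] c rs T by auto
  then show ?thesis by (simp add: arrivals_0)
qed

text \<open>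
  The maximum principle transfers the distance \<open>\<eta>\<close> of the boundary values first to \<open>w\<close>, then through the
  initial value \<open>m0 / w\<close> with \<open>w \<ge> 1\<close> to \<open>p\<close>, and so to the density \<open>p * w\<close> at all times.
\<close>

lemma arrivals_close:
  assumes T: "T > 0" and cd: "exit_pair T c m0 w p" and cd': "exit_pair T c' m0 w' p'"
    and M: "\<And>x. x \<in> net_points N \<Longrightarrow> \<bar>m0 x\<bar> \<le> M" "M \<ge> 0"
    and G: "\<And>s. s \<in> {0..T} \<Longrightarrow> exp (1/2 * c s) \<le> G"
    and \<eta>: "\<And>s. s \<in> {0..T} \<Longrightarrow> \<bar>exp (1/2 * c s) - exp (1/2 * c' s)\<bar> \<le> \<eta>"
    and s: "s \<in> {0..T}"
  shows "\<bar>arrivals T w p s - arrivals T w' p' s\<bar> \<le> 2 * ((\<Sum>j\<in>J. len j) * (M * (G + 1))) * \<eta>"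
proof -
  from cd obtain wy wt py pt where w: "heat_sol T w wy wt" and p: "heat_sol T p py pt"
    unfolding exit_pair_def hopf_cole_def by blast
  from cd' obtain wy' wt' py' pt' where w': "heat_sol T w' wy' wt'" and p': "heat_sol T p' py' pt'"
    unfolding exit_pair_def hopf_cole_def by blast
  have h: "hopf_cole T c m0 w p" and h': "hopf_cole T c' m0 w' p'" using cd cd' unfolding exit_pair_def by auto
  note w1 = hopf_coleD(1)[OF h] hopf_coleD(1)[OF h']
  note w0 = hopf_coleD(2)[OF h] hopf_coleD(2)[OF h']
  note wb = hopf_coleD(3)[OF h] hopf_coleD(3)[OF h']
  note p0 = hopf_coleD(4)[OF h] hopf_coleD(4)[OF h']
  note pb = hopf_coleD(5)[OF h] hopf_coleD(5)[OF h']
  have v0: "fst e = j0" "end_pos e = 0" if "e \<in> ends_at (vertex N i0)" for e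
    using that by (auto simp: ends_at_exit end_pos_def)
  have TT: "T \<in> {0..T}" "0 \<in> {0..T}" using T by auto
  have \<eta>0: "\<eta> \<ge> 0" using \<eta>[OF TT(1)] by linarith
  have rT: "T - t \<in> {0..T}" if "t \<in> {0..T}" for t using that by auto
  have dw: "\<bar>w j y t - w' j y t\<bar> \<le> \<eta>" if "j \<in> J" "y \<in> {0..len j}" "t \<in> {0..T}" for j y t
  proof (rule heat_sol_compare[OF w w' T _ _ that])
    show "\<bar>w j y 0 - w' j y 0\<bar> \<le> \<eta>" if "j \<in> J" "y \<in> {0..len j}" for j y
      using \<eta>[OF TT(1)] w0[OF that] by simp
    show "\<bar>w (fst e) (end_pos e) t - w' (fst e) (end_pos e) t\<bar> \<le> \<eta>" if "e \<in> ends_at (vertex N i0)" "t \<in> {0..T}" for e t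
      using \<eta>[OF rT[OF that(2)]] wb[OF that(2)] unfolding v0[OF that(1)] by simp
  qed
  have bw: "w j y t \<le> G" if "j \<in> J" "y \<in> {0..len j}" "t \<in> {0..T}" for j y t
  proof (rule max_principle[OF w T _ _ that])
    show "w j y 0 \<le> G" if "j \<in> J" "y \<in> {0..len j}" for j y using G[OF TT(1)] w0[OF that] by simp
    show "w (fst e) (end_pos e) t \<le> G" if "e \<in> ends_at (vertex N i0)" "t \<in> {0..T}" for e t
      using G[OF rT[OF that(2)]] wb[OF that(2)] unfolding v0[OF that(1)] by simp
  qed
  have bp: "\<bar>p' j y t - 0\<bar> \<le> M" if "j \<in> J" "y \<in> {0..len j}" "t \<in> {0..T}" for j y t
  proof (rule heat_sol_compare[OF p' heat_sol_const T _ _ that])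
    show "\<bar>p' j y 0 - 0\<bar> \<le> M" if "j \<in> J" "y \<in> {0..len j}" for j y
    proof -
      have "\<bar>m0 (\<pi> j y)\<bar> / w' j y T \<le> M / 1"
        using M(1)[OF net_pointI[OF that]] w1(2)[OF that TT(1)] M(2) by (intro frac_le) auto
      then show ?thesis using w1(2)[OF that TT(1)] p0(2)[OF that] by (simp add: abs_divide)
    qed
    show "\<bar>p' (fst e) (end_pos e) t - 0\<bar> \<le> M" if "e \<in> ends_at (vertex N i0)" "t \<in> {0..T}" for e t
      using pb(2)[OF that(2)] M(2) unfolding v0[OF that(1)] by simp
  qed
  have dp: "\<bar>p j y t - p' j y t\<bar> \<le> M * \<eta>" if "j \<in> J" "y \<in> {0..len j}" "t \<in> {0..T}" for j y t
  proof (rule heat_sol_compare[OF p p' T _ _ that])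
    show "\<bar>p j y 0 - p' j y 0\<bar> \<le> M * \<eta>" if "j \<in> J" "y \<in> {0..len j}" for j y
    proof -
      let ?a = "w j y T" and ?b = "w' j y T" and ?m = "m0 (\<pi> j y)"
      have ab: "?a \<ge> 1" "?b \<ge> 1" using w1[OF that TT(1)] by auto
      then have ab1: "1 \<le> ?a * ?b" using mult_mono[of 1 ?a 1 ?b] by simp
      have "p j y 0 - p' j y 0 = ?m * (?b - ?a) / (?a * ?b)"
        using ab unfolding p0[OF that] by (simp add: field_simps)
      also have "\<bar>\<dots>\<bar> = \<bar>?m\<bar> * \<bar>?a - ?b\<bar> / (?a * ?b)"
        using ab by (simp add: abs_mult abs_divide abs_minus_commute)
      also have "\<dots> \<le> (M * \<eta>) / 1"
        using M(1)[OF net_pointI[OF that]] M(2) dw[OF that TT(1)] ab1 \<eta>0 by (intro frac_le mult_mono) auto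
      finally show ?thesis by simp
    qed
    show "\<bar>p (fst e) (end_pos e) t - p' (fst e) (end_pos e) t\<bar> \<le> M * \<eta>" if "e \<in> ends_at (vertex N i0)" "t \<in> {0..T}" for e t
      using pb[OF that(2)] M(2) \<eta>0 unfolding v0[OF that(1)] by simp
  qed
  \<comment> \<open>Integrate the pointwise bound on each edge.\<close>
  have close: "\<bar>mass T p w r - mass T p' w' r\<bar> \<le> ((\<Sum>j\<in>J. len j) * (M * (G + 1))) * \<eta>" if r: "r \<in> {0..T}" for r
  proof -
    have edge: "\<bar>integral {0..len j} (\<lambda>y. p j y r * w j y (T - r)) - integral {0..len j} (\<lambda>y. p' j y r * w' j y (T - r))\<bar>
        \<le> (M * (G + 1) * \<eta>) * (len j - 0)" if j: "j \<in> J" for j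
    proof -
      have cont: "continuous_on {0..len j} (\<lambda>y. f j y t)" if "heat_sol T f fy ft" "t \<in> {0..T}" for f fy ft t
        by (rule continuous_on_compose2[OF C21D(1)[OF heat_solD(1)[OF that(1) j]], of _ "\<lambda>y. (y, t)", simplified])
          (use that in \<open>auto intro!: continuous_intros\<close>)
      note c = cont[OF p r] cont[OF w rT[OF r]] cont[OF p' r] cont[OF w' rT[OF r]]
      have c1: "continuous_on {0..len j} (\<lambda>y. p j y r * w j y (T - r))" "continuous_on {0..len j} (\<lambda>y. p' j y r * w' j y (T - r))"
        by (intro continuous_on_mult c)+
      have "norm (integral {0..len j} (\<lambda>y. p j y r * w j y (T - r) - p' j y r * w' j y (T - r))) \<le> (M * (G + 1) * \<eta>) * (len j - 0)"
      proof (rule integral_bound)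
        show "continuous_on {0..len j} (\<lambda>y. p j y r * w j y (T - r) - p' j y r * w' j y (T - r))"
          by (intro continuous_on_diff c1)
        fix y assume y: "y \<in> {0..len j}"
        let ?w = "w j y (T - r)" and ?w' = "w' j y (T - r)"
        have "p j y r * ?w - p' j y r * ?w' = (p j y r - p' j y r) * ?w + p' j y r * (?w - ?w')" by (simp add: algebra_simps)
        also have "\<bar>\<dots>\<bar> \<le> \<bar>p j y r - p' j y r\<bar> * \<bar>?w\<bar> + \<bar>p' j y r\<bar> * \<bar>?w - ?w'\<bar>"
          by (rule order.trans[OF abs_triangle_ineq]) (simp add: abs_mult)
        also have "\<dots> \<le> (M * \<eta>) * G + M * \<eta>"
          using dp[OF j y r] bw[OF j y rT[OF r]] w1(1)[OF j y rT[OF r]] bp[OF j y r] dw[OF j y rT[OF r]] M(2) \<eta>0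
          by (intro add_mono mult_mono) auto
        finally show "norm (p j y r * ?w - p' j y r * ?w') \<le> M * (G + 1) * \<eta>" by (simp add: algebra_simps)
      qed (use len_pos[OF j] in simp)
      then show ?thesis
        using integral_diff[OF integrable_continuous_real[OF c1(1)] integrable_continuous_real[OF c1(2)]] by simp
    qed
    have "\<bar>mass T p w r - mass T p' w' r\<bar> = \<bar>\<Sum>j\<in>J. integral {0..len j} (\<lambda>y. p j y r * w j y (T - r)) - integral {0..len j} (\<lambda>y. p' j y r * w' j y (T - r))\<bar>"
      by (simp add: mass_def sum_subtractf)
    also have "\<dots> \<le> (\<Sum>j\<in>J. (M * (G + 1) * \<eta>) * (len j - 0))"
      by (intro order.trans[OF sum_abs] sum_mono edge)
    also have "(\<Sum>j\<in>J. (M * (G + 1) * \<eta>) * (len j - 0)) = (M * (G + 1) * \<eta>) * (\<Sum>j\<in>J. len j)"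
      by (simp only: diff_zero sum_distrib_left)
    finally show ?thesis by (simp only: mult_ac)
  qed
  show ?thesis using close[OF TT(2)] close[OF s] unfolding arrivals_def by linarith
qed

lemma net_points_compact: "compact (net_points N)"
proof -
  have "compact (edge N j)" if "j \<in> J" for j
    unfolding edge_def by (intro compact_continuous_image param_cont that) simp
  moreover have "finite (vertices N)" using net by (auto simp: is_network_def vertices_def)
  ultimately show ?thesis
    unfolding net_points_def by (intro compact_Un compact_UN finJ finite_imp_compact[of "vertices N"])
qed

text \<open>
  For each announced time \<open>\<tau>\<close> a pair of heat solutions is chosen. Since \<open>(\<tau>, s) \<mapsto> exp (c \<tau> s / 2)\<close> is
  uniformly continuous on a compact square, the diagonal \<open>\<tau> \<mapsto> F \<tau> \<tau>\<close> of the arrival distributions is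
  continuous. All solutions of the system share this distribution, so the fixed point found for it is
  coherent for each of them.
\<close>

lemma coherent_time_exists:
  fixes c :: "real \<Rightarrow> real \<Rightarrow> real"
  assumes T: "0 < t0" "t0 < T" and \<theta>: "0 < \<theta>"
    and c: "\<And>\<tau>. smooth3 (c \<tau>)" "\<And>\<tau> s. \<tau> \<in> {0..T} \<Longrightarrow> s \<in> {0..T} \<Longrightarrow> c \<tau> s \<ge> 0"
    and cc: "continuous_on UNIV (\<lambda>(\<tau>, s). c \<tau> s)"
    and m0: "continuous_on (net_points N) m0" "m0 (vertex N i0) = 0" "\<And>x. x \<in> net_points N \<Longrightarrow> m0 x \<ge> 0"
  shows "\<exists>\<tau>\<in>{t0..T}. (\<exists>u m. MFG_solution N i0 T (c \<tau>) m0 u m) \<and>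
    (\<forall>u m. MFG_solution N i0 T (c \<tau>) m0 u m \<longrightarrow> quorum_time t0 T \<theta> (arrival_cdf N i0 j0 m) = \<tau>)"
proof -
  have T0: "T > 0" using T by simp
  have "\<exists>w p. exit_pair T (c \<tau>) m0 w p" if "\<tau> \<in> {0..T}" for \<tau>
    by (rule exit_pair_exists[OF T0 c(1) c(2)[OF that] m0])
  then obtain W P where WP: "\<And>\<tau>. \<tau> \<in> {0..T} \<Longrightarrow> exit_pair T (c \<tau>) m0 (W \<tau>) (P \<tau>)" by metis
  define F where "F \<tau> = arrivals T (W \<tau>) (P \<tau>)" for \<tau>
  have sub: "\<tau> \<in> {0..T}" if "\<tau> \<in> {t0..T}" for \<tau> using that T by auto
  obtain M where M: "\<And>x. x \<in> net_points N \<Longrightarrow> \<bar>m0 x\<bar> \<le> M" "M \<ge> 0"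
  proof -
    have "bounded (m0 ` net_points N)"
      by (intro compact_imp_bounded compact_continuous_image m0(1) net_points_compact)
    then obtain B where "B > 0" "\<forall>x\<in>m0 ` net_points N. norm x \<le> B" using bounded_pos by blast
    then show ?thesis using that[of B] by auto
  qed
  let ?g = "\<lambda>q. exp (1/2 * c (fst q) (snd q))"
  let ?K = "{0..T} \<times> {0..T}"
  have gc: "continuous_on ?K ?g"
  proof -
    have "continuous_on ?K (\<lambda>q. c (fst q) (snd q))" using continuous_on_subset[OF cc, of ?K] by (simp add: case_prod_beta)
    then show ?thesis by (intro continuous_intros)
  qed
  have Kc: "compact ?K" by (intro compact_Times) auto
  obtain G where G: "\<And>q. q \<in> ?K \<Longrightarrow> ?g q \<le> G" "G \<ge> 0"
  proof -
    have "bounded (?g ` ?K)" by (intro compact_imp_bounded compact_continuous_image gc Kc)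
    then obtain B where "B > 0" "\<forall>x\<in>?g ` ?K. norm x \<le> B" using bounded_pos by blast
    then show ?thesis using that[of B] by auto
  qed
  define C where "C = 2 * ((\<Sum>j\<in>J. len j) * (M * (G + 1)))"
  have C: "C \<ge> 0" unfolding C_def using M(2) G(2) len_pos by (intro mult_nonneg_nonneg sum_nonneg) (auto intro: less_imp_le)
  have uc: "uniformly_continuous_on ?K ?g" by (rule compact_uniformly_continuous[OF gc Kc])
  have "continuous_on {t0..T} (\<lambda>\<tau>. F \<tau> \<tau>)"
    unfolding continuous_on_iff
  proof (intro ballI allI impI)
    fix \<tau> and \<epsilon> :: real assume \<tau>: "\<tau> \<in> {t0..T}" and \<epsilon>: "\<epsilon> > 0"
    define \<eta> where "\<eta> = \<epsilon> / (2 * (C + 1))"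
    have "\<eta> > 0" using \<epsilon> C by (simp add: \<eta>_def)
    then obtain d1 where d1: "d1 > 0" "\<And>q q'. q \<in> ?K \<Longrightarrow> q' \<in> ?K \<Longrightarrow> dist q' q < d1 \<Longrightarrow> dist (?g q') (?g q) < \<eta>"
      using uniformly_continuous_onE[OF uc \<open>\<eta> > 0\<close>] by metis
    have "continuous_on {0..T} (F \<tau>)"
      unfolding F_def by (rule arrivals_deriv[OF T0 WP[OF sub[OF \<tau>]]])
    then obtain d2 where d2: "d2 > 0" "\<And>s. s \<in> {0..T} \<Longrightarrow> dist s \<tau> < d2 \<Longrightarrow> dist (F \<tau> s) (F \<tau> \<tau>) < \<epsilon> / 2"
      using sub[OF \<tau>] \<epsilon> unfolding continuous_on_iff by (metis half_gt_zero)
    show "\<exists>d>0. \<forall>\<tau>'\<in>{t0..T}. dist \<tau>' \<tau> < d \<longrightarrow> dist (F \<tau>' \<tau>') (F \<tau> \<tau>) < \<epsilon>"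
    proof (intro exI[of _ "min d1 d2"] conjI ballI impI)
      show "0 < min d1 d2" using d1 d2 by simp
      fix \<tau>' assume \<tau>': "\<tau>' \<in> {t0..T}" "dist \<tau>' \<tau> < min d1 d2"
      have "\<bar>F \<tau> \<tau>' - F \<tau>' \<tau>'\<bar> \<le> C * \<eta>"
        unfolding F_def C_def
      proof (rule arrivals_close[OF T0 WP[OF sub[OF \<tau>]] WP[OF sub[OF \<tau>'(1)]] _ M(2) _ _ sub[OF \<tau>'(1)]])
        show "\<bar>m0 x\<bar> \<le> M" if "x \<in> net_points N" for x using M(1)[OF that] .
        show "exp (1/2 * c \<tau> s) \<le> G" if "s \<in> {0..T}" for s using G(1)[of "(\<tau>, s)"] that sub[OF \<tau>] by simp
        show "\<bar>exp (1/2 * c \<tau> s) - exp (1/2 * c \<tau>' s)\<bar> \<le> \<eta>" if "s \<in> {0..T}" for s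
        proof -
          have "dist (?g (\<tau>, s)) (?g (\<tau>', s)) < \<eta>"
            by (rule d1(2)) (use that sub[OF \<tau>] sub[OF \<tau>'(1)] \<tau>'(2) in \<open>auto simp: dist_Pair_Pair dist_commute\<close>)
          then show ?thesis by (simp add: dist_real_def)
        qed
      qed
      also have "\<dots> < \<epsilon> / 2"
      proof -
        have "C * \<epsilon> < (C + 1) * \<epsilon>" using \<epsilon> by simp
        then show ?thesis using C by (simp add: \<eta>_def field_simps)
      qed
      finally have "\<bar>F \<tau> \<tau>' - F \<tau>' \<tau>'\<bar> < \<epsilon> / 2" .
      moreover have "\<bar>F \<tau> \<tau>' - F \<tau> \<tau>\<bar> < \<epsilon> / 2"
        using d2(2)[OF sub[OF \<tau>'(1)]] \<tau>'(2) by (simp add: dist_real_def)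
      ultimately show "dist (F \<tau>' \<tau>') (F \<tau> \<tau>) < \<epsilon>" unfolding dist_real_def by linarith
    qed
  qed
  then have "\<exists>\<tau>\<in>{t0..T}. quorum_time t0 T \<theta> (F \<tau>) = \<tau>"
  proof (rule quorum_fixed_point[OF T \<theta>, rotated 2])
    fix \<tau> r s assume \<tau>: "\<tau> \<in> {t0..T}"
    note cd = WP[OF sub[OF \<tau>]]
    show "0 \<le> r \<Longrightarrow> r \<le> s \<Longrightarrow> s \<le> T \<Longrightarrow> F \<tau> r \<le> F \<tau> s"
      unfolding F_def by (rule arrivals_mono[OF T0 cd])
    show "0 \<le> r \<Longrightarrow> r < s \<Longrightarrow> s \<le> T \<Longrightarrow> F \<tau> r = F \<tau> s \<Longrightarrow> F \<tau> s = 0"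
      unfolding F_def by (rule arrivals_flat[OF T0 cd])
  qed
  then obtain \<tau> where \<tau>: "\<tau> \<in> {t0..T}" "quorum_time t0 T \<theta> (F \<tau>) = \<tau>" by blast
  have hc: "hopf_cole T (c \<tau>) m0 (W \<tau>) (P \<tau>)" using WP[OF sub[OF \<tau>(1)]] by (simp add: exit_pair_def)
  show ?thesis
  proof (intro bexI[OF _ \<tau>(1)] conjI allI impI)
    show "\<exists>u m. MFG_solution N i0 T (c \<tau>) m0 u m" by (rule MFG_exists[OF T0 hc])
    fix u m assume "MFG_solution N i0 T (c \<tau>) m0 u m"
    then have "arrival_cdf N i0 j0 m s = F \<tau> s" if "s \<in> {0..T}" for s
      using arrival_cdf_eq_mass_loss[OF T0 hc _ that] by (simp add: F_def arrivals_def)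
    then have "quorum_time t0 T \<theta> (arrival_cdf N i0 j0 m) = quorum_time t0 T \<theta> (F \<tau>)"
      by (rule quorum_time_cong)
    then show "quorum_time t0 T \<theta> (arrival_cdf N i0 j0 m) = \<tau>" using \<tau>(2) by simp
  qed
qed

end

theorem corollary4p1:
  fixes N :: "('i, 'j, 'n::finite) network" and i0 :: 'i and j0 :: 'j
    and t0 Tmax \<theta> \<alpha> :: real and c1 c2 c3 :: "real \<Rightarrow> real" and m0 :: "real ^ 'n \<Rightarrow> real"
  assumes "is_network N" and "boundary_idx N = {i0}"
    and "Inc N i0 = {j0}" and "edge_param N j0 0 = vertex N i0"
    and "0 < t0" and "t0 < Tmax" and "0 < \<theta>" and "\<theta> < 1"
    and "penalty c1" and "penalty c2" and "penalty c3"
    and "prob_density N m0"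
    and "0 < \<alpha>" and "\<alpha> < 1"
    and "\<And>T. T \<in> {0..Tmax} \<Longrightarrow> hoelder_on {0..Tmax} 1 (\<alpha>/2) (meeting_cost c1 c2 c3 t0 T)"
    and "\<And>T s. T \<in> {0..Tmax} \<Longrightarrow> s \<in> {0..Tmax} \<Longrightarrow> meeting_cost c1 c2 c3 t0 T s \<ge> 0"
    and "\<And>T \<epsilon>. T \<in> {0..Tmax} \<Longrightarrow> \<epsilon> > 0 \<Longrightarrow>
          \<exists>\<delta>>0. \<forall>T'\<in>{0..Tmax}. \<bar>T' - T\<bar> < \<delta> \<longrightarrow>
            hoelder_norm {0..Tmax} 1 (\<alpha>/2) (\<lambda>s. meeting_cost c1 c2 c3 t0 T' s - meeting_cost c1 c2 c3 t0 T s) < \<epsilon>"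
    and "hoelder_net N 2 \<alpha> m0" and "m0 (vertex N i0) = 0"
    and "edge_deriv N j0 1 m0 (vertex N i0) > 0 \<or>
         edge_deriv N j0 1 m0 (vertex N i0) = 0 \<and> edge_deriv N j0 2 m0 (vertex N i0) = 0"
  shows "\<exists>T\<in>{t0..Tmax}.
           (\<exists>u m. MFG_solution N i0 Tmax (meeting_cost c1 c2 c3 t0 T) m0 u m) \<and>
           (\<forall>u m. MFG_solution N i0 Tmax (meeting_cost c1 c2 c3 t0 T) m0 u m \<longrightarrow>
              quorum_time t0 Tmax \<theta> (arrival_cdf N i0 j0 m) = T)"
proof -
  interpret exit_network N i0 j0 by unfold_locales (use assms in auto)
  have c: "smooth3 c1" "smooth3 c2" "smooth3 c3"
    using assms by (auto simp: penalty_def intro: smooth_on_imp_smooth3)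
  have cont: "continuous_on UNIV c1" "continuous_on UNIV c2" "continuous_on UNIV c3"
    using c unfolding smooth3_def by (blast intro: DERIV_continuous_on)+
  have smooth: "smooth3 (meeting_cost c1 c2 c3 t0 \<tau>)" for \<tau>
    unfolding meeting_cost_def[abs_def]
    using smooth3_add[OF smooth3_add[OF smooth3_affine[OF c(1), of 1 "- t0"] smooth3_affine[OF c(2), of 1 "- \<tau>"]]
        smooth3_affine[OF c(3), of "-1" \<tau>]]
    by simp
  have "continuous_on UNIV (\<lambda>q. c1 (snd q - t0) + c2 (snd q - fst q) + c3 (fst q - snd q))"
    by (intro continuous_intros continuous_on_compose2[OF cont(1)] continuous_on_compose2[OF cont(2)] continuous_on_compose2[OF cont(3)]) auto
  then have joint: "continuous_on UNIV (\<lambda>(\<tau>, s). meeting_cost c1 c2 c3 t0 \<tau> s)"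
    by (simp add: meeting_cost_def case_prod_beta)
  have m0: "continuous_on (net_points N) m0" "\<And>x. x \<in> net_points N \<Longrightarrow> m0 x \<ge> 0"
    using assms by (auto simp: hoelder_net_def prob_density_def)
  show ?thesis
    by (rule coherent_time_exists[OF assms(5-7) smooth assms(16) joint m0(1) assms(19) m0(2)])
qed

end
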